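(* Let $\{\alpha_{n,k}\in[0,1] : 0\le k\le n,\ n\ge 1\}$ be a triangular array of parameters and let $\gamma:[0,1]\to[0,1]$ be a curve. Suppose that $\gamma$ is piecewise Hölder continuous with exponent $\theta\in(0,1]$ (i.e. there is a finite partition of $[0,1]$ into disjoint intervals such that $\gamma$ is Hölder continuous with exponent $\theta$ on each of them), that $$\overline{\gamma([0,1])}\subset[0,\beta_*]$$ for some $\beta_*\in(0,1)$, and that $$\lim_{n\to\infty} n^{\theta}\sup_{t\in[0,1]}|\alpha_{n,\lfloor nt\rfloor}-\gamma_t|<\infty .$$ Let $T_{n,k}=T_{\alpha_{n,k}}$. For $f\in C([0,1])$ let $f_{n,k}=f\circ T_{n,k}\circ\dots\circ T_{n,1}$ (with $f_{n,0}=f$), and $$\zeta_n(x,t)=\int_0^t f_{n,\lfloor ns\rfloor}(x)\,ds,\qquad \zeta(t)=\int_0^t\hat\mu_{\gamma_s}(f)\,ds .$$ (i) If $\beta_*\ge\frac12$, then for each $f\in C([0,1])$, $$\lim_{n\to\infty}\sup_{t\in[0,1]}|\zeta_n(x,t)-\zeta(t)|=0$$ in probability with respect to the Lebesgue measure $m$ on $[0,1]$; that is, for all $\varepsilon>0$, $$\lim_{n\to\infty}m\Big(\Big\{x\in[0,1] : \sup_{t\in[0,1]}|\zeta_n(x,t)-\zeta(t)|\ge\varepsilon\Big\}\Big)=0 .$$ (ii) If $\beta_*<\frac12$, then for each $f\in C([0,1])$, $$\lim_{n\to\infty}\sup_{t\in[0,1]}|\zeta_n(x,t)-\zeta(t)|=0$$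 for Lebesgue almost every $x\in[0,1]$. Moreover, the one-parameter family of measures $\mathscr{P}=(\hat\mu_{\gamma_t})_{t\in[0,1]}$ is the unique physical family of measures, and it has a basin $A$ of full measure, i.e. $m(A)=1$.
   Context: For $\alpha\in[0,1]$ the Pomeau--Manneville map $T_\alpha:[0,1]\to[0,1]$ is $$T_\alpha(x)=\begin{cases}x(1+2^\alpha x^\alpha), & x\in[0,\tfrac12),\\ 2x-1, & x\in[\tfrac12,1].\end{cases}$$ For $0\le\alpha<1$, $\hat\mu_\alpha$ denotes the SRB measure of $T_\alpha$, i.e. the $T_\alpha$-invariant probability measure equivalent to Lebesgue measure on $[0,1]$, and $\hat\mu_\alpha(f)=\int f\,d\hat\mu_\alpha$. $m$ is the Lebesgue measure on $[0,1]$, and $\gamma_t=\gamma(t)$. Physical family of measures (for the array $\{T_{n,k}\}$): let $\mathscr{P}=(\mu_t)_{t\in[0,1]}$ be a one-parameter family of measures on $[0,1]$ such that $t\mapsto\mu_t(f)$ is measurable for every bounded continuous $f:[0,1]\to\mathbb{R}$. If there is a measurable set $A\subset[0,1]$ with $m(A)>0$ such that $$\lim_{n\to\infty}\int_0^t f_{n,\lfloor ns\rfloor}(x)\,ds=\int_0^t\mu_s(f)\,ds,\qquad t\in[0,1],$$ for all $x\in A$ and all bounded continuous $f:[0,1]\to\mathbb{R}$, then $\mathscr{P}$ is called a physical family of measures and $A$ is called a basin of $\mathscr{P}$. Two physical families $(\mu_t)_{t\in[0,1]}$ and $(\mu'_t)_{t\in[0,1]}$ are considered the same if $\mu_t=\mu'_t$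 except for a set of parameters $t$ of zero Lebesgue measure; uniqueness is understood in this sense. *)

theory Defs
  imports "HOL-Probability.Probability"
begin

text \<open>The value of \<open>T\<^sub>\<alpha>\<close> outside \<open>[0,1]\<close> is irrelevant. The convention \<open>0 powr 0 = 0\<close> does no harm
  at \<open>x = 0\<close>, because of the factor \<open>x\<close>.\<close>

definition PM_map :: "real \<Rightarrow> real \<Rightarrow> real" where
  "PM_map \<alpha> x = (if x < 1/2 then x * (1 + 2 powr \<alpha> * x powr \<alpha>) else 2 * x - 1)"

abbreviation leb01 :: "real measure" where
  "leb01 \<equiv> lebesgue_on {0..1}"

text \<open>Measures on \<open>[0,1]\<close> are Borel measures. Equivalence to Lebesgue measure is stated for its
  restriction to the Borel sets, the \<open>\<sigma>\<close>-algebra on which \<open>\<mu>\<close> lives.\<close>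

definition is_SRB :: "real \<Rightarrow> real measure \<Rightarrow> bool" where
  "is_SRB \<alpha> \<mu> \<longleftrightarrow>
     sets \<mu> = sets (restrict_space borel {0..1}) \<and>
     prob_space \<mu> \<and>
     distr \<mu> \<mu> (PM_map \<alpha>) = \<mu> \<and>
     absolutely_continuous (restrict_space lborel {0..1}) \<mu> \<and>
     absolutely_continuous \<mu> (restrict_space lborel {0..1})"

definition SRB :: "real \<Rightarrow> real measure" where
  "SRB \<alpha> = (THE \<mu>. is_SRB \<alpha> \<mu>)"

definition holder_on :: "real \<Rightarrow> real set \<Rightarrow> (real \<Rightarrow> real) \<Rightarrow> bool" where
  "holder_on \<theta> I g \<longleftrightarrow> (\<exists>C. \<forall>s\<in>I. \<forall>t\<in>I. \<bar>g s - g t\<bar> \<le> C * \<bar>s - t\<bar> powr \<theta>)"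

definition piecewise_holder :: "real \<Rightarrow> (real \<Rightarrow> real) \<Rightarrow> bool" where
  "piecewise_holder \<theta> g \<longleftrightarrow>
     (\<exists>P. finite P \<and> partition_on {0..1} P \<and> (\<forall>I\<in>P. is_interval I \<and> holder_on \<theta> I g))"

text \<open>\<open>PM_orbit \<alpha> n k = T\<^sub>n\<^sub>,\<^sub>k \<circ> \<dots> \<circ> T\<^sub>n\<^sub>,\<^sub>1\<close> for the array \<open>\<alpha>\<close>; the entry \<open>\<alpha> n 0\<close> is not used.\<close>

primrec PM_orbit :: "(nat \<Rightarrow> nat \<Rightarrow> real) \<Rightarrow> nat \<Rightarrow> nat \<Rightarrow> real \<Rightarrow> real" where
  "PM_orbit \<alpha> n 0 = id"
| "PM_orbit \<alpha> n (Suc k) = PM_map (\<alpha> n (Suc k)) \<circ> PM_orbit \<alpha> n k"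

definition zeta_n :: "(nat \<Rightarrow> nat \<Rightarrow> real) \<Rightarrow> (real \<Rightarrow> real) \<Rightarrow> nat \<Rightarrow> real \<Rightarrow> real \<Rightarrow> real" where
  "zeta_n \<alpha> f n x t = (LINT s:{0..t}|lebesgue. f (PM_orbit \<alpha> n (nat \<lfloor>real n * s\<rfloor>) x))"

definition family_integral :: "(real \<Rightarrow> real measure) \<Rightarrow> (real \<Rightarrow> real) \<Rightarrow> real \<Rightarrow> real" where
  "family_integral \<mu> f t = (LINT s:{0..t}|lebesgue. (LINT x|\<mu> s. f x))"

text \<open>Continuous functions on \<open>[0,1]\<close> are automatically bounded, so boundedness of the test
  functions is not mentioned. Finiteness of each \<open>\<mu> t\<close> makes \<open>\<mu>\<^sub>t(f)\<close> well defined
  for all of them, in particular for \<open>f = 1\<close>.\<close>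

definition measurable_family :: "(real \<Rightarrow> real measure) \<Rightarrow> bool" where
  "measurable_family \<mu> \<longleftrightarrow>
     (\<forall>t\<in>{0..1}. finite_measure (\<mu> t) \<and> sets (\<mu> t) = sets (restrict_space borel {0..1})) \<and>
     (\<forall>f :: real \<Rightarrow> real. continuous_on {0..1} f \<longrightarrow> (\<lambda>t. LINT x|\<mu> t. f x) \<in> borel_measurable leb01)"

definition is_basin :: "(nat \<Rightarrow> nat \<Rightarrow> real) \<Rightarrow> (real \<Rightarrow> real measure) \<Rightarrow> real set \<Rightarrow> bool" where
  "is_basin \<alpha> \<mu> A \<longleftrightarrow>
     A \<in> sets leb01 \<and> measure leb01 A > 0 \<and>
     (\<forall>x\<in>A. \<forall>f. continuous_on {0..1} f \<longrightarrow>
        (\<forall>t\<in>{0..1}. (\<lambda>n. zeta_n \<alpha> f n x t) \<longlonglongrightarrow> family_integral \<mu> f t))"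

definition physical_family :: "(nat \<Rightarrow> nat \<Rightarrow> real) \<Rightarrow> (real \<Rightarrow> real measure) \<Rightarrow> bool" where
  "physical_family \<alpha> \<mu> \<longleftrightarrow> measurable_family \<mu> \<and> (\<exists>A. is_basin \<alpha> \<mu> A)"

end

theory Submission
  imports Defs
begin

text \<open>
  Loss of memory is proved by coupling. The transfer operators preserve the decreasing densities, and a
  decreasing density stays decreasing when a constant is subtracted. If two decreasing densities of
  equal mass are not concentrated near \<open>0\<close>, then after a bounded number of steps both exceed a fixed
  fraction of their mass, which can be removed from both. Otherwise the potential \<open>x powr - q\<close> drops by
  a multiple of the mass that is left. For \<open>q > b\<close>, where \<open>b < 1\<close> bounds the parameters, the remaining
  mass is therefore summable in time, as long as the initial potential is finite. All densities
  are bounded by a multiple of \<open>x powr - b\<close>, so this is the case if \<open>q < 1 - b\<close>, which leaves room for \<open>q\<close>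
  if \<open>b < 1/2\<close>; otherwise the potential is cut off at a small \<open>s\<close>.

  Products of decreasing observables along the orbit keep the density decreasing. Hence correlations
  decay at the same rate. For \<open>b < 1\<close> the variance of the averages tends to \<open>0\<close>; for \<open>b < 1/2\<close> the
  fourth moment is summable in \<open>n\<close>, and Borel--Cantelli applies although the rows of the array are
  unrelated. The means converge because the last \<open>L\<close> maps before time \<open>ns\<close> have parameters close
  to \<open>\<gamma> s\<close>, while everything earlier is forgotten.
\<close>

section \<open>The maps and their transfer operators\<close>

text \<open>The parameter may change at every step, so there is no common invariant density to
  compare with; constants take its place, as the part that any two decreasing densities share.
  Uniformity in the parameters rests on one comparison, \<open>x powr b \<le> (2 * x) powr a\<close>
  for a in [0,b] and 0 < x \<le> 1/2. It makes every left step expand by a relative amount of at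
  least \<open>x powr b\<close>, and this single rate yields both the density bound
  \<open>x powr - b\<close> and a drop of the potential of order \<open>x powr (b - q)\<close>. The
  latter is as large as desired near 0 exactly because b < q, so it can beat the potential of the
  mass that the right branch throws back towards 0. For b < 1/2 the choice q = 1/2 meets both b < q
  and q < 1 - b. The variance of the averages is then only bounded by a multiple of 1/n, which is
  not summable; this forces the fourth moment. One null set has to serve all f and all times, hence
  the reduction to countably many decreasing observables and to rational times.\<close>

abbreviation lb01 :: "real measure" where
  "lb01 \<equiv> restrict_space lborel {0..1}"

lemma space_lb01 [simp]: "space lb01 = {0..1}"
  by (simp add: space_restrict_space)

lemma prob_space_lb01: "prob_space lb01"
  by (rule prob_spaceI) (simp add: emeasure_restrict_space)

interpretation lb01: prob_space lb01
  by (rule prob_space_lb01)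

lemma sets_lb01: "sets lb01 = sets (restrict_space borel {0..1})"
  by (simp add: sets_restrict_space)

lemma measurable_lb01_cong: "measurable lb01 M = measurable (restrict_space borel {0..1}) M"
  by (rule measurable_cong_sets) (simp_all add: sets_lb01)

lemma borel_imp_lb01: "f \<in> borel_measurable borel \<Longrightarrow> f \<in> borel_measurable lb01"
  by (simp add: measurable_restrict_space1)

lemma AE_lb01_pos: "AE x in lb01. x \<in> {0<..1}"
proof -
  have "AE x in lborel. x \<noteq> (0::real)" by (rule AE_lborel_singleton)
  then have "AE x in lborel. x \<in> {0..1} \<longrightarrow> x \<in> {0<..(1::real)}" by eventually_elim auto
  then show ?thesis by (simp add: AE_restrict_space_iff)
qed

section \<open>The left branch, its derivative and its inverse\<close>

definition left_branch :: "real \<Rightarrow> real \<Rightarrow> real" where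
  "left_branch a x = x * (1 + (2 * x) powr a)"

definition left_deriv :: "real \<Rightarrow> real \<Rightarrow> real" where
  "left_deriv a x = 1 + (1 + a) * (2 * x) powr a"

lemma PM_map_left: "x < 1/2 \<Longrightarrow> PM_map a x = left_branch a x"
  by (simp add: PM_map_def left_branch_def powr_mult)

lemma PM_map_right: "x \<ge> 1/2 \<Longrightarrow> PM_map a x = 2 * x - 1"
  by (simp add: PM_map_def)

lemma powr_le_one_unit: "0 \<le> a \<Longrightarrow> 0 \<le> x \<Longrightarrow> x \<le> 1 \<Longrightarrow> x powr a \<le> (1::real)"
  by (metis powr_mono2 powr_one_eq_one)

lemma left_branch_bounds:
  assumes "0 \<le> a" "0 \<le> x" "x \<le> 1/2"
  shows "x \<le> left_branch a x" "left_branch a x \<le> 2 * x"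
proof -
  have "(2*x) powr a \<le> 1" using assms by (intro powr_le_one_unit) auto
  then have "x * (1 + (2*x) powr a) \<le> x * 2" using assms by (intro mult_left_mono) auto
  then show "left_branch a x \<le> 2 * x" by (simp add: left_branch_def)
  show "x \<le> left_branch a x" using assms by (simp add: left_branch_def algebra_simps)
qed

lemma PM_map_in: "0 \<le> a \<Longrightarrow> x \<in> {0..1} \<Longrightarrow> PM_map a x \<in> {0..1}"
  by (cases "x < 1/2") (use left_branch_bounds[of a x] in \<open>auto simp: PM_map_left PM_map_right\<close>)

lemma PM_map_measurable [measurable]: "PM_map a \<in> borel_measurable borel"
  unfolding PM_map_def by measurable

lemma PM_map_measurable_lb01: "0 \<le> a \<Longrightarrow> PM_map a \<in> measurable lb01 lb01"
  by (intro measurable_restrict_space2)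
     (auto simp: measurable_lb01_cong space_restrict_space dest: PM_map_in[of a]
       intro!: measurable_restrict_space1)

lemma left_branch_strict_mono:
  assumes "0 \<le> a" "0 \<le> x" "x < y"
  shows "left_branch a x < left_branch a y"
proof -
  have "(2*x) powr a \<le> (2*y) powr a"  using assms by (intro powr_mono2) auto
  then have "x * (1 + (2*x) powr a) \<le> x * (1 + (2*y) powr a)"
    using assms by (intro mult_left_mono) auto
  also have "\<dots> < y * (1 + (2*y) powr a)"
    using assms by (intro mult_strict_right_mono) (auto intro: add_pos_nonneg)
  finally show ?thesis by (simp add: left_branch_def)
qed

lemma left_branch_half [simp]: "left_branch a (1/2) = 1"
  by (simp add: left_branch_def)

lemma left_branch_has_derivative:
  assumes "0 < x"
  shows "(left_branch a has_field_derivative left_deriv a x) (at x within S)"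
proof -
  have "((\<lambda>x. x * (1 + (2 * x) powr a)) has_field_derivative
     1 * (1 + (2 * x) powr a) + (0 + a * (2*x) powr (a - 1) * (2 * 1)) * x) (at x within S)"
    by (rule derivative_eq_intros refl | use assms in simp)+
  moreover have "1 * (1 + (2 * x) powr a) + (0 + a * (2*x) powr (a - 1) * (2 * 1)) * x = left_deriv a x"
    using assms by (simp add: left_deriv_def powr_diff algebra_simps)
  ultimately show ?thesis by (simp add: left_branch_def[abs_def])
qed

lemma left_deriv_ge_1: "0 \<le> a \<Longrightarrow> 1 \<le> left_deriv a x"
  by (simp add: left_deriv_def)

lemma left_deriv_mono: "0 \<le> a \<Longrightarrow> 0 \<le> x \<Longrightarrow> x \<le> y \<Longrightarrow> left_deriv a x \<le> left_deriv a y"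
  by (auto simp: left_deriv_def intro!: mult_left_mono powr_mono2)

lemma left_deriv_le_3: "0 \<le> a \<Longrightarrow> a \<le> 1 \<Longrightarrow> 0 \<le> x \<Longrightarrow> x \<le> 1/2 \<Longrightarrow> left_deriv a x \<le> 3"
proof -
  assume *: "0 \<le> a" "a \<le> 1" "0 \<le> x" "x \<le> 1/2"
  have "(1 + a) * (2*x) powr a \<le> 2 * 1"
    using * by (intro mult_mono powr_le_one_unit) auto
  then show ?thesis by (simp add: left_deriv_def)
qed

text \<open>The closed interval contains 1/2, where the formula of the left branch gives 1, so this
  inverse branch is defined on all of [0,1]. The other inverse branch is written out as
  \<open>(x + 1) / 2\<close>.\<close>

definition pre :: "real \<Rightarrow> real \<Rightarrow> real" where
  "pre a x = (THE y. 0 \<le> y \<and> y \<le> 1/2 \<and> left_branch a y = x)"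

lemma left_branch_inj: "0 \<le> a \<Longrightarrow> 0 \<le> x \<Longrightarrow> 0 \<le> y \<Longrightarrow> left_branch a x = left_branch a y \<Longrightarrow> x = y"
  by (metis left_branch_strict_mono less_irrefl linorder_less_linear)

lemma pre_left_branch: "0 \<le> a \<Longrightarrow> 0 \<le> y \<Longrightarrow> y \<le> 1/2 \<Longrightarrow> pre a (left_branch a y) = y"
  unfolding pre_def by (rule the_equality) (auto intro: left_branch_inj)

lemma left_branch_surj:
  assumes "0 \<le> a" "0 \<le> x" "x \<le> 1"
  shows "\<exists>y. 0 \<le> y \<and> y \<le> 1/2 \<and> left_branch a y = x"
proof (cases "x = 0")
  case True then show ?thesis by (intro exI[of _ 0]) (simp add: left_branch_def)
next
  case False
  have "continuous_on {x/2..min x (1/2)} (left_branch a)"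
    using assms False
    by (auto intro!: DERIV_continuous_on[where D="left_deriv a"] left_branch_has_derivative)
  moreover have "left_branch a (x/2) \<le> x" using left_branch_bounds[of a "x/2"] assms by auto
  moreover have "x \<le> left_branch a (min x (1/2))"
    using left_branch_bounds[of a x] assms by (cases "x \<le> 1/2") auto
  ultimately have "\<exists>y\<ge>x/2. y \<le> min x (1/2) \<and> left_branch a y = x"
    by (intro IVT') (use assms in auto)
  then show ?thesis using assms by (metis min.bounded_iff divide_nonneg_pos order_trans zero_less_numeral)
qed

lemma pre_props:
  assumes "0 \<le> a" "x \<in> {0..1}"
  shows left_branch_pre: "left_branch a (pre a x) = x" and pre_nonneg: "0 \<le> pre a x" and pre_le_half: "pre a x \<le> 1/2"
proof -
  obtain y where y: "0 \<le> y" "y \<le> 1/2" "left_branch a y = x"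
    using left_branch_surj[of a x] assms by auto
  then have "pre a x = y" using pre_left_branch[of a y] assms by auto
  then show "left_branch a (pre a x) = x" "0 \<le> pre a x" "pre a x \<le> 1/2" using y by auto
qed

lemma pre_bounds:
  assumes "0 \<le> a" "x \<in> {0..1}"
  shows "x / 2 \<le> pre a x" "pre a x \<le> x"
  using left_branch_bounds[of a "pre a x"] pre_props[OF assms] assms by auto

lemma pre_mono: "0 \<le> a \<Longrightarrow> 0 \<le> x \<Longrightarrow> x \<le> y \<Longrightarrow> y \<le> 1 \<Longrightarrow> pre a x \<le> pre a y"
  using left_branch_strict_mono[of a "pre a y" "pre a x"] pre_props[of a x] pre_props[of a y]
  by (force simp: not_le)

lemma pre_measurable_borel:
  assumes "0 \<le> a" shows "pre a \<in> borel_measurable lb01"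
proof -
  have "mono_on {0..1} (pre a)" using assms by (auto simp: mono_on_def intro: pre_mono)
  then have "pre a \<in> borel_measurable (restrict_space borel {0..1})"
    by (rule borel_measurable_mono_on_fnc)
  then show "pre a \<in> borel_measurable lb01" by (simp add: measurable_lb01_cong)
qed

lemma pre_measurable_lb01:
  assumes "0 \<le> a" shows "pre a \<in> measurable lb01 lb01"
proof (intro measurable_restrict_space2)
  show "pre a \<in> space lb01 \<rightarrow> {0..1}"
  proof
    fix x assume "x \<in> space lb01"
    then have x: "x \<in> {0..1}" by simp
    then show "pre a x \<in> {0..1}"
      using pre_nonneg[OF assms x] pre_bounds(2)[OF assms x] by simp
  qed
qed (use pre_measurable_borel[OF assms] in simp)

section \<open>The transfer operator of one map and its duality with composition\<close>

definition tr :: "real \<Rightarrow> (real \<Rightarrow> real) \<Rightarrow> real \<Rightarrow> real" where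
  "tr a f x = f (pre a x) / left_deriv a (pre a x) + f ((x + 1) / 2) / 2"

lemma integrable_lb01_iff: "integrable lb01 f \<longleftrightarrow> set_integrable lborel {0..1} (f :: real \<Rightarrow> real)"
  by (simp add: integrable_restrict_space set_integrable_def)

lemma LINT_lb01: "(LINT x|lb01. f x) = (LINT x:{0..1}|lborel. (f x :: real))"
  by (simp add: integral_restrict_space set_lebesgue_integral_def)

lemma left_branch_image: "0 \<le> a \<Longrightarrow> left_branch a ` {0<..<1/2} = {0<..<1}"
proof (intro equalityI subsetI)
  fix x assume a: "0 \<le> a" and "x \<in> left_branch a ` {0<..<1/2}"
  then obtain y where y: "0 < y" "y < 1/2" "x = left_branch a y" by auto
  then show "x \<in> {0<..<1}"
    using left_branch_strict_mono[OF a, of 0 y] left_branch_strict_mono[OF a, of y "1/2"]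
    by (simp add: left_branch_def)
next
  fix x :: real assume a: "0 \<le> a" and x: "x \<in> {0<..<1}"
  have "pre a x \<noteq> 1/2" using x left_branch_pre[OF a, of x] by (metis greaterThanLessThan_iff atLeastAtMost_iff left_branch_half less_le)
  then have "pre a x \<in> {0<..<1/2}" using pre_props[OF a, of x] pre_bounds[OF a, of x] x by auto
  then show "x \<in> left_branch a ` {0<..<1/2}"
    using left_branch_pre[OF a, of x] x by (intro image_eqI[of _ _ "pre a x"]) auto
qed

lemma abs_integrable_iff_lborel:
  fixes f :: "real \<Rightarrow> real"
  assumes "S \<in> sets borel" "f \<in> borel_measurable (restrict_space borel S)"
  shows "f absolutely_integrable_on S \<longleftrightarrow> set_integrable lborel S f" 
    "set_lebesgue_integral lebesgue S f = set_lebesgue_integral lborel S f"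
proof -
  have *: "(\<lambda>x. indicator S x *\<^sub>R f x) \<in> borel_measurable lborel"
    using assms by (subst (asm) borel_measurable_restrict_space_iff) auto
  show "f absolutely_integrable_on S \<longleftrightarrow> set_integrable lborel S f"
    unfolding set_integrable_def using integrable_completion[OF *] by simp
  show "set_lebesgue_integral lebesgue S f = set_lebesgue_integral lborel S f"
    unfolding set_lebesgue_integral_def using integral_completion[OF *] by simp
qed

text \<open>Substitution \<open>x = left_branch a y\<close>, whose Jacobian cancels the denominator
  in \<open>tr\<close>. Open intervals are used because the derivative formula is only established
  at positive points.\<close>

lemma tr_left:
  assumes a: "0 \<le> a" and f: "integrable lb01 f" and p: "\<psi> \<in> borel_measurable borel"
    and bd: "\<And>x. \<bar>\<psi> x\<bar> \<le> C"
  shows "set_integrable lborel {0<..<1} (\<lambda>x. \<psi> x * (f (pre a x) / left_deriv a (pre a x)))"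
   "(LINT x:{0<..<1}|lborel. \<psi> x * (f (pre a x) / left_deriv a (pre a x))) =
    (LINT x:{0<..<1/2}|lborel. \<psi> (PM_map a x) * f x)"
proof -
  let ?F = "\<lambda>x. \<psi> x * (f (pre a x) / left_deriv a (pre a x))"
  let ?S = "{0<..<1/2::real}"
  have fm: "f \<in> borel_measurable lb01" using f by simp
  have "?F \<in> borel_measurable lb01"
    using measurable_compose[OF pre_measurable_lb01[OF a] fm] pre_measurable_borel[OF a] borel_imp_lb01[OF p]
    unfolding left_deriv_def by measurable
  then have Fm: "?F \<in> borel_measurable (restrict_space borel {0<..<1})"
    unfolding measurable_lb01_cong by (rule measurable_restrict_mono) auto
  have fS: "set_integrable lborel ?S f"
    using f unfolding integrable_lb01_iff by (rule set_integrable_subset) auto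
  have G: "set_integrable lborel ?S (\<lambda>x. \<psi> (PM_map a x) * f x)"
    unfolding set_integrable_def
  proof (rule Bochner_Integration.integrable_bound)
    show "integrable lborel (\<lambda>x. C * (indicator ?S x *\<^sub>R f x))"
      using fS by (simp add: set_integrable_def)
    have "(\<lambda>x. indicator ?S x *\<^sub>R f x) \<in> borel_measurable lborel"
      using fS by (auto simp: set_integrable_def)
    then have "(\<lambda>x. \<psi> (PM_map a x) * (indicator ?S x *\<^sub>R f x)) \<in> borel_measurable lborel"
      using p by (intro borel_measurable_times measurable_compose[OF _ p]) auto
    then show "(\<lambda>x. indicator ?S x *\<^sub>R (\<psi> (PM_map a x) * f x)) \<in> borel_measurable lborel"
      by (simp add: mult_ac)
    have "C \<ge> 0" using bd[of 0] by linarith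
    then show "AE x in lborel. norm (indicator ?S x *\<^sub>R (\<psi> (PM_map a x) * f x))
          \<le> norm (C * (indicator ?S x *\<^sub>R f x))"
      by (intro AE_I2) (use bd in \<open>auto simp: abs_mult indicator_def intro!: mult_right_mono\<close>)
  qed
  have eq: "\<bar>left_deriv a x\<bar> * ?F (left_branch a x) = \<psi> (PM_map a x) * f x" if "x \<in> ?S" for x
    using that pre_left_branch[OF a, of x] left_deriv_ge_1[OF a, of x] by (auto simp: PM_map_left)
  have "(\<lambda>x. \<psi> (PM_map a x) * f x) absolutely_integrable_on ?S"
    using G integrable_completion[of "\<lambda>x. indicator ?S x *\<^sub>R (\<psi> (PM_map a x) * f x)" lborel]
    unfolding set_integrable_def by auto
  then have A: "(\<lambda>x. \<bar>left_deriv a x\<bar> * ?F (left_branch a x)) absolutely_integrable_on ?S"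
  proof -
    have eq2: "indicator ?S x *\<^sub>R (\<bar>left_deriv a x\<bar> * ?F (left_branch a x)) = indicator ?S x *\<^sub>R (\<psi> (PM_map a x) * f x)" for x
      by (cases "x \<in> ?S") (simp_all only: eq indicator_simps scaleR_zero_left if_True if_False not_False_eq_True)
    assume "(\<lambda>x. \<psi> (PM_map a x) * f x) absolutely_integrable_on ?S"
    then show ?thesis unfolding set_integrable_def eq2 .
  qed
  \<comment> \<open>The change of variables theorem is an equivalence that prescribes the value of
    the integral. With this value taken to be the integral on the left, the left side reduces to
    \<open>A\<close>.\<close>
  have "(\<lambda>x. \<bar>left_deriv a x\<bar> * ?F (left_branch a x)) absolutely_integrable_on ?S \<and>
           integral ?S (\<lambda>x. \<bar>left_deriv a x\<bar> * ?F (left_branch a x)) = integral ?S (\<lambda>x. \<bar>left_deriv a x\<bar> * ?F (left_branch a x))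
     \<longleftrightarrow> ?F absolutely_integrable_on (left_branch a ` ?S) \<and> integral (left_branch a ` ?S) ?F = integral ?S (\<lambda>x. \<bar>left_deriv a x\<bar> * ?F (left_branch a x))"
    by (rule has_absolute_integral_change_of_variables_1')
       (use left_branch_inj[OF a] in \<open>auto intro!: left_branch_has_derivative inj_onI\<close>)
  with A have B: "?F absolutely_integrable_on {0<..<1}"
      "integral {0<..<1} ?F = integral ?S (\<lambda>x. \<bar>left_deriv a x\<bar> * ?F (left_branch a x))"
    by (auto simp only: left_branch_image[OF a])
  show "set_integrable lborel {0<..<1} ?F"
    using B(1) abs_integrable_iff_lborel(1)[OF _ Fm] by auto
  have "(LINT x:{0<..<1}|lborel. ?F x) = integral {0<..<1} ?F"
    using abs_integrable_iff_lborel(2)[OF _ Fm] set_lebesgue_integral_eq_integral(2)[OF B(1)] by simp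
  also have "\<dots> = (LINT x:?S|lebesgue. \<bar>left_deriv a x\<bar> * ?F (left_branch a x))"
    using B(2) set_lebesgue_integral_eq_integral(2)[OF A] by simp
  also have "\<dots> = (LINT x:?S|lebesgue. \<psi> (PM_map a x) * f x)"
    using eq by (intro set_lebesgue_integral_cong) auto
  also have "\<dots> = (LINT x:?S|lborel. \<psi> (PM_map a x) * f x)"
    using G unfolding set_lebesgue_integral_def set_integrable_def
    by (intro integral_completion) auto
  finally show "(LINT x:{0<..<1}|lborel. ?F x) = (LINT x:?S|lborel. \<psi> (PM_map a x) * f x)" .
qed

lemma tr_right:
  fixes f \<psi> :: "real \<Rightarrow> real"
  assumes f: "integrable lb01 f" and p: "\<psi> \<in> borel_measurable borel"
    and bd: "\<And>x. \<bar>\<psi> x\<bar> \<le> C"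
  shows "set_integrable lborel {0..1} (\<lambda>x. \<psi> x * (f ((x+1)/2) / 2))"
   "(LINT x:{0..1}|lborel. \<psi> x * (f ((x+1)/2) / 2)) = (LINT x:{1/2..1}|lborel. \<psi> (PM_map a x) * f x)"
proof -
  have fS: "set_integrable lborel {1/2..1} f"
    using f unfolding integrable_lb01_iff by (rule set_integrable_subset) auto
  define H where "H z = indicator {1/2..1} z *\<^sub>R (\<psi> (PM_map a z) * f z)" for z
  have "integrable lborel H"
  proof (rule Bochner_Integration.integrable_bound)
    show "integrable lborel (\<lambda>x. C * (indicator {1/2..1} x *\<^sub>R f x))"
      using fS by (simp add: set_integrable_def)
    have "(\<lambda>x. indicator {1/2..1} x *\<^sub>R f x) \<in> borel_measurable lborel"
      using fS by (auto simp: set_integrable_def)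
    then have "(\<lambda>x. \<psi> (PM_map a x) * (indicator {1/2..1} x *\<^sub>R f x)) \<in> borel_measurable lborel"
      using p by (intro borel_measurable_times measurable_compose[OF _ p]) auto
    then show "H \<in> borel_measurable lborel"
      by (simp add: mult_ac H_def[abs_def])
    have "C \<ge> 0" using bd[of 0] by linarith
    then show "AE x in lborel. norm (H x) \<le> norm (C * (indicator {1/2..1} x *\<^sub>R f x))"
      by (intro AE_I2) (use bd in \<open>auto simp: H_def abs_mult indicator_def intro!: mult_right_mono\<close>)
  qed
  then have 1: "integrable lborel (\<lambda>x. H (1/2 + 1/2 * x))"
    using lborel_integrable_real_affine[of H "1/2" "1/2"] by simp
  have 2: "indicator {0..1} x *\<^sub>R (\<psi> x * (f ((x+1)/2) / 2)) = 1/2 * H (1/2 + 1/2 * x)" for x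
    by (auto simp: H_def indicator_def PM_map_right field_simps)
  show "set_integrable lborel {0..1} (\<lambda>x. \<psi> x * (f ((x+1)/2) / 2))"
    unfolding set_integrable_def 2 using 1 by simp
  show "(LINT x:{0..1}|lborel. \<psi> x * (f ((x+1)/2) / 2)) = (LINT x:{1/2..1}|lborel. \<psi> (PM_map a x) * f x)"
    unfolding set_lebesgue_integral_def 2
    using lborel_integral_real_affine[of "1/2" H "1/2"] by (simp add: H_def)
qed

lemma set_lborel_open_closed:
  fixes f :: "real \<Rightarrow> real"
  shows "set_integrable lborel {0<..<1} f \<Longrightarrow> f \<in> borel_measurable lb01 \<Longrightarrow> set_integrable lborel {0..1} f"
    "f \<in> borel_measurable lb01 \<Longrightarrow> (LINT x:{0<..<1}|lborel. f x) = (LINT x:{0..1}|lborel. f x)"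
proof -
  have ae: "AE x in lborel. indicator {0<..<1} x *\<^sub>R f x = indicator {0..1} x *\<^sub>R f x"
    using AE_lborel_singleton[of 0] AE_lborel_singleton[of 1]
    by eventually_elim (auto simp: indicator_def)
  have m: "(\<lambda>x. indicator {0..1} x *\<^sub>R f x) \<in> borel_measurable lborel" if "f \<in> borel_measurable lb01"
    using that by (subst (asm) borel_measurable_restrict_space_iff) auto
  have m': "(\<lambda>x. indicator {0<..<1} x *\<^sub>R f x) \<in> borel_measurable lborel" if "f \<in> borel_measurable lb01"
  proof -
    have "(\<lambda>x. indicator {0<..<1} x *\<^sub>R (indicator {0..1} x *\<^sub>R f x)) \<in> borel_measurable lborel"
      using m[OF that] by simp
    then show ?thesis by (rule measurable_cong[THEN iffD1, rotated]) (auto simp: indicator_def)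
  qed
  show "set_integrable lborel {0<..<1} f \<Longrightarrow> f \<in> borel_measurable lb01 \<Longrightarrow> set_integrable lborel {0..1} f"
    unfolding set_integrable_def using integrable_cong_AE[OF m' m ae] by blast
  show "f \<in> borel_measurable lb01 \<Longrightarrow> (LINT x:{0<..<1}|lborel. f x) = (LINT x:{0..1}|lborel. f x)"
    unfolding set_lebesgue_integral_def by (intro integral_cong_AE m m' ae)
qed

text \<open>The domains of the two branches cover [0,1] up to the null set {0}. Bounded test
  functions suffice: orbit observables and the truncated potential are of this kind.\<close>

lemma tr_dual:
  fixes f \<psi> :: "real \<Rightarrow> real"
  assumes a: "0 \<le> a" and f: "integrable lb01 f" and p: "\<psi> \<in> borel_measurable borel"
    and bd: "\<And>x. \<bar>\<psi> x\<bar> \<le> C"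
  shows tr_mult_integrable: "integrable lb01 (\<lambda>x. \<psi> x * tr a f x)"
   and integral_tr: "(LINT x|lb01. \<psi> x * tr a f x) = (LINT x|lb01. \<psi> (PM_map a x) * f x)"
proof -
  note L = tr_left[OF a f p bd] and R = tr_right[OF f p bd]
  have fm: "f \<in> borel_measurable lb01" using f by simp
  let ?g = "\<lambda>x. \<psi> x * (f (pre a x) / left_deriv a (pre a x))"
  have gm: "?g \<in> borel_measurable lb01"
    using measurable_compose[OF pre_measurable_lb01[OF a] fm] pre_measurable_borel[OF a] borel_imp_lb01[OF p]
    unfolding left_deriv_def by measurable
  note L' = set_lborel_open_closed(1)[OF L(1) gm] L(2)[unfolded set_lborel_open_closed(2)[OF gm]]
  have eq: "\<psi> x * tr a f x = ?g x + \<psi> x * (f ((x+1)/2) / 2)" for x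
    by (simp add: tr_def distrib_left)
  show "integrable lb01 (\<lambda>x. \<psi> x * tr a f x)"
    unfolding integrable_lb01_iff eq by (intro set_integral_add L' R)
  have "integrable lb01 (\<lambda>x. \<psi> (PM_map a x) * f x)"
  proof (rule Bochner_Integration.integrable_bound)
    show "integrable lb01 (\<lambda>x. C * f x)" using f by simp
    show "(\<lambda>x. \<psi> (PM_map a x) * f x) \<in> borel_measurable lb01"
      by (intro borel_measurable_times fm borel_imp_lb01 measurable_compose[OF PM_map_measurable p])
    have "C \<ge> 0" using bd[of 0] by linarith
    then show "AE x in lb01. norm (\<psi> (PM_map a x) * f x) \<le> norm (C * f x)"
      by (intro AE_I2) (use bd in \<open>auto simp: abs_mult intro!: mult_right_mono\<close>)
  qed
  then have I: "set_integrable lborel {0..1} (\<lambda>x. \<psi> (PM_map a x) * f x)"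
    by (simp add: integrable_lb01_iff)
  have "(LINT x|lb01. \<psi> x * tr a f x) = (LINT x:{0..1}|lborel. ?g x) + (LINT x:{0..1}|lborel. \<psi> x * (f ((x+1)/2) / 2))"
    unfolding LINT_lb01 eq by (intro set_integral_add L' R)
  also have "\<dots> = (LINT x:{0<..<1/2}|lborel. \<psi> (PM_map a x) * f x) + (LINT x:{1/2..1}|lborel. \<psi> (PM_map a x) * f x)"
    by (simp only: L'(2) R(2)[of a])
  also have "\<dots> = (LINT x:{0<..<1/2} \<union> {1/2..1}|lborel. \<psi> (PM_map a x) * f x)"
    by (intro set_integral_Un[symmetric] set_integrable_subset[OF I]) auto
  also have "{0<..<1/2} \<union> {1/2..1} = {0<..(1::real)}" by auto
  also have "(LINT x:{0<..1}|lborel. \<psi> (PM_map a x) * f x) = (LINT x:{0..1}|lborel. \<psi> (PM_map a x) * f x)"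
    unfolding set_lebesgue_integral_def
  proof (rule integral_cong_AE)
    show "AE x in lborel. indicator {0<..1} x *\<^sub>R (\<psi> (PM_map a x) * f x) = indicator {0..1} x *\<^sub>R (\<psi> (PM_map a x) * f x)"
      using AE_lborel_singleton[of 0] by eventually_elim (auto simp: indicator_def)
  next
    have "set_integrable lborel {0<..1} (\<lambda>x. \<psi> (PM_map a x) * f x)"
      by (rule set_integrable_subset[OF I]) auto
    then show "(\<lambda>x. indicator {0<..1} x *\<^sub>R (\<psi> (PM_map a x) * f x)) \<in> borel_measurable lborel"
      unfolding set_integrable_def by (rule borel_measurable_integrable)
    show "(\<lambda>x. indicator {0..1} x *\<^sub>R (\<psi> (PM_map a x) * f x)) \<in> borel_measurable lborel"
      using I unfolding set_integrable_def by (rule borel_measurable_integrable)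
  qed
  finally show "(LINT x|lb01. \<psi> x * tr a f x) = (LINT x|lb01. \<psi> (PM_map a x) * f x)"
    by (simp add: LINT_lb01)
qed

section \<open>Decreasing densities\<close>

text \<open>Nothing is demanded at 0, where a density may blow up. Elsewhere monotonicity holds
  pointwise and not just almost everywhere, so that values such as \<open>f 1\<close> and
  \<open>f (1/2)\<close> carry information.\<close>

definition decr :: "(real \<Rightarrow> real) \<Rightarrow> bool" where
  "decr f \<longleftrightarrow> integrable lb01 f \<and> (\<forall>x\<in>{0<..1}. 0 \<le> f x) \<and>
     (\<forall>x y. 0 < x \<longrightarrow> x \<le> y \<longrightarrow> y \<le> 1 \<longrightarrow> f y \<le> f x)"

lemma decrD:
  assumes "decr f"
  shows decr_integrable: "integrable lb01 f"
    and decr_nonneg: "0 < x \<Longrightarrow> x \<le> 1 \<Longrightarrow> 0 \<le> f x"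
    and decr_antimono: "0 < x \<Longrightarrow> x \<le> y \<Longrightarrow> y \<le> 1 \<Longrightarrow> f y \<le> f x"
  using assms by (auto simp: decr_def)

lemma AE_lb01I: "(\<And>x. 0 < x \<Longrightarrow> x \<le> 1 \<Longrightarrow> P x) \<Longrightarrow> AE x in lb01. P x"
  using AE_lb01_pos by eventually_elim auto

lemma integral_lb01_mono:
  fixes f g :: "real \<Rightarrow> real"
  assumes "integrable lb01 f" "integrable lb01 g" "\<And>x. 0 < x \<Longrightarrow> x \<le> 1 \<Longrightarrow> f x \<le> g x"
  shows "(LINT x|lb01. f x) \<le> (LINT x|lb01. g x)"
  using assms by (intro integral_mono_AE AE_lb01I)

lemma integral_lb01_nonneg:
  fixes f :: "real \<Rightarrow> real"
  assumes "\<And>x. 0 < x \<Longrightarrow> x \<le> 1 \<Longrightarrow> 0 \<le> f x"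
  shows "0 \<le> (LINT x|lb01. f x)"
  using assms by (intro integral_nonneg_AE AE_lb01I)

lemma integral_lb01_cong:
  fixes f g :: "real \<Rightarrow> real"
  assumes "f \<in> borel_measurable lb01" "g \<in> borel_measurable lb01" "\<And>x. 0 < x \<Longrightarrow> x \<le> 1 \<Longrightarrow> f x = g x"
  shows "(LINT x|lb01. f x) = (LINT x|lb01. g x)"
  using assms by (intro integral_cong_AE AE_lb01I)

lemma integrable_bounded_mult:
  fixes f \<psi> :: "real \<Rightarrow> real"
  assumes f: "integrable lb01 f" and p: "\<psi> \<in> borel_measurable lb01"
    and bd: "\<And>x. x \<in> {0..1} \<Longrightarrow> \<bar>\<psi> x\<bar> \<le> C"
  shows "integrable lb01 (\<lambda>x. \<psi> x * f x)"
proof (rule Bochner_Integration.integrable_bound)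
  show "integrable lb01 (\<lambda>x. C * f x)" using f by simp
  show "(\<lambda>x. \<psi> x * f x) \<in> borel_measurable lb01"
    using f p by (intro borel_measurable_times) auto
  have C: "C \<ge> 0" using bd[of 0] by simp
  have "norm (\<psi> x * f x) \<le> norm (C * f x)" if "x \<in> {0..1}" for x
    using mult_right_mono[OF bd[OF that], of "\<bar>f x\<bar>"] C by (simp add: abs_mult)
  then show "AE x in lb01. norm (\<psi> x * f x) \<le> norm (C * f x)"
    by (intro AE_I2) simp
qed

lemma integral_bounded_mult_le:
  fixes f \<psi> :: "real \<Rightarrow> real"
  assumes f: "integrable lb01 f" and p: "\<psi> \<in> borel_measurable lb01"
    and bd: "\<And>x. x \<in> {0..1} \<Longrightarrow> \<bar>\<psi> x\<bar> \<le> C"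
  shows "\<bar>LINT x|lb01. \<psi> x * f x\<bar> \<le> C * (LINT x|lb01. \<bar>f x\<bar>)"
proof -
  have C: "C \<ge> 0" using bd[of 0] by simp
  have "\<bar>LINT x|lb01. \<psi> x * f x\<bar> \<le> (LINT x|lb01. \<bar>\<psi> x * f x\<bar>)"
    using integral_norm_bound[of lb01 "\<lambda>x. \<psi> x * f x"] by simp
  also have "\<dots> \<le> (LINT x|lb01. C * \<bar>f x\<bar>)"
    using f bd by (intro integral_lb01_mono integrable_abs integrable_bounded_mult[OF f p bd])
      (auto simp: abs_mult intro!: mult_right_mono)
  finally show ?thesis by simp
qed

section \<open>Operations that preserve decreasing densities\<close>

lemma decr_const: "0 \<le> c \<Longrightarrow> decr (\<lambda>x. c)"
  by (simp add: decr_def)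

lemma decr_add: "decr f \<Longrightarrow> decr g \<Longrightarrow> decr (\<lambda>x. f x + g x)"
  by (auto simp: decr_def intro: add_mono)

lemma decr_cmult: "0 \<le> c \<Longrightarrow> decr f \<Longrightarrow> decr (\<lambda>x. c * f x)"
  by (auto simp: decr_def intro: mult_left_mono)

text \<open>Coupling removes mass in this way: \<open>f 1\<close> is the least value on (0,1], hence
  the largest constant with a nonnegative remainder.\<close>

lemma decr_minus_const: "decr f \<Longrightarrow> c \<le> f 1 \<Longrightarrow> decr (\<lambda>x. f x - c)"
  unfolding decr_def by (auto intro: order_trans)

lemma decr_mult:
  assumes w: "w \<in> borel_measurable borel" "\<And>x. 0 \<le> x \<Longrightarrow> x \<le> 1 \<Longrightarrow> 0 \<le> w x \<and> w x \<le> 1"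
    "\<And>x y. 0 \<le> x \<Longrightarrow> x \<le> y \<Longrightarrow> y \<le> 1 \<Longrightarrow> w y \<le> w x"
    and f: "decr f"
  shows "decr (\<lambda>x. w x * f x)"
  unfolding decr_def
proof (intro conjI allI impI ballI)
  show "integrable lb01 (\<lambda>x. w x * f x)"
    using w(2) by (intro integrable_bounded_mult[OF decr_integrable[OF f] borel_imp_lb01[OF w(1)], of 1]) auto
  show "0 \<le> w x * f x" if "x \<in> {0<..1}" for x
    using that w(2) decr_nonneg[OF f] by simp
  show "w y * f y \<le> w x * f x" if "0 < x" "x \<le> y" "y \<le> 1" for x y
    using that w(2)[of x] w(2)[of y] w(3)[of x y] decr_nonneg[OF f, of y] decr_antimono[OF f, of x y] 
    by (intro mult_mono) auto
qed

lemma tr_integrable: 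
  assumes "0 \<le> a" "integrable lb01 f" 
  shows "integrable lb01 (tr a f)" "(LINT x|lb01. tr a f x) = (LINT x|lb01. f x)"
  using tr_dual[OF assms, of "\<lambda>x. 1" 1] by simp_all

lemma pre_pos: "0 \<le> a \<Longrightarrow> 0 < x \<Longrightarrow> x \<le> 1 \<Longrightarrow> 0 < pre a x"
  using pre_bounds(1)[of a x] by auto

text \<open>Both inverse branches are increasing, so the compositions decrease. The derivative of
  the left branch increases along \<open>pre a\<close>, so dividing by it keeps the first summand
  decreasing.\<close>

lemma decr_tr:
  assumes a: "0 \<le> a" and f: "decr f" shows "decr (tr a f)"
  unfolding decr_def
proof (intro conjI allI impI ballI)
  show "integrable lb01 (tr a f)" using tr_integrable[OF a] decr_integrable[OF f] by blast
  show "0 \<le> tr a f x" if "x \<in> {0<..1}" for x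
    unfolding tr_def using that decr_nonneg[OF f] left_deriv_ge_1[OF a] pre_pos[OF a, of x] pre_le_half[OF a, of x]
    by (intro add_nonneg_nonneg divide_nonneg_nonneg) (auto intro: order_trans[of 0 1])
  show "tr a f y \<le> tr a f x" if *: "0 < x" "x \<le> y" "y \<le> 1" for x y
    unfolding tr_def
  proof (intro add_mono frac_le divide_right_mono)
    have p: "0 < pre a x" "pre a x \<le> pre a y" "pre a y \<le> 1"
      using * pre_pos[OF a, of x] pre_mono[OF a, of x y] pre_le_half[OF a, of y] by auto
    show "f (pre a y) \<le> f (pre a x)" "0 \<le> f (pre a x)"
      using p decr_antimono[OF f] decr_nonneg[OF f] by auto
    show "left_deriv a (pre a x) \<le> left_deriv a (pre a y)" using p by (intro left_deriv_mono a) auto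
    show "0 < left_deriv a (pre a x)" using left_deriv_ge_1[OF a, of "pre a x"] by linarith
    show "f ((y + 1) / 2) \<le> f ((x + 1) / 2)" using * by (intro decr_antimono[OF f]) auto
  qed (use * decr_nonneg[OF f] in auto)
qed

text \<open>Only the left preimage is kept. This costs at most the factor 3, the bound for the left
  derivative when a \<le> 1.\<close>

lemma tr_ge_pre:
  assumes a: "0 \<le> a" "a \<le> 1" and f: "decr f" and x: "0 < x" "x \<le> 1"
  shows "f (pre a x) / 3 \<le> tr a f x"
proof -
  have "f (pre a x) / 3 \<le> f (pre a x) / left_deriv a (pre a x)"
    using left_deriv_le_3[OF a, of "pre a x"] left_deriv_ge_1[OF a(1), of "pre a x"] 
      pre_pos[of a x] pre_le_half[of a x] decr_nonneg[OF f, of "pre a x"] x a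
    by (intro divide_left_mono) auto
  then show ?thesis using decr_nonneg[OF f, of "(x+1)/2"] x by (simp add: tr_def)
qed

lemma indicator_mult_integrable:
  fixes f :: "real \<Rightarrow> real"
  assumes "integrable lb01 f" and "S \<in> sets borel"
  shows "integrable lb01 (\<lambda>x. indicator S x * f x)"
  using assms by (intro integrable_bounded_mult[of _ _ 1] borel_imp_lb01) (auto simp: indicator_def)

lemma integral_lb01_indicator:
  assumes "0 \<le> x" "x \<le> y" "y \<le> 1"
  shows "(LINT z|lb01. indicator {x..y} z * c) = (y - x) * (c::real)"
proof -
  have "(LINT z|lb01. indicator {x..y} z * c) = (LINT z|lborel. indicator {x..y} z *\<^sub>R c)"
    unfolding LINT_lb01 set_lebesgue_integral_def
    using assms by (intro Bochner_Integration.integral_cong) (auto simp: indicator_def)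
  then show ?thesis using assms by simp
qed

lemma decr_le_integral:
  assumes f: "decr f" and x: "0 < x" "x \<le> 1"
  shows "x * f x \<le> (LINT y|lb01. indicator {0..x} y * f y)"
proof -
  have "x * f x = (LINT y|lb01. indicator {0..x} y * f x)"
    using x by (subst integral_lb01_indicator) auto
  also have "\<dots> \<le> (LINT y|lb01. indicator {0..x} y * f y)"
    using x decr_antimono[OF f]
    by (intro integral_lb01_mono indicator_mult_integrable decr_integrable[OF f]) (auto simp: indicator_def)
  finally show ?thesis .
qed

lemma decr_integral_ge_part:
  assumes f: "decr f" and S: "S \<in> sets borel"
  shows "(LINT y|lb01. indicator S y * f y) \<le> (LINT y|lb01. f y)"
  using decr_nonneg[OF f]
  by (intro integral_lb01_mono indicator_mult_integrable decr_integrable[OF f] S) (auto simp: indicator_def)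

text \<open>Controls what passes through the right branch, since a decreasing density is at most
  \<open>f (1/2)\<close> on [1/2,1].\<close>

lemma decr_half_le:
  assumes f: "decr f" shows "f (1/2) \<le> 2 * (LINT x|lb01. f x)"
  using decr_le_integral[OF f, of "1/2"] decr_integral_ge_part[OF f, of "{0..1/2}"] by simp

text \<open>Chosen so that \<open>K0 b * ((1 - b) / 2) = 2\<close>. In one step the right branch
  adds at most x to the mass of [0,x], where x \<le> \<open>2 * pre a x\<close>, and
  \<open>left_branch_powr_ge\<close> supplies a gain of \<open>(1 - b) / 2 * pre a x\<close> to
  absorb it.\<close>

definition K0 :: "real \<Rightarrow> real" where "K0 b = 4 / (1 - b)"

text \<open>The bound on the mass near \<open>0\<close> keeps the densities below a multiple of \<open>x powr - b\<close>.\<close>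

definition decr_cone :: "real \<Rightarrow> (real \<Rightarrow> real) \<Rightarrow> bool" where
  "decr_cone b f \<longleftrightarrow> decr f \<and> (LINT x|lb01. f x) \<le> 1 \<and>
     (\<forall>x\<in>{0..1}. (LINT y|lb01. indicator {0..x} y * f y) \<le> K0 b * x powr (1 - b))"

lemma coneD:
  assumes "decr_cone b f"
  shows cone_decr: "decr f" and cone_mass: "(LINT x|lb01. f x) \<le> 1"
    and cone_near_zero: "x \<in> {0..1} \<Longrightarrow> (LINT y|lb01. indicator {0..x} y * f y) \<le> K0 b * x powr (1 - b)"
  using assms by (auto simp: decr_cone_def)

section \<open>Power inequalities behind the cone and the potential\<close>

lemma ln_one_plus_ge_half:
  fixes u :: real assumes "0 \<le> u" "u \<le> 1" shows "u / 2 \<le> ln (1 + u)"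
proof -
  have 1: "u / (1 + u) \<le> ln (1 + u)"
    using ln_le_minus_one[of "1/(1+u)"] assms by (simp add: ln_div field_simps)
  have "u / 2 \<le> u / (1 + u)"
    using assms by (intro divide_left_mono) auto
  then show ?thesis using 1 by (rule order_trans)
qed

lemma one_plus_powr_ge:
  fixes u p :: real
  assumes "0 \<le> u" "u \<le> 1" "0 \<le> p"
  shows "1 + p * u / 2 \<le> (1 + u) powr p"
proof -
  have "1 + p * u / 2 \<le> 1 + p * ln (1 + u)"
    using ln_one_plus_ge_half[of u] assms mult_left_mono[of "u/2" "ln (1+u)" p] by simp
  also have "\<dots> \<le> exp (p * ln (1 + u))" by (rule exp_ge_add_one_self)
  also have "\<dots> = (1 + u) powr p" using assms by (simp add: powr_def)
  finally show ?thesis .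
qed

lemma one_plus_powr_minus_le:
  fixes u q :: real
  assumes "0 \<le> u" "u \<le> 1" "0 \<le> q" "q \<le> 1"
  shows "(1 + u) powr - q \<le> 1 - q * u / 4"
proof -
  have z: "0 \<le> q * u / 2" "q * u \<le> 1" using assms mult_le_one[of q u] by auto
  have pos: "0 < 1 + q * u / 2" using z by linarith
  have "(1 + u) powr - q = 1 / (1 + u) powr q" by (simp add: powr_minus field_simps)
  also have "\<dots> \<le> 1 / (1 + q * u / 2)"
    using one_plus_powr_ge[of u q] assms z pos by (intro divide_left_mono mult_pos_pos) auto
  also have "\<dots> \<le> 1 - (q * u / 2) / 2"
    using z mult_left_mono[of "q*u" 1 "q*u"] by (simp add: divide_simps) (simp add: algebra_simps)
  finally show ?thesis by simp
qed

lemma powr_exponent_le: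
  fixes x :: real assumes "0 < x" "x \<le> 1" "a \<le> b" shows "x powr b \<le> x powr a"
  using assms powr_mono'[of a b x] by simp

text \<open>Replaces the expansion of the current map by one that depends on the bound b only; all
  later estimates become uniform in the parameter through it.\<close>

lemma double_powr_ge:
  fixes x :: real
  assumes "0 \<le> a" "a \<le> b" "0 < x" "x \<le> 1/2"
  shows "x powr b \<le> (2 * x) powr a"
proof -
  have "x powr b \<le> (2 * x) powr b" using assms by (intro powr_mono2) auto
  also have "\<dots> \<le> (2 * x) powr a" using assms by (intro powr_exponent_le) auto
  finally show ?thesis .
qed

text \<open>One step multiplies y by \<open>1 + (2 * y) powr a\<close>, a relative gain of at least
  \<open>y powr b\<close>. As \<open>y powr (1 - b) * y powr b = y\<close>, the exponent 1 - b makes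
  the gain linear in y.\<close>

lemma left_branch_powr_ge:
  assumes "0 \<le> a" "a \<le> b" "b < 1" "0 < y" "y \<le> 1/2"
  shows "y powr (1 - b) + (1 - b) / 2 * y \<le> left_branch a y powr (1 - b)"
proof -
  let ?u = "(2*y) powr a"
  have u: "0 \<le> ?u" "?u \<le> 1" using assms by (auto intro: powr_le_one_unit)
  have "y powr (1-b) + (1-b)/2 * y = y powr (1-b) * (1 + (1-b) * y powr b / 2)"
    using assms by (simp add: distrib_left powr_add[symmetric])
  also have "\<dots> \<le> y powr (1-b) * (1 + (1-b) * ?u / 2)"
    using double_powr_ge[of a b y] assms by (intro mult_left_mono add_mono divide_right_mono) auto
  also have "\<dots> \<le> y powr (1-b) * (1 + ?u) powr (1-b)"
    using one_plus_powr_ge[OF u, of "1-b"] assms by (intro mult_left_mono) auto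
  also have "\<dots> = left_branch a y powr (1-b)"
    by (simp add: left_branch_def powr_mult)
  finally show ?thesis .
qed

lemma indicator_PM_map_le:
  assumes a: "0 \<le> a" and x: "x \<in> {0<..1}" and y: "0 < y" "y \<le> 1"
  shows "indicator {0..x} (PM_map a y) \<le> indicator {0..pre a x} y + (indicator {1/2..(x+1)/2} y :: real)"
proof (cases "y < 1/2")
  case True
  have "y \<le> pre a x" if "left_branch a y \<le> x"
    using pre_mono[OF a, of "left_branch a y" x] pre_left_branch[OF a, of y] that x y True 
      left_branch_bounds[OF a, of y] by auto
  then show ?thesis using True y by (auto simp: PM_map_left indicator_def)
next
  case False
  then show ?thesis using y by (auto simp: PM_map_right indicator_def)
qed

text \<open>Mass landing in [0,x] comes from [0, \<open>pre a x\<close>] and from [1/2, (x + 1)/2].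
  The second interval has length x/2 and density at most 2, and the growth of
  \<open>y powr (1 - b)\<close> along the left branch makes room for it.\<close>

lemma cone_tr:
  assumes a: "0 \<le> a" "a \<le> b" "b < 1" and f: "decr_cone b f"
  shows "decr_cone b (tr a f)"
  unfolding decr_cone_def
proof (intro conjI ballI)
  note d = cone_decr[OF f]
  note i = decr_integrable[OF d]
  show "decr (tr a f)" using d a by (intro decr_tr)
  show "(LINT x|lb01. tr a f x) \<le> 1" using tr_integrable(2)[OF a(1) i] cone_mass[OF f] by simp
  fix x :: real assume "x \<in> {0..1}"
  then consider "x = 0" | "x \<in> {0<..1}" by force
  then show "(LINT y|lb01. indicator {0..x} y * tr a f y) \<le> K0 b * x powr (1 - b)"
  proof cases
    case 1
    have "(LINT y|lb01. indicator {0..0::real} y * tr a f y) = (LINT y|lb01. 0)"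
      by (intro integral_lb01_cong borel_measurable_integrable indicator_mult_integrable tr_integrable(1)[OF a(1) i])
        (auto simp: indicator_def)
    then show ?thesis using 1 by simp
  next
    case 2
    let ?y = "pre a x"
    have y: "0 < ?y" "?y \<le> 1/2" "?y \<ge> x/2" "left_branch a ?y = x"
      using 2 pre_pos[OF a(1), of x] pre_props[OF a(1), of x] pre_bounds[OF a(1), of x] by auto
    have h1: "integrable lb01 (\<lambda>y. indicator {0..?y} y * f y)"
      by (intro indicator_mult_integrable i) auto
    have h2: "integrable lb01 (\<lambda>y. indicator {1/2..(x+1)/2} y * f (1/2))"
      by (intro indicator_mult_integrable) auto
    have "(LINT y|lb01. indicator {0..x} y * tr a f y) = (LINT y|lb01. indicator {0..x} (PM_map a y) * f y)"
      by (rule integral_tr[OF a(1) i, of _ 1]) (auto simp: indicator_def)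
    also have "\<dots> \<le> (LINT y|lb01. indicator {0..?y} y * f y + indicator {1/2..(x+1)/2} y * f (1/2))"
    proof (rule integral_lb01_mono)
      show "integrable lb01 (\<lambda>y. indicator {0..x} (PM_map a y) * f y)"
        by (rule integrable_bounded_mult[OF i, of _ 1])
           (auto intro!: borel_imp_lb01 simp: indicator_def)
      show "integrable lb01 (\<lambda>y. indicator {0..?y} y * f y + indicator {1/2..(x+1)/2} y * f (1/2))"
        by (intro Bochner_Integration.integrable_add h1 h2)
      fix z :: real assume z: "0 < z" "z \<le> 1"
      have "indicator {0..x} (PM_map a z) * f z \<le> (indicator {0..?y} z + indicator {1/2..(x+1)/2} z) * f z"
        using indicator_PM_map_le[OF a(1) 2 z] decr_nonneg[OF d z] by (rule mult_right_mono)
      also have "\<dots> \<le> indicator {0..?y} z * f z + indicator {1/2..(x+1)/2} z * f (1/2)"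
        using decr_antimono[OF d, of "1/2" z] z by (auto simp: indicator_def)
      finally show "indicator {0..x} (PM_map a z) * f z \<le> indicator {0..?y} z * f z + indicator {1/2..(x+1)/2} z * f (1/2)" .
    qed
    also have "\<dots> = (LINT y|lb01. indicator {0..?y} y * f y) + ((x+1)/2 - 1/2) * f (1/2)"
      using 2 by (subst Bochner_Integration.integral_add[OF h1 h2], subst integral_lb01_indicator) auto
    also have "\<dots> \<le> K0 b * ?y powr (1 - b) + x / 2 * 2"
    proof (rule add_mono)
      have "((x+1)/2 - 1/2) * f (1/2) = x / 2 * f (1/2)" by (simp add: field_simps)
      also have "\<dots> \<le> x / 2 * 2"
        using 2 decr_half_le[OF d] cone_mass[OF f] by (intro mult_left_mono) auto
      finally show "((x+1)/2 - 1/2) * f (1/2) \<le> x / 2 * 2" .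
    qed (use cone_near_zero[OF f, of ?y] y 2 in auto)
    also have "\<dots> \<le> K0 b * (?y powr (1 - b) + (1 - b) / 2 * ?y)"
      using a y by (simp add: K0_def distrib_left)
    also have "\<dots> \<le> K0 b * x powr (1 - b)"
      using left_branch_powr_ge[OF a y(1,2)] a by (intro mult_left_mono) (auto simp: K0_def y)
    finally show ?thesis .
  qed
qed

text \<open>Monotonicity turns the bound on the mass of [0,x] into a pointwise one. The cone itself
  keeps the integral form because that passes through \<open>tr\<close> by duality.\<close>

lemma cone_bound:
  assumes f: "decr_cone b f" and x: "0 < x" "x \<le> 1"
  shows "f x \<le> K0 b * x powr - b"
proof -
  have "x * f x \<le> K0 b * x powr (1 + - b)"
    using decr_le_integral[OF cone_decr[OF f] x] cone_near_zero[OF f, of x] x by simp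
  also have "\<dots> = x * (K0 b * x powr - b)"
    using x powr_add[of x 1 "-b"] by simp
  finally show ?thesis using x by simp
qed

text \<open>Apart from monotonicity the cone consists of upper bounds. Hence whatever coupling
  leaves over is again in the cone.\<close>

lemma cone_mono:
  assumes f: "decr_cone b f" and g: "decr g" and le: "\<And>x. 0 < x \<Longrightarrow> x \<le> 1 \<Longrightarrow> g x \<le> f x"
  shows "decr_cone b g"
  unfolding decr_cone_def
proof (intro conjI ballI g)
  note i = decr_integrable[OF cone_decr[OF f]] decr_integrable[OF g]
  have "(LINT x|lb01. g x) \<le> (LINT x|lb01. f x)" using i le by (intro integral_lb01_mono)
  then show "(LINT x|lb01. g x) \<le> 1" using cone_mass[OF f] by simp
  fix x :: real assume x: "x \<in> {0..1}"
  have "(LINT y|lb01. indicator {0..x} y * g y) \<le> (LINT y|lb01. indicator {0..x} y * f y)"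
    using le by (intro integral_lb01_mono indicator_mult_integrable i) (auto simp: indicator_def)
  then show "(LINT y|lb01. indicator {0..x} y * g y) \<le> K0 b * x powr (1 - b)"
    using cone_near_zero[OF f x] by simp
qed

lemma cone_const:
  assumes b: "0 \<le> b" "b < 1" and c: "0 \<le> c" "c \<le> 1" shows "decr_cone b (\<lambda>_. c)"
  unfolding decr_cone_def
proof (intro conjI ballI decr_const c)
  show "(LINT x|lb01. c) \<le> 1" using c by (simp add: lb01.prob_space[simplified])
  fix x :: real assume x: "x \<in> {0..1}"
  have "(LINT y|lb01. indicator {0..x} y * c) = x * c" using x by (subst integral_lb01_indicator) auto
  also have "\<dots> \<le> x * 1" using x c by (intro mult_left_mono) auto
  also have "x * 1 \<le> x powr (1 - b)"
  proof (cases "x = 0")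
    case False then show ?thesis using x b powr_exponent_le[of x "1-b" 1] by auto
  qed auto
  also have "\<dots> \<le> K0 b * x powr (1 - b)"
    using b by (simp add: K0_def field_simps mult_left_le)
  finally show "(LINT y|lb01. indicator {0..x} y * c) \<le> K0 b * x powr (1 - b)" by simp
qed

lemma cone_cmult: "decr_cone b f \<Longrightarrow> 0 \<le> c \<Longrightarrow> c \<le> 1 \<Longrightarrow> decr_cone b (\<lambda>x. c * f x)"
  by (rule cone_mono[of b f])
    (auto intro: decr_cmult cone_decr mult_left_le_one_le dest: decr_nonneg[OF cone_decr])

lemma cone_mult:
  assumes w: "w \<in> borel_measurable borel" "\<And>x. 0 \<le> x \<Longrightarrow> x \<le> 1 \<Longrightarrow> 0 \<le> w x \<and> w x \<le> 1"
    "\<And>x y. 0 \<le> x \<Longrightarrow> x \<le> y \<Longrightarrow> y \<le> 1 \<Longrightarrow> w y \<le> w x"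
    and f: "decr_cone b f"
  shows "decr_cone b (\<lambda>x. w x * f x)"
  using f w(2) decr_nonneg[OF cone_decr[OF f]] 
  by (intro cone_mono[OF f decr_mult[OF w cone_decr[OF f]]]) (auto intro: mult_left_le_one_le)

lemma cone_convex:
  assumes f: "decr_cone b f" and g: "decr_cone b g" and uv: "0 \<le> u" "0 \<le> v" "u + v \<le> 1"  and b: "b < 1"
  shows "decr_cone b (\<lambda>x. u * f x + v * g x)"
  unfolding decr_cone_def
proof (intro conjI ballI decr_add decr_cmult uv cone_decr[OF f] cone_decr[OF g])
  note i = decr_integrable[OF cone_decr[OF f]] decr_integrable[OF cone_decr[OF g]]
  have "(LINT x|lb01. u * f x + v * g x) \<le> u * 1 + v * 1"
    using i uv cone_mass[OF f] cone_mass[OF g] by (auto intro!: add_mono mult_left_mono simp del: mult_1_right)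
  then show "(LINT x|lb01. u * f x + v * g x) \<le> 1" using uv by simp
  fix x :: real assume x: "x \<in> {0..1}"
  let ?K = "K0 b * x powr (1 - b)"
  have K: "0 \<le> ?K" using b by (simp add: K0_def)
  have "(LINT y|lb01. indicator {0..x} y * (u * f y + v * g y)) =
     (LINT y|lb01. u * (indicator {0..x} y * f y) + v * (indicator {0..x} y * g y))"
    by (simp add: algebra_simps)
  also have "\<dots> = u * (LINT y|lb01. indicator {0..x} y * f y) + v * (LINT y|lb01. indicator {0..x} y * g y)"
    using indicator_mult_integrable[OF i(1)] indicator_mult_integrable[OF i(2)] by simp
  also have "\<dots> \<le> u * ?K + v * ?K"
    using cone_near_zero[OF f x] cone_near_zero[OF g x] uv by (intro add_mono mult_left_mono) auto
  also have "\<dots> \<le> ?K" using K uv mult_right_mono[of "u+v" 1 ?K] by (simp add: distrib_right)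
  finally show "(LINT y|lb01. indicator {0..x} y * (u * f y + v * g y)) \<le> ?K" .
qed

text \<open>Even the weakest expansion moves x to at least \<open>x + x * x\<close>, so the left
  preimage of the new point is at most x, where the decreasing f is at least \<open>f x\<close>. A
  lower bound travels to the right by \<open>d * d\<close> per step at the price of a factor
  3.\<close>

lemma tr_lower_spread:
  assumes a: "0 \<le> a" "a \<le> 1" and f: "decr f" and d: "0 < d" "d \<le> x" "x \<le> 1"
  shows "f x / 3 \<le> tr a f (min 1 (x + d * d))"
proof -
  let ?y = "min 1 (x + d * d)"
  have y: "0 < ?y" "?y \<le> 1" "?y \<in> {0..1}" using d by (auto simp: add_pos_pos)
  have "pre a ?y \<le> x"
  proof (cases "x < 1/2")
    case True
    have "x + d * d \<le> x + x * x" using d by (intro add_left_mono mult_mono) auto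
    also have "\<dots> \<le> left_branch a x"
      using double_powr_ge[of a 1 x] a d True by (simp add: left_branch_def distrib_left)
    finally have "pre a ?y \<le> pre a (left_branch a x)"
      using y left_branch_bounds[of a x] a d True by (intro pre_mono) auto
    then show ?thesis using pre_left_branch[of a x] a d True by simp
  qed (use pre_le_half[OF a(1) y(3)] in auto)
  then have "f x \<le> f (pre a ?y)"
    using pre_pos[OF a(1) y(1,2)] d by (intro decr_antimono[OF f]) auto
  also have "\<dots> / 3 \<le> tr a f ?y" using tr_ge_pre[OF a f y(1,2)] .
  finally show ?thesis by simp
qed

section \<open>Compositions of transfer operators along a parameter sequence\<close>

primrec trs :: "(nat \<Rightarrow> real) \<Rightarrow> nat \<Rightarrow> (real \<Rightarrow> real) \<Rightarrow> real \<Rightarrow> real" where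
  "trs a 0 f = f"
| "trs a (Suc k) f = tr (a k) (trs a k f)"

lemma trs_add: "trs a (j + k) f = trs (\<lambda>i. a (j + i)) k (trs a j f)"
  by (induction k) simp_all

lemma trs_diff: "trs a k (\<lambda>x. f x - g x) = (\<lambda>x. trs a k f x - trs a k g x)"
  by (induction k) (simp_all add: tr_def fun_eq_iff diff_divide_distrib)

lemma decr_trs: "(\<And>i. 0 \<le> a i) \<Longrightarrow> decr f \<Longrightarrow> decr (trs a k f)"
  by (induction k) (auto intro: decr_tr)

lemma cone_trs: "(\<And>i. a i \<in> {0..b}) \<Longrightarrow> b < 1 \<Longrightarrow> decr_cone b f \<Longrightarrow> decr_cone b (trs a k f)"
  by (induction k) (auto intro: cone_tr)

lemma trs_integrable:
  assumes "\<And>i. 0 \<le> a i" "integrable lb01 f"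
  shows "integrable lb01 (trs a k f)" "(LINT x|lb01. trs a k f x) = (LINT x|lb01. f x)"
  using assms by (induction k) (auto simp: tr_integrable)

lemma tr_mono:
  assumes a: "0 \<le> a" and le: "\<And>x. 0 < x \<Longrightarrow> x \<le> 1 \<Longrightarrow> f x \<le> g x" and x: "0 < x" "x \<le> 1"
  shows "tr a f x \<le> tr a g x"
  unfolding tr_def using x pre_pos[OF a x] pre_le_half[OF a, of x] left_deriv_ge_1[OF a, of "pre a x"]
  by (intro add_mono divide_right_mono le) auto

lemma trs_mono:
  assumes "\<And>i. 0 \<le> a i" "\<And>x. 0 < x \<Longrightarrow> x \<le> 1 \<Longrightarrow> f x \<le> g x" "0 < x" "x \<le> 1"
  shows "trs a k f x \<le> trs a k g x"
  using assms(3,4) by (induction k arbitrary: x) (auto intro: tr_mono assms)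

lemma trs_lower:
  assumes a: "\<And>i. a i \<in> {0..1}" and f: "decr f" and d: "0 < d" "d \<le> 1"
  shows "f d / 3 ^ k \<le> trs a k f (min 1 (d + k * (d * d)))"
proof (induction k)
  case 0 show ?case using d by simp
next
  case (Suc k)
  let ?x = "min 1 (d + k * (d * d))"
  have a': "0 \<le> a k" "a k \<le> 1" "\<And>i. 0 \<le> a i" using a by auto
  have "f d / 3 ^ Suc k \<le> trs a k f ?x / 3" using Suc by simp
  also have "\<dots> \<le> tr (a k) (trs a k f) (min 1 (?x + d * d))"
    using d by (intro tr_lower_spread a' decr_trs f) auto
  also have "min 1 (?x + d * d) = min 1 (d + real (Suc k) * (d * d))"
  proof -
    have "real (Suc k) * (d * d) = k * (d * d) + d * d" by (simp add: distrib_right)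
    moreover have "0 \<le> d * d" by simp
    ultimately show ?thesis unfolding min_def by (smt (verit))
  qed
  finally show ?case by simp
qed

text \<open>At 1 a decreasing function is smallest, so this is a lower bound on all of (0,1]. The
  travel time from d to 1 is at most about \<open>1 / (d * d)\<close> steps, whatever the parameters
  and the density.\<close>

lemma trs_lower_unif:
  assumes d: "0 < d" "d \<le> (1::real)"
  obtains N where "N \<ge> 1" "\<And>a f. (\<And>i. a i \<in> {0..1}) \<Longrightarrow> decr f \<Longrightarrow> f d / 3 ^ N \<le> trs a N f 1"
proof -
  define N where "N = nat \<lceil>1 / (d * d)\<rceil>"
  have "1 / (d * d) \<le> N" unfolding N_def by linarith
  then have "1 \<le> d + N * (d * d)" using d by (simp add: field_simps add_nonneg_pos)
  then have "min 1 (d + N * (d * d)) = 1" by simp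
  moreover have "N \<ge> 1" using \<open>1 / (d * d) \<le> N\<close> d
    by (metis One_nat_def Suc_leI divide_pos_pos mult_pos_pos of_nat_0_less_iff order_less_le_trans zero_less_one)
  ultimately show ?thesis using that[of N] trs_lower[of _ _ d N] d by metis
qed

section \<open>Powers near 0 and the truncated potential\<close>

lemma powr_lb01:
  assumes p: "-1 < p" and r: "0 \<le> r" "r \<le> 1"
  shows "integrable lb01 (\<lambda>x. indicator {0..r} x * x powr p)"
    "(LINT x|lb01. indicator {0..r} x * x powr p) = r powr (p + 1) / (p + 1)"
proof -
  have hi: "((\<lambda>x. x powr p) has_integral r powr (p+1) / (p+1)) {0..r}"
    using has_integral_powr_from_0[OF p r(1)] .
  then have ab: "(\<lambda>x. x powr p) absolutely_integrable_on {0..r}"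
    by (intro nonnegative_absolutely_integrable_1) auto
  have m: "(\<lambda>x. x powr p) \<in> borel_measurable (restrict_space borel {0..r})"
    by (simp add: measurable_restrict_space1)
  have eq: "indicator {0..1} x *\<^sub>R (indicator {0..r} x * x powr p) = indicator {0..r} x *\<^sub>R x powr p" for x
    using r by (auto simp: indicator_def)
  show "integrable lb01 (\<lambda>x. indicator {0..r} x * x powr p)"
    unfolding integrable_lb01_iff using ab abs_integrable_iff_lborel(1)[OF _ m]
    by (simp add: set_integrable_def eq del: real_scaleR_def)
  show "(LINT x|lb01. indicator {0..r} x * x powr p) = r powr (p + 1) / (p + 1)"
    unfolding LINT_lb01 using abs_integrable_iff_lborel(2)[OF _ m] set_lebesgue_integral_eq_integral(2)[OF ab]
     integral_unique[OF hi]
    by (simp add: set_lebesgue_integral_def eq del: real_scaleR_def)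
qed

text \<open>The cut-off at s makes it bounded, as the duality requires, and keeps its integral
  finite even against densities as large as \<open>x powr - b\<close> with q + b \<ge> 1.\<close>

definition pot :: "real \<Rightarrow> real \<Rightarrow> real \<Rightarrow> real" where
  "pot q s x = max x s powr - q"

lemma pot_measurable [measurable]: "pot q s \<in> borel_measurable borel"
  unfolding pot_def by measurable

lemma pot_bound: "0 < s \<Longrightarrow> 0 \<le> q \<Longrightarrow> \<bar>pot q s x\<bar> \<le> s powr - q"
  by (auto simp: pot_def intro!: powr_mono2')

lemma pot_antimono: "0 < s \<Longrightarrow> 0 \<le> q \<Longrightarrow> x \<le> y \<Longrightarrow> pot q s y \<le> pot q s x"
  by (auto simp: pot_def intro!: powr_mono2')

lemma pot_le: "0 \<le> q \<Longrightarrow> 0 < x \<Longrightarrow> pot q s x \<le> x powr - q"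
  by (auto simp: pot_def intro!: powr_mono2')

lemma pot_integrable:
  assumes "integrable lb01 f" "0 < s" "0 \<le> q"
  shows "integrable lb01 (\<lambda>x. pot q s x * f x)"
  by (rule integrable_bounded_mult[OF assms(1) borel_imp_lb01[OF pot_measurable] pot_bound[OF assms(2,3)]])

lemma pot_integral_le:
  assumes "0 < s" "0 \<le> q" "q < 1"
  shows "(LINT x|lb01. pot q s x) \<le> 1 / (1 - q)"
proof -
  have "(LINT x|lb01. pot q s x) \<le> (LINT x|lb01. indicator {0..1} x * x powr - q)"
    using pot_integrable[of "\<lambda>_. 1" s q] assms
    by (intro integral_lb01_mono powr_lb01) (auto simp: pot_le)
  also have "\<dots> = 1 / (1 - q)" using assms by (subst powr_lb01) auto
  finally show ?thesis .
qed

text \<open>A left step multiplies x by 1 + u with u \<ge> \<open>x powr b\<close>, which lowers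
  \<open>x powr - q\<close> by at least \<open>q / 4 * x powr (b - q)\<close>. As b < q, this is
  smallest at the right end d.\<close>

lemma pot_left_step:
  assumes a: "0 \<le> a" "a \<le> b" and q: "b < q" "q \<le> 1" and s: "0 < s" "s \<le> x" and x: "x \<le> d" "d < 1/2"
  shows "pot q s (PM_map a x) + q / 4 * d powr (b - q) \<le> pot q s x"
proof -
  have x0: "0 < x" "x < 1/2" using s x by auto
  let ?u = "(2*x) powr a"
  have u: "0 \<le> ?u" "?u \<le> 1" using x0 a by (auto intro: powr_le_one_unit)
  have Tx: "PM_map a x = x * (1 + ?u)" using x0 by (simp add: PM_map_left left_branch_def)
  have "x \<le> PM_map a x" using left_branch_bounds(1)[of a x] x0 a by (simp add: PM_map_left)
  then have "s \<le> PM_map a x" using s by simp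
  then have "pot q s (PM_map a x) = x powr - q * (1 + ?u) powr - q"
    by (simp add: pot_def Tx powr_mult)
  also have "\<dots> \<le> x powr - q * (1 - q * ?u / 4)"
    using one_plus_powr_minus_le[OF u, of q] a q by (intro mult_left_mono) auto
  also have "\<dots> \<le> x powr - q * (1 - q * x powr b / 4)"
    using double_powr_ge[OF a x0(1)] x0 a q
    by (intro mult_left_mono diff_left_mono divide_right_mono) auto
  also have "\<dots> = x powr - q - q / 4 * x powr (b - q)"
    by (simp add: right_diff_distrib powr_add[symmetric])
  also have "\<dots> \<le> x powr - q - q / 4 * d powr (b - q)"
  proof -
    have "d powr (b - q) \<le> x powr (b - q)" using x0 x q by (intro powr_mono2') auto
    then show ?thesis using a q by (intro diff_left_mono mult_left_mono) auto
  qed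
  finally show ?thesis using s by (simp add: pot_def)
qed

text \<open>Mass in [s,d] loses potential at the rate of \<open>pot_left_step\<close>. The only gain
  comes from the right branch, which spreads a density of at most \<open>f (1/2)\<close> over [0,1];
  it is at most half the integral of the potential times twice the mass.\<close>

lemma pot_tr:
  assumes a: "0 \<le> a" "a \<le> b" and q: "b < q" "q < 1" and s: "0 < s" and d: "d < 1/2"
   and f: "decr f"
  shows "(LINT x|lb01. pot q s x * tr a f x) + q / 4 * d powr (b - q) * (LINT x|lb01. indicator {s..d} x * f x)
     \<le> (LINT x|lb01. pot q s x * f x) + (LINT x|lb01. f x) / (1 - q)"
proof -
  note i = decr_integrable[OF f]
  let ?c = "q / 4 * d powr (b - q)"
  have q0: "0 \<le> q" using a q by simp
  \<comment> \<open>This is \<open>tr_right\<close> for the constant density 1: the right branch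
    doubles lengths, so the integral over [1/2,1] is half of that over [0,1].\<close>
  have V2: "set_integrable lborel {1/2..1} (\<lambda>x. pot q s (PM_map a x))"
    "(LINT x:{1/2..1}|lborel. pot q s (PM_map a x)) = (LINT x|lb01. pot q s x) / 2"
  proof -
    have "integrable lb01 (\<lambda>x. pot q s (PM_map a x) * 1)"
      by (rule integrable_bounded_mult[OF _ _ pot_bound[OF s q0]]) (simp_all add: borel_imp_lb01)
    then show "set_integrable lborel {1/2..1} (\<lambda>x. pot q s (PM_map a x))"
      unfolding integrable_lb01_iff by (auto intro: set_integrable_subset[of lborel "{0..1}"])
    show "(LINT x:{1/2..1}|lborel. pot q s (PM_map a x)) = (LINT x|lb01. pot q s x) / 2"
      using tr_right(2)[of "\<lambda>_. 1" "pot q s" "s powr -q" a] pot_bound[OF s q0] by (simp add: LINT_lb01)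
  qed
  have eqr: "indicator {0..1} x *\<^sub>R (indicator {1/2..1} x * pot q s (PM_map a x)) = indicator {1/2..1} x *\<^sub>R pot q s (PM_map a x)" for x
    by (auto simp: indicator_def)
  have R: "integrable lb01 (\<lambda>x. indicator {1/2..1} x * pot q s (PM_map a x))"
    using V2(1) unfolding integrable_lb01_iff set_integrable_def eqr .
  have R2: "(LINT x|lb01. indicator {1/2..1} x * pot q s (PM_map a x)) = (LINT x|lb01. pot q s x) / 2"
    using V2(2) unfolding LINT_lb01 set_lebesgue_integral_def eqr .
  have "(LINT x|lb01. pot q s x * tr a f x) = (LINT x|lb01. pot q s (PM_map a x) * f x)"
    by (rule integral_tr[OF a(1) i pot_measurable pot_bound[OF s q0]])
  also have "\<dots> \<le> (LINT x|lb01. (pot q s x * f x - ?c * (indicator {s..d} x * f x)) + indicator {1/2..1} x * pot q s (PM_map a x) * f (1/2))"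
  proof (rule integral_lb01_mono)
    show "integrable lb01 (\<lambda>x. pot q s (PM_map a x) * f x)"
      by (rule integrable_bounded_mult[OF i _ pot_bound[OF s q0]]) (auto intro!: borel_imp_lb01)
    show "integrable lb01 (\<lambda>x. pot q s x * f x - ?c * (indicator {s..d} x * f x) + indicator {1/2..1} x * pot q s (PM_map a x) * f (1/2))"
      by (intro Bochner_Integration.integrable_add Bochner_Integration.integrable_diff pot_integrable i s q0
          integrable_mult_right integrable_mult_left indicator_mult_integrable R) auto
    fix x :: real assume x: "0 < x" "x \<le> 1"
    have f0: "0 \<le> f x" using decr_nonneg[OF f x] .
    \<comment> \<open>On the right half only the reinjection term counts, on [s,d] the drop is
      quantitative, and at the other points the map moves x to the right, so the potential does not
      grow.\<close>
    consider "x \<ge> 1/2" | "x < 1/2" "x \<in> {s..d}" | "x < 1/2" "x \<notin> {s..d}" by linarith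
    then show "pot q s (PM_map a x) * f x \<le> pot q s x * f x - ?c * (indicator {s..d} x * f x) + indicator {1/2..1} x * pot q s (PM_map a x) * f (1/2)"
    proof cases
      case 1
      have "pot q s (PM_map a x) * f x \<le> pot q s (PM_map a x) * f (1/2)"
        using decr_antimono[OF f, of "1/2" x] 1 x by (intro mult_left_mono) (auto simp: pot_def)
      moreover have "0 \<le> pot q s x * f x" using f0 by (simp add: pot_def)
      moreover have "indicator {s..d} x = (0::real)" "indicator {1/2..1} x = (1::real)" using 1 d x by (auto simp: indicator_def)
      ultimately show ?thesis by simp
    next
      case 2
      have "(pot q s (PM_map a x) + ?c) * f x \<le> pot q s x * f x"
        using pot_left_step[of a b q s x d] a q s 2 d f0 by (intro mult_right_mono) auto
      then show ?thesis using 2 by (simp add: algebra_simps)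
    next
      case 3
      have "pot q s (PM_map a x) \<le> pot q s x"
        using 3 x a s q0 left_branch_bounds[of a x] by (intro pot_antimono) (auto simp: PM_map_left)
      then show ?thesis using f0 3 by (simp add: mult_right_mono)
    qed
  qed
  also have "\<dots> = (LINT x|lb01. pot q s x * f x) - ?c * (LINT x|lb01. indicator {s..d} x * f x) + (LINT x|lb01. pot q s x) / 2 * f (1/2)"
  proof -
    have I: "integrable lb01 (\<lambda>x. pot q s x * f x)" "integrable lb01 (\<lambda>x. ?c * (indicator {s..d} x * f x))"
      "integrable lb01 (\<lambda>x. indicator {1/2..1} x * pot q s (PM_map a x) * f (1/2))"
      by (intro pot_integrable i s q0
          integrable_mult_right integrable_mult_left indicator_mult_integrable R; simp)+
    show ?thesis
      unfolding R2[symmetric] integral_mult_left_zero[symmetric] integral_mult_right_zero[symmetric]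
      by (subst Bochner_Integration.integral_add, intro Bochner_Integration.integrable_diff I, rule I(3),
          subst Bochner_Integration.integral_diff, rule I, rule I, rule refl)
  qed
  also have "(LINT x|lb01. pot q s x) / 2 * f (1/2) \<le> (1 / (1 - q)) / 2 * (2 * (LINT x|lb01. f x))"
    using pot_integral_le[OF s q0 q(2)] decr_half_le[OF f] q decr_nonneg[OF f, of "1/2"]
    by (intro mult_mono divide_right_mono) auto
  also have "(1 / (1 - q)) / 2 * (2 * (LINT x|lb01. f x)) = (LINT x|lb01. f x) / (1 - q)"
    using q by (simp add: divide_simps)
  finally show ?thesis by linarith
qed

section \<open>Coupling and loss of memory\<close>

abbreviation Pot :: "real \<Rightarrow> real \<Rightarrow> (real \<Rightarrow> real) \<Rightarrow> real" where
  "Pot q s f \<equiv> LINT x|lb01. pot q s x * f x"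

lemma Pot_mono:
  assumes "0 < s" "0 \<le> q" "integrable lb01 f" "integrable lb01 g" "\<And>x. 0 < x \<Longrightarrow> x \<le> 1 \<Longrightarrow> f x \<le> g x"
  shows "Pot q s f \<le> Pot q s g"
  using assms by (intro integral_lb01_mono pot_integrable mult_left_mono) (auto simp: pot_def)

lemma Pot_nonneg: "decr f \<Longrightarrow> 0 \<le> Pot q s f"
  by (intro integral_lb01_nonneg mult_nonneg_nonneg) (auto simp: pot_def decr_nonneg)

text \<open>Only the reinjection term of \<open>pot_tr\<close> is kept; the drop is discarded, so
  its parameter d may be any value, here 1/4.\<close>

lemma Pot_trs:
  assumes a: "\<And>i. a i \<in> {0..b}" and q: "b < q" "q < 1" and s: "0 < s" and f: "decr f"
  shows "Pot q s (trs a k f) \<le> Pot q s f + k * ((LINT x|lb01. f x) / (1 - q))"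
proof (induction k)
  case (Suc k)
  have a': "0 \<le> a k" "a k \<le> b" "\<And>i. 0 \<le> a i" using a by auto
  have d: "decr (trs a k f)" by (intro decr_trs a' f)
  have "0 \<le> q / 4 * (1/4) powr (b - q) * (LINT x|lb01. indicator {s..1/4} x * trs a k f x)"
    using order_trans[OF a'(1,2)] q decr_nonneg[OF d] by (intro mult_nonneg_nonneg integral_lb01_nonneg) auto
  with pot_tr[OF a'(1,2) q s _ d, of "1/4"] Suc
  have "Pot q s (trs a (Suc k) f) \<le> Pot q s f + k * ((LINT x|lb01. f x) / (1 - q)) + (LINT x|lb01. f x) / (1 - q)"
    using trs_integrable(2)[of a f k] a'(3) decr_integrable[OF f] by simp
  then show ?case unfolding of_nat_Suc distrib_right by linarith
qed simp

lemma powr_small: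
  assumes "0 < (p::real)" "1 \<le> R"
  obtains d where "0 < d" "d < 1/2" "R \<le> d powr - p"
proof -
  define e where "e = R powr (- 1 / p)"
  define d where "d = min e (1/4)"
  have "e > 0" using assms by (simp add: e_def)
  then have d: "0 < d" "d < 1/2" "d \<le> e" by (auto simp: d_def)
  have "R = e powr - p" using assms by (simp add: e_def powr_powr)
  also have "\<dots> \<le> d powr - p" using d assms by (intro powr_mono2') auto
  finally show ?thesis using that d by blast
qed

text \<open>To the right of d the density is at most \<open>f d\<close>, on a set of length at most
  1. If no more than half of the mass lies in [0,d], then \<open>f d\<close> is at least half of the
  mass.\<close>

lemma decr_spread:
  assumes f: "decr f" and d: "0 < d" "d \<le> 1"
  shows "(LINT x|lb01. f x) \<le> (LINT x|lb01. indicator {0..d} x * f x) + f d"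
proof -
  have I: "integrable lb01 (\<lambda>x. indicator {0..d} x * f x)"
    by (intro indicator_mult_integrable decr_integrable[OF f]) auto
  have "(LINT x|lb01. f x) \<le> (LINT x|lb01. indicator {0..d} x * f x + f d)"
    using d decr_antimono[OF f] decr_nonneg[OF f]
    by (intro integral_lb01_mono Bochner_Integration.integrable_add I decr_integrable[OF f])
      (auto simp: indicator_def add_increasing2 add_increasing)
  also have "\<dots> = (LINT x|lb01. indicator {0..d} x * f x) + f d"
    using I lb01.prob_space by simp
  finally show ?thesis .
qed

lemma decr_split_indicator:
  assumes f: "decr f"
  shows "(LINT x|lb01. indicator {0..d} x * f x) \<le> (LINT x|lb01. indicator {0..s} x * f x) + (LINT x|lb01. indicator {s..d} x * f x)"
proof -
  have I: "integrable lb01 (\<lambda>x. indicator S x * f x)" if "S \<in> sets borel" for S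
    by (intro indicator_mult_integrable decr_integrable[OF f] that)
  have "(LINT x|lb01. indicator {0..d} x * f x) \<le> (LINT x|lb01. indicator {0..s} x * f x + indicator {s..d} x * f x)"
    using decr_nonneg[OF f]
    by (intro integral_lb01_mono Bochner_Integration.integrable_add I) (auto simp: indicator_def)
  also have "\<dots> = (LINT x|lb01. indicator {0..s} x * f x) + (LINT x|lb01. indicator {s..d} x * f x)"
    using I[of "{0..s}"] I[of "{s..d}"] by simp
  finally show ?thesis .
qed

text \<open>The functions \<open>f'\<close> and \<open>g'\<close> are the parts not yet coupled
  after k steps. The removed parts coincide because the differences agree, so no joint distribution
  is needed. The relation is pointwise on (0,1], which is what monotone operators can
  propagate.\<close>

definition coupled :: "(nat \<Rightarrow> real) \<Rightarrow> nat \<Rightarrow> (real \<Rightarrow> real) \<Rightarrow> (real \<Rightarrow> real) \<Rightarrow> (real \<Rightarrow> real) \<Rightarrow> (real \<Rightarrow> real) \<Rightarrow> bool" where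
  "coupled a k f g f' g' \<longleftrightarrow> decr f' \<and> decr g' \<and>
     (\<forall>x\<in>{0<..1}. f' x \<le> trs a k f x \<and> g' x \<le> trs a k g x \<and> f' x - g' x = trs a k f x - trs a k g x) \<and>
     (LINT x|lb01. f' x) = (LINT x|lb01. g' x) \<and> (LINT x|lb01. f' x) \<le> (LINT x|lb01. f x)"

lemma coupled_trivial:
  assumes "\<And>i. 0 \<le> a i" "decr f" "decr g" "(LINT x|lb01. f x) = (LINT x|lb01. g x)"
  shows "coupled a k f g (trs a k f) (trs a k g)"
  using assms by (auto simp: coupled_def decr_trs trs_integrable decr_integrable)

lemma coupled_trans:
  assumes a: "\<And>i. 0 \<le> a i" and 1: "coupled a j f g f1 g1" and 2: "coupled (\<lambda>i. a (j + i)) k f1 g1 f2 g2"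
  shows "coupled a (j + k) f g f2 g2"
proof -
  let ?a = "\<lambda>i. a (j + i)"
  have "f2 x \<le> trs a (j + k) f x \<and> g2 x \<le> trs a (j + k) g x \<and> f2 x - g2 x = trs a (j + k) f x - trs a (j + k) g x"
    if x: "x \<in> {0<..1}" for x
  proof -
    have "trs ?a k f1 x \<le> trs ?a k (trs a j f) x" "trs ?a k g1 x \<le> trs ?a k (trs a j g) x"
      using 1 x a by (auto intro!: trs_mono simp: coupled_def)
    \<comment> \<open>The two differences agree on (0,1] only and not as functions, so monotonicity
      of \<open>trs\<close> is applied in both directions instead of rewriting.\<close>
    moreover have "trs ?a k f1 x - trs ?a k g1 x = trs ?a k (trs a j f) x - trs ?a k (trs a j g) x"
    proof (rule antisym)
      have *: "trs ?a k f1 x - trs ?a k g1 x = trs ?a k (\<lambda>x. f1 x - g1 x) x"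
        "trs ?a k (trs a j f) x - trs ?a k (trs a j g) x = trs ?a k (\<lambda>x. trs a j f x - trs a j g x) x"
        by (simp_all add: trs_diff)
      show "trs ?a k f1 x - trs ?a k g1 x \<le> trs ?a k (trs a j f) x - trs ?a k (trs a j g) x"
        unfolding * using 1 x a by (intro trs_mono) (auto simp: coupled_def)
      show "trs ?a k (trs a j f) x - trs ?a k (trs a j g) x \<le> trs ?a k f1 x - trs ?a k g1 x"
        unfolding * using 1 x a by (intro trs_mono) (auto simp: coupled_def)
    qed
    ultimately show ?thesis using 2 x by (force simp: coupled_def trs_add)
  qed
  then show ?thesis using 1 2 by (auto simp: coupled_def)
qed

text \<open>The actual coupling step: a constant below both minima is a common part of the two
  densities.\<close>

lemma coupled_subtract:
  assumes a: "\<And>i. 0 \<le> a i" and f: "decr f" and g: "decr g" and eq: "(LINT x|lb01. f x) = (LINT x|lb01. g x)"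
    and c: "0 \<le> c" "c \<le> trs a k f 1" "c \<le> trs a k g 1"
  shows "coupled a k f g (\<lambda>x. trs a k f x - c) (\<lambda>x. trs a k g x - c)"
    "(LINT x|lb01. trs a k f x - c) = (LINT x|lb01. f x) - c"
proof -
  have I: "(LINT x|lb01. trs a k h x - c) = (LINT x|lb01. h x) - c" if "decr h" for h
    using trs_integrable[where a=a and k=k, OF a decr_integrable[OF that]] lb01.prob_space by simp
  then show "(LINT x|lb01. trs a k f x - c) = (LINT x|lb01. f x) - c" using f by blast
  show "coupled a k f g (\<lambda>x. trs a k f x - c) (\<lambda>x. trs a k g x - c)"
    using assms I[OF f] I[OF g] by (auto simp: coupled_def intro!: decr_minus_const decr_trs)
qed

lemma coupled_cone:
  assumes "coupled a k f g f' g'" "\<And>i. a i \<in> {0..b}" "b < 1" "decr_cone b f" "decr_cone b g"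
  shows "decr_cone b f'" "decr_cone b g'"
  using assms cone_mono[of b "trs a k f" f'] cone_mono[of b "trs a k g" g']
    cone_trs[where a=a and k=k, OF assms(2,3,4)] cone_trs[where a=a and k=k, OF assms(2,3,5)]
  by (auto simp: coupled_def)

text \<open>Either the remaining mass is comparable with what a density in the cone may hide in
  [0,s], where the truncated potential sees nothing, or k times this mass is paid for by the initial
  potential and mass. The constant B does not depend on s, which is chosen later according to k or
  to a tolerance.\<close>

definition coupling_bound :: "real \<Rightarrow> real \<Rightarrow> real \<Rightarrow> bool" where
  "coupling_bound b q B \<longleftrightarrow> 0 \<le> B \<and> (\<forall>s k a f g. 0 < s \<longrightarrow> s \<le> 1 \<longrightarrow> (\<forall>i. a i \<in> {0..b}) \<longrightarrow> decr_cone b f \<longrightarrow> decr_cone b g \<longrightarrow>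
     (LINT x|lb01. f x) = (LINT x|lb01. g x) \<longrightarrow>
     (\<exists>f' g'. coupled a k f g f' g' \<and> ((LINT x|lb01. f' x) \<le> 4 * (K0 b * s powr (1 - b)) \<or>
       real k * (LINT x|lb01. f' x) \<le> Pot q s f + Pot q s g + B * (LINT x|lb01. f x))))"

lemma coupling_boundD:
  assumes "coupling_bound b q B" "0 < s" "s \<le> 1" "\<And>i. a i \<in> {0..b}" "decr_cone b f" "decr_cone b g"
    "(LINT x|lb01. f x) = (LINT x|lb01. g x)"
  obtains f' g' where "coupled a k f g f' g'" "(LINT x|lb01. f' x) \<le> 4 * (K0 b * s powr (1 - b)) \<or>
       real k * (LINT x|lb01. f' x) \<le> Pot q s f + Pot q s g + B * (LINT x|lb01. f x)"
proof -
  have "\<exists>f' g'. coupled a k f g f' g' \<and> ((LINT x|lb01. f' x) \<le> 4 * (K0 b * s powr (1 - b)) \<or>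
       real k * (LINT x|lb01. f' x) \<le> Pot q s f + Pot q s g + B * (LINT x|lb01. f x))"
    by (rule assms(1)[unfolded coupling_bound_def, THEN conjunct2, rule_format]) (use assms in auto)
  then show ?thesis using that by blast
qed

text \<open>Either a fixed proportion of both densities lies above a fixed point \<open>d\<close>, and then
  a constant can be subtracted after \<open>N\<close> steps, or one of them is concentrated near \<open>0\<close>,
  and then the potential drops by more than the mass in one step.\<close>

proposition coupling:
  assumes b: "0 < b" "b < q" "q < 1"
  shows "\<exists>B. coupling_bound b q B"
proof -
  have K: "2 / (1 - q) + 1 \<ge> 1" using b by simp
  have q0: "0 < q" using b by simp
  \<comment> \<open>With this d the drop rate c satisfies
    \<open>c / 4 \<ge> 2 / (1 - q) + 1\<close>: if a quarter of the mass M lies in [s,d], the drop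
    pays for the reinjection of both densities, \<open>2 * M / (1 - q)\<close>, and leaves M
    over.\<close>
  obtain d where d: "0 < d" "d < 1/2" "16 / q * (2 / (1 - q) + 1) \<le> d powr - (q - b)"
    using powr_small[of "q - b" "16 / q * (2 / (1 - q) + 1)"] b q0 K
      mult_mono[of 1 "16/q" 1 "2 / (1 - q) + 1"] by (auto simp: divide_simps)
  define c where "c = q / 4 * d powr (b - q)"
  have c: "2 / (1 - q) + 1 \<le> c / 4" using d(3) q0 by (simp add: c_def field_simps)
  obtain N where N: "N \<ge> 1" "\<And>a f. (\<And>i. a i \<in> {0..1}) \<Longrightarrow> decr f \<Longrightarrow> f d / 3 ^ N \<le> trs a N f 1"
    using trs_lower_unif[of d] d by auto
  \<comment> \<open>The fraction removed after N steps: \<open>decr_spread\<close> gives half of the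
    mass at d, and N steps divide it by \<open>3 ^ N\<close>.\<close>
  define \<eta> :: real where "\<eta> = 1 / (2 * 3 ^ N)"
  have \<eta>: "0 < \<eta>" "\<eta> \<le> 1" by (auto simp: \<eta>_def divide_simps intro: order_trans[of 1 2])
  \<comment> \<open>\<open>B * \<eta>\<close> is the price of N steps per unit of mass: the growth
    of the two potentials, plus N for the time that these steps consume.\<close>
  define B where "B = (2 * N / (1 - q) + N) / \<eta>"
  have B: "0 \<le> B" "real N \<le> B" "B * \<eta> = 2 * N / (1 - q) + N"
  proof -
    show "B * \<eta> = 2 * N / (1 - q) + N" using \<eta> by (simp add: B_def)
    have "real N \<le> 2 * N / (1 - q) + N" using b by simp
    also have "\<dots> \<le> (2 * N / (1 - q) + N) / \<eta>" using \<eta> b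
      by (intro mult_imp_le_div_pos mult_right_le_one_le) auto
    finally show "real N \<le> B" by (simp add: B_def)
    then show "0 \<le> B" by simp
  qed
  have main: "\<exists>f' g'. coupled a k f g f' g' \<and> ((LINT x|lb01. f' x) \<le> 4 * (K0 b * s powr (1 - b)) \<or>
       k * (LINT x|lb01. f' x) \<le> Pot q s f + Pot q s g + B * (LINT x|lb01. f x))"
    if s: "0 < s" "s \<le> 1" and a: "\<And>i. a i \<in> {0..b}" and f: "decr_cone b f" and g: "decr_cone b g"
      and eq: "(LINT x|lb01. f x) = (LINT x|lb01. g x)" for s k a f g
    using a f g eq
  proof (induction k arbitrary: a f g rule: less_induct)
    case (less k a f g)
    define M where "M = (LINT x|lb01. f x)"
    note a = less.prems(1) and f = less.prems(2) and g = less.prems(3) and eq = less.prems(4)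
    have a0: "\<And>i. 0 \<le> a i" and a1: "\<And>i. a i \<in> {0..1}" using a b by (auto intro!: order_trans[of "a _" b 1])
    have df: "decr f" and dg: "decr g" using f g by (auto dest: cone_decr)
    have M0: "0 \<le> M" unfolding M_def using decr_nonneg[OF df] by (intro integral_lb01_nonneg)
    have Mg: "(LINT x|lb01. g x) = M" using eq M_def by simp
    have P0: "0 \<le> Pot q s f" "0 \<le> Pot q s g" using Pot_nonneg df dg by auto
    have triv: "coupled a k f g (trs a k f) (trs a k g)" "(LINT x|lb01. trs a k f x) = M"
      using coupled_trivial[where a=a, OF a0 df dg eq] trs_integrable(2)[where a=a, OF a0 decr_integrable[OF df]] M_def by auto
    \<comment> \<open>Each case stops or hands a shorter time to the induction hypothesis:
      \<open>conc\<close> spends one step, \<open>spread\<close> spends N. In \<open>short\<close>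
      the mass term alone suffices, as B \<ge> N.\<close>
    consider (small) "M \<le> 4 * (K0 b * s powr (1 - b))"
      | (conc) "M > 4 * (K0 b * s powr (1 - b))" "k \<ge> 1" "(LINT x|lb01. indicator {0..d} x * f x) > M/2 \<or> (LINT x|lb01. indicator {0..d} x * g x) > M/2"
      | (short) "k < N"
      | (spread) "k \<ge> N" "(LINT x|lb01. indicator {0..d} x * f x) \<le> M/2" "(LINT x|lb01. indicator {0..d} x * g x) \<le> M/2"
      using N(1) by linarith
    then show ?case
    proof cases
      case small
      then show ?thesis using triv by metis
    next
      case short
      have "k * M \<le> B * M" using short B M0 by (intro mult_right_mono) auto
      then have "k * (LINT x|lb01. trs a k f x) \<le> Pot q s f + Pot q s g + B * (LINT x|lb01. f x)"
        using triv(2) P0 M_def by simp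
      then show ?thesis using triv(1) by blast
    next
      case conc
      let ?f = "tr (a 0) f" and ?g = "tr (a 0) g"
      have a00: "0 \<le> a 0" "a 0 \<le> b" using a[of 0] by auto
      \<comment> \<open>By the cone condition [0,s] carries less than M/4, so of the mass M/2 in
        [0,d] at least M/4 lies in [s,d].\<close>
      have part: "(LINT x|lb01. indicator {s..d} x * h x) \<ge> M / 4"
        if h: "decr_cone b h" "(LINT x|lb01. indicator {0..d} x * h x) > M/2" for h
        using decr_split_indicator[OF cone_decr[OF h(1)], of d s] cone_near_zero[OF h(1), of s] h(2) conc(1) s
        by auto
      have nn: "0 \<le> (LINT x|lb01. indicator {s..d} x * h x)" if h: "decr_cone b h" for h
        using decr_nonneg[OF cone_decr[OF h]] by (intro integral_lb01_nonneg mult_nonneg_nonneg) auto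
      have "M / 4 \<le> (LINT x|lb01. indicator {s..d} x * f x) + (LINT x|lb01. indicator {s..d} x * g x)"
        using conc(3) part[OF f] part[OF g] nn[OF f] nn[OF g] by linarith
      then have "c * (M / 4) \<le> c * ((LINT x|lb01. indicator {s..d} x * f x) + (LINT x|lb01. indicator {s..d} x * g x))"
        using c K by (intro mult_left_mono) (linarith, linarith)
      moreover have "(2 / (1 - q) + 1) * M \<le> c / 4 * M" using c M0 by (intro mult_right_mono)
      moreover have "(2 / (1 - q) + 1) * M = 2 * (M / (1 - q)) + M" by (simp add: distrib_right)
      moreover have "Pot q s (tr (a 0) h) + c * (LINT x|lb01. indicator {s..d} x * h x) \<le> Pot q s h + M / (1 - q)"
        if "decr h" "(LINT x|lb01. h x) = M" for h
        using pot_tr[OF a00 b(2,3) s(1) d(2) that(1)] that(2) by (simp add: c_def)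
      note this[OF df M_def[symmetric]] this[OF dg Mg]
      \<comment> \<open>The surplus M pays for the step just spent, because the final remainder has
        mass at most M.\<close>
      ultimately have "Pot q s ?f + Pot q s ?g + M \<le> Pot q s f + Pot q s g"
        unfolding distrib_left by simp
      moreover
      have cf: "decr_cone b ?f" "decr_cone b ?g" using cone_tr[OF a00] b f g by auto
      have Mf: "(LINT x|lb01. ?f x) = M" "(LINT x|lb01. ?g x) = M"
        using tr_integrable(2)[OF a00(1) decr_integrable] df dg M_def Mg by auto
      obtain f' g' where fg: "coupled (\<lambda>i. a (1 + i)) (k - 1) ?f ?g f' g'"
        "(LINT x|lb01. f' x) \<le> 4 * (K0 b * s powr (1 - b)) \<or>
       real (k - 1) * (LINT x|lb01. f' x) \<le> Pot q s ?f + Pot q s ?g + B * (LINT x|lb01. ?f x)"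
        using less.IH[of "k - 1" "\<lambda>i. a (1 + i)" ?f ?g] conc(2) a cf Mf by auto
      have c1: "coupled a 1 f g ?f ?g" using coupled_trivial[where a=a and k=1, OF a0 df dg eq] by simp
      have cc: "coupled a k f g f' g'"
        using coupled_trans[where a=a, OF a0 c1 fg(1)] conc(2) by simp
      have "(LINT x|lb01. f' x) \<le> M" using cc by (simp add: coupled_def M_def)
      moreover have "real k * (LINT x|lb01. f' x) = real (k - 1) * (LINT x|lb01. f' x) + (LINT x|lb01. f' x)"
        using conc(2) by (simp add: of_nat_diff algebra_simps)
      ultimately have "(LINT x|lb01. f' x) \<le> 4 * (K0 b * s powr (1 - b)) \<or>
         real k * (LINT x|lb01. f' x) \<le> Pot q s f + Pot q s g + B * (LINT x|lb01. f x)"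
        using fg(2) unfolding Mf M_def[symmetric] by linarith
      then show ?thesis using cc by blast
    next
      case spread
      define m where "m = \<eta> * M"
      have "m \<le> trs a N h 1" if h: "decr_cone b h" "(LINT x|lb01. indicator {0..d} x * h x) \<le> M/2" "(LINT x|lb01. h x) = M" for h
      proof -
        have "M / 2 \<le> h d" using decr_spread[OF cone_decr[OF h(1)], of d] h(2,3) d by simp
        then have "M / 2 / 3 ^ N \<le> h d / 3 ^ N" by (intro divide_right_mono) auto
        also have "\<dots> \<le> trs a N h 1" using N(2)[where a=a, OF a1 cone_decr[OF h(1)]] .
        finally show ?thesis by (simp add: m_def \<eta>_def)
      qed
      note low = this[OF f spread(2) M_def[symmetric]] this[OF g spread(3) Mg]
      have m0: "0 \<le> m" using \<eta> M0 by (simp add: m_def)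
      let ?f = "\<lambda>x. trs a N f x - m" and ?g = "\<lambda>x. trs a N g x - m"
      have c1: "coupled a N f g ?f ?g" using coupled_subtract(1)[where a=a, OF a0 df dg eq m0 low] .
      have Mf: "(LINT x|lb01. ?f x) = M - m" using coupled_subtract(2)[where a=a, OF a0 df dg eq m0 low] M_def by simp
      have cf: "decr_cone b ?f" "decr_cone b ?g" using coupled_cone[where a=a, OF c1 a _ f g] b by auto
      obtain f' g' where fg: "coupled (\<lambda>i. a (N + i)) (k - N) ?f ?g f' g'"
        "(LINT x|lb01. f' x) \<le> 4 * (K0 b * s powr (1 - b)) \<or>
       real (k - N) * (LINT x|lb01. f' x) \<le> Pot q s ?f + Pot q s ?g + B * (LINT x|lb01. ?f x)"
      proof -
        have "(LINT x|lb01. ?f x) = (LINT x|lb01. ?g x)" using c1 by (simp only: coupled_def)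
        moreover have "k - N < k" using spread(1) N(1) by simp
        ultimately show ?thesis using less.IH[of "k - N" "\<lambda>i. a (N + i)" ?f ?g] a cf that by blast
      qed
      have cc: "coupled a k f g f' g'"
        using coupled_trans[where a=a, OF a0 c1 fg(1)] spread(1) by simp
      have le: "Pot q s (\<lambda>x. trs a N h x - m) \<le> Pot q s h + N * (M / (1 - q))" if h: "decr_cone b h" "(LINT x|lb01. h x) = M" for h
      proof -
        have "Pot q s (\<lambda>x. trs a N h x - m) \<le> Pot q s (trs a N h)"
          using m0 q0 s trs_integrable(1)[where a=a, OF a0 decr_integrable[OF cone_decr[OF h(1)]]] by (intro Pot_mono) auto
        also have "\<dots> \<le> Pot q s h + N * (M / (1 - q))"
          using Pot_trs[where a=a, OF a b(2,3) s(1) cone_decr[OF h(1)], where k=N] h(2) by simp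
        finally show ?thesis .
      qed
      \<comment> \<open>Removing m lowers the mass term by \<open>B * \<eta> * M\<close>, which by
        the choice of B balances the growth of the potentials and the N steps exactly.\<close>
      have "Pot q s ?f + Pot q s ?g + B * (M - m) + N * M \<le> Pot q s f + Pot q s g + 2 * N / (1 - q) * M + B * M - (B * \<eta>) * M + N * M"
      proof -
        have "2 * N / (1 - q) * M = 2 * (N * (M / (1 - q)))" by simp
        moreover have "B * (M - m) = B * M - (B * \<eta>) * M" by (simp add: m_def algebra_simps)
        ultimately show ?thesis using le[OF f M_def[symmetric]] le[OF g Mg] by linarith
      qed
      also have "\<dots> = Pot q s f + Pot q s g + B * M" by (simp add: B(3) algebra_simps)
      finally have 1: "Pot q s ?f + Pot q s ?g + B * (M - m) + N * M \<le> Pot q s f + Pot q s g + B * M" .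
      have "(LINT x|lb01. f' x) \<le> M" using cc by (simp add: coupled_def M_def)
      then have "N * (LINT x|lb01. f' x) \<le> N * M" by (intro mult_left_mono) auto
      moreover have "real k * (LINT x|lb01. f' x) = real (k - N) * (LINT x|lb01. f' x) + N * (LINT x|lb01. f' x)"
        using spread(1) by (simp add: of_nat_diff algebra_simps)
      ultimately have "(LINT x|lb01. f' x) \<le> 4 * (K0 b * s powr (1 - b)) \<or>
         real k * (LINT x|lb01. f' x) \<le> Pot q s f + Pot q s g + B * (LINT x|lb01. f x)"
        using fg(2) 1 unfolding Mf M_def[symmetric] by linarith
      then show ?thesis using cc by blast
    qed
  qed
  show ?thesis
    unfolding coupling_bound_def
    by (intro exI[of _ B] conjI B(1) allI impI main) blast+
qed

text \<open>The coupled parts cancel, and each remainder contributes its mass.\<close>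

lemma coupled_L1:
  assumes c: "coupled a k f g f' g'" and a: "\<And>i. 0 \<le> a i" and f: "integrable lb01 f" and g: "integrable lb01 g"
    and p: "\<psi> \<in> borel_measurable borel" and bd: "\<And>x. \<bar>\<psi> x\<bar> \<le> 1"
  shows "\<bar>(LINT x|lb01. \<psi> x * trs a k f x) - (LINT x|lb01. \<psi> x * trs a k g x)\<bar> \<le> 2 * (LINT x|lb01. f' x)"
proof -
  have d: "decr f'" "decr g'" using c by (auto simp: coupled_def)
  note i = decr_integrable[OF d(1)] decr_integrable[OF d(2)] 
  note I = trs_integrable(1)[where a=a and k=k, OF a f] trs_integrable(1)[where a=a and k=k, OF a g]
  have J: "integrable lb01 (\<lambda>x. \<psi> x * h x)" if "integrable lb01 h" for h
    by (rule integrable_bounded_mult[OF that borel_imp_lb01[OF p] bd])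
  have "(LINT x|lb01. \<psi> x * trs a k f x) - (LINT x|lb01. \<psi> x * trs a k g x)
      = (LINT x|lb01. \<psi> x * trs a k f x - \<psi> x * trs a k g x)"
    using J I by simp
  also have "\<dots> = (LINT x|lb01. \<psi> x * (f' x - g' x))"
    using c by (intro integral_lb01_cong borel_measurable_integrable Bochner_Integration.integrable_diff J I i)
      (auto simp: coupled_def right_diff_distrib[symmetric])
  also have "\<bar>\<dots>\<bar> \<le> 1 * (LINT x|lb01. \<bar>f' x - g' x\<bar>)"
    by (rule integral_bounded_mult_le[OF _ borel_imp_lb01[OF p] bd]) (use i in simp)
  also have "(LINT x|lb01. \<bar>f' x - g' x\<bar>) \<le> (LINT x|lb01. f' x + g' x)"
    using i decr_nonneg[OF d(1)] decr_nonneg[OF d(2)] by (intro integral_lb01_mono) (auto simp: abs_le_iff add_increasing)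
  also have "\<dots> = 2 * (LINT x|lb01. f' x)" using c i by (simp add: coupled_def)
  finally show ?thesis by simp
qed

text \<open>The rate is uniform over parameter sequences in [0,b], so it applies to every time
  window of every row of the array.\<close>

definition memory_loss :: "real \<Rightarrow> (nat \<Rightarrow> real) \<Rightarrow> bool" where
  "memory_loss b \<rho> \<longleftrightarrow> (\<forall>a k f g \<psi>. (\<forall>i. a i \<in> {0..b}) \<longrightarrow> decr_cone b f \<longrightarrow> decr_cone b g \<longrightarrow>
     (LINT x|lb01. f x) = (LINT x|lb01. g x) \<longrightarrow> \<psi> \<in> borel_measurable borel \<longrightarrow> (\<forall>x. \<bar>\<psi> x\<bar> \<le> 1) \<longrightarrow>
     \<bar>(LINT x|lb01. \<psi> x * trs a k f x) - (LINT x|lb01. \<psi> x * trs a k g x)\<bar> \<le> \<rho> k)"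

lemma memory_lossI:
  assumes "\<And>a k f g. (\<And>i. a i \<in> {0..b}) \<Longrightarrow> decr_cone b f \<Longrightarrow> decr_cone b g \<Longrightarrow>
    (LINT x|lb01. f x) = (LINT x|lb01. g x) \<Longrightarrow> \<exists>f' g'. coupled a k f g f' g' \<and> 2 * (LINT x|lb01. f' x) \<le> \<rho> k"
  shows "memory_loss b \<rho>"
  unfolding memory_loss_def
proof (intro allI impI)
  fix a :: "nat \<Rightarrow> real" and k f g and \<psi> :: "real \<Rightarrow> real"
  assume *: "\<forall>i. a i \<in> {0..b}" "decr_cone b f" "decr_cone b g" "(LINT x|lb01. f x) = (LINT x|lb01. g x)" "\<psi> \<in> borel_measurable borel" "\<forall>x. \<bar>\<psi> x\<bar> \<le> 1"
  obtain f' g' where c: "coupled a k f g f' g'" "2 * (LINT x|lb01. f' x) \<le> \<rho> k" using assms * by blast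
  have "\<bar>(LINT x|lb01. \<psi> x * trs a k f x) - (LINT x|lb01. \<psi> x * trs a k g x)\<bar> \<le> 2 * (LINT x|lb01. f' x)"
    by (rule coupled_L1[OF c(1)]) (use * decr_integrable cone_decr in auto)
  with c(2) show "\<bar>(LINT x|lb01. \<psi> x * trs a k f x) - (LINT x|lb01. \<psi> x * trs a k g x)\<bar> \<le> \<rho> k" by simp
qed

lemma memory_lossD:
  assumes "memory_loss b \<rho>" "\<And>i. a i \<in> {0..b}" "decr_cone b f" "decr_cone b g"
    "(LINT x|lb01. f x) = (LINT x|lb01. g x)" "\<psi> \<in> borel_measurable borel" "\<And>x. \<bar>\<psi> x\<bar> \<le> 1"
  shows "\<bar>(LINT x|lb01. \<psi> x * trs a k f x) - (LINT x|lb01. \<psi> x * trs a k g x)\<bar> \<le> \<rho> k"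
  using assms unfolding memory_loss_def by blast

lemma coupled_mass_le:
  assumes "coupled a k f g f' g'" "decr_cone b f" shows "(LINT x|lb01. f' x) \<le> 1"
  using assms cone_mass[of b f] by (auto simp: coupled_def)

text \<open>The truncated potential is at most \<open>s powr - q\<close> times the mass. Letting s
  shrink like a power of k makes the mass hidden in [0,s] small while the potential stays small
  compared with k.\<close>

theorem memory_loss_tendsto:
  assumes b: "0 < b" "b < 1"
  obtains \<rho> where "memory_loss b \<rho>" "\<rho> \<longlonglongrightarrow> 0"
proof -
  define q where "q = (b + 1) / 2"
  have q: "b < q" "q < 1" "0 \<le> q" using b by (auto simp: q_def)
  obtain B where B: "coupling_bound b q B" using coupling[OF b(1) q(1,2)] by blast
  have B0: "0 \<le> B" using B by (simp add: coupling_bound_def)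
  \<comment> \<open>The three terms come from the mass hidden in [0,s], the two potentials and the
    constant B, each doubled by the passage to test functions. At k = 0 the value 2 covers the two
    masses.\<close>
  define \<rho> where "\<rho> k = (if k = 0 then 2 else
      8 * (K0 b * real k powr (- (1 - b) / 2)) + 4 * real k powr (q / 2 - 1) + 2 * B / real k)" for k
  have K: "0 \<le> K0 b" using b by (simp add: K0_def)
  have "memory_loss b \<rho>"
  proof (rule memory_lossI)
    fix a :: "nat \<Rightarrow> real" and k f g
    assume a: "\<And>i. a i \<in> {0..b}" and f: "decr_cone b f" and g: "decr_cone b g" and eq: "(LINT x|lb01. f x) = (LINT x|lb01. g x)"
    show "\<exists>f' g'. coupled a k f g f' g' \<and> 2 * (LINT x|lb01. f' x) \<le> \<rho> k"
    proof (cases "k = 0")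
      case True
      have "coupled a k f g (trs a k f) (trs a k g)"
        by (rule coupled_trivial) (use a f g eq cone_decr in auto)
      then show ?thesis using True coupled_mass_le[OF _ f] by (fastforce simp: \<rho>_def)
    next
      case False
      \<comment> \<open>Then \<open>s powr - q / k = k powr (q / 2 - 1)\<close>, which tends to 0
        because q < 1.\<close>
      define s where "s = real k powr (- 1/2)"
      have s: "0 < s" "s \<le> 1" using False powr_mono[of "-1/2" 0 "real k"] by (auto simp: s_def)
      obtain f' g' where c: "coupled a k f g f' g'" "(LINT x|lb01. f' x) \<le> 4 * (K0 b * s powr (1 - b)) \<or>
       real k * (LINT x|lb01. f' x) \<le> Pot q s f + Pot q s g + B * (LINT x|lb01. f x)"
        by (rule coupling_boundD[OF B s a f g eq])
      have P: "Pot q s h \<le> s powr - q" if h: "decr_cone b h" for h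
      proof -
        have "Pot q s h \<le> (LINT x|lb01. s powr - q * h x)"
          using pot_bound[OF s(1) q(3)] decr_nonneg[OF cone_decr[OF h]] decr_integrable[OF cone_decr[OF h]]
          by (intro integral_lb01_mono pot_integrable s q mult_right_mono) (auto simp: abs_le_iff)
        also have "\<dots> \<le> s powr - q * 1" using cone_mass[OF h] by (auto intro!: mult_left_mono simp del: mult_1_right)
        finally show ?thesis by simp
      qed
      have e1: "s powr (1 - b) = real k powr (- (1 - b) / 2)"
        unfolding s_def powr_powr by (rule arg_cong[where f="(powr) (real k)"]) (simp add: field_simps)
      have e2: "s powr - q / real k = real k powr (q / 2 - 1)" 
        using False by (simp add: s_def powr_powr powr_diff)
      have nn: "0 \<le> K0 b * real k powr (- (1 - b) / 2)" "0 \<le> real k powr (q / 2 - 1)" "0 \<le> B / real k"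
        using K B0 by auto
      have rho: "\<rho> k = 8 * (K0 b * real k powr (- (1 - b) / 2)) + 4 * real k powr (q / 2 - 1) + 2 * (B / real k)"
        using False by (simp add: \<rho>_def)
      from c(2) have "2 * (LINT x|lb01. f' x) \<le> \<rho> k"
      proof
        assume "real k * (LINT x|lb01. f' x) \<le> Pot q s f + Pot q s g + B * (LINT x|lb01. f x)"
        also have "\<dots> \<le> s powr - q + s powr - q + B * 1"
          using P[OF f] P[OF g] cone_mass[OF f] B0 by (intro add_mono mult_left_mono)
        finally have "(LINT x|lb01. f' x) \<le> (2 * s powr - q + B) / real k" using False by (simp add: field_simps)
        also have "\<dots> = 2 * real k powr (q / 2 - 1) + B / real k" by (simp add: e2[symmetric] add_divide_distrib)
        finally show ?thesis using nn unfolding rho by linarith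
      next
        assume "(LINT x|lb01. f' x) \<le> 4 * (K0 b * s powr (1 - b))"
        then show ?thesis using nn unfolding e1 rho by linarith
      qed
      then show ?thesis using c(1) by blast
    qed
  qed
  moreover have "\<rho> \<longlonglongrightarrow> 0"
  proof -
    have 1: "(\<lambda>k. real k powr p) \<longlonglongrightarrow> 0" if "p < 0" for p
      using that by (intro tendsto_neg_powr filterlim_real_sequentially)
    have "(\<lambda>k. 8 * (K0 b * real k powr (- (1 - b) / 2)) + 4 * real k powr (q / 2 - 1) + 2 * B / real k) \<longlonglongrightarrow> 8 * (K0 b * 0) + 4 * 0 + 0"
      using b q by (intro tendsto_intros 1 lim_const_over_n) auto
    then show ?thesis
      unfolding mult_zero_right add_0 by (rule Lim_transform_eventually) (auto simp: \<rho>_def eventually_sequentially intro!: exI[of _ 1])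
  qed
  ultimately show ?thesis using that by blast
qed

text \<open>Split at r: to the right the potential is at most \<open>r powr - (1/2)\<close>, to the
  left the cone gives \<open>K0 b * x powr - (b + 1/2)\<close>, integrable as b < 1/2. The bound is
  independent of s and becomes small with the mass when r is chosen well.\<close>

lemma Pot_cone_le:
  assumes f: "decr_cone b f" and b: "b < 1/2" and s: "0 < s" and r: "0 < r" "r \<le> 1"
  shows "Pot (1/2) s f \<le> r powr - (1/2) * (LINT x|lb01. f x) + K0 b / (1/2 - b) * r powr (1/2 - b)"
proof -
  note d = cone_decr[OF f]
  have P: "integrable lb01 (\<lambda>x. indicator {0..r} x * x powr - (b + 1/2))"
    "(LINT x|lb01. indicator {0..r} x * x powr - (b + 1/2)) = r powr (1/2 - b) / (1/2 - b)"
    using powr_lb01[of "-(b + 1/2)" r] b r by auto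
  have "Pot (1/2) s f \<le> (LINT x|lb01. r powr - (1/2) * f x + K0 b * (indicator {0..r} x * x powr - (b + 1/2)))"
  proof (intro integral_lb01_mono pot_integrable decr_integrable[OF d] s Bochner_Integration.integrable_add integrable_mult_right)
    fix x :: real assume x: "0 < x" "x \<le> 1"
    note f0 = decr_nonneg[OF d x]
    show "pot (1/2) s x * f x \<le> r powr - (1/2) * f x + K0 b * (indicator {0..r} x * x powr - (b + 1/2))"
    proof (cases "x \<le> r")
      case True
      have "pot (1/2) s x * f x \<le> x powr - (1/2) * (K0 b * x powr - b)"
        using cone_bound[OF f x] pot_le[of "1/2" x s] x f0 by (intro mult_mono) auto
      also have "\<dots> = K0 b * x powr - (b + 1/2)"
      proof -
        have e: "- (b + 1/2) = - (1/2) + - b" by simp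
        show ?thesis unfolding e powr_add by simp
      qed
      finally show ?thesis using True x f0 by (simp add: add_increasing)
    next
      case False
      have "pot (1/2) s x \<le> x powr - (1/2)" using x by (intro pot_le) auto
      also have "\<dots> \<le> r powr - (1/2)" using False r by (intro powr_mono2') auto
      finally show ?thesis using False f0 by (simp add: mult_right_mono)
    qed
  qed (use P in auto)
  also have "\<dots> = r powr - (1/2) * (LINT x|lb01. f x) + K0 b / (1/2 - b) * r powr (1/2 - b)"
    using P decr_integrable[OF d] by simp
  finally show ?thesis .
qed

lemma powr_small_le:
  assumes "0 < (p::real)" "0 < e" "0 \<le> c"
  obtains s where "0 < s" "s \<le> 1" "c * s powr p \<le> e"
proof -
  define s where "s = min 1 ((e / (c + 1)) powr (1 / p))"
  have s: "0 < s" "s \<le> 1" using assms by (auto simp: s_def)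
  have "s powr p \<le> ((e / (c + 1)) powr (1 / p)) powr p"
    using s assms by (intro powr_mono2) (auto simp: s_def)
  also have "\<dots> = e / (c + 1)" using assms by (simp add: powr_powr)
  finally have "c * s powr p \<le> c * (e / (c + 1))" using assms by (intro mult_left_mono)
  also have "\<dots> \<le> e" using assms by (simp add: field_simps)
  finally show ?thesis using that s by blast
qed

text \<open>The rate follows by applying the coupling twice: the mass that is still uncoupled after \<open>k\<close> steps
  is at most of order \<open>1 / k\<close>, hence has a small potential when it enters the next \<open>k\<close> steps.\<close>

theorem memory_loss_summable:
  assumes b: "0 < b" "b < 1/2"
  obtains C \<delta> where "0 \<le> C" "0 < \<delta>" "\<delta> < 1" "memory_loss b (\<lambda>k. C * (1 + real k) powr - (1 + \<delta>))"
proof -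
  \<comment> \<open>The exponent that appears when \<open>x powr - (b + 1/2)\<close> is integrated
    up to r.\<close>
  define \<delta> where "\<delta> = 1/2 - b"
  have \<delta>: "0 < \<delta>" "\<delta> < 1/2" using b by (auto simp: \<delta>_def)
  have b1: "b < 1" using b by simp
  obtain B where B: "coupling_bound b (1/2) B" using coupling[OF b(1,2)] by auto
  have B0: "0 \<le> B" using B by (simp add: coupling_bound_def)
  have K: "0 \<le> K0 b" using b by (simp add: K0_def)
  define L where "L = K0 b / \<delta>"
  have L: "0 \<le> L" using K \<delta> by (simp add: L_def)
  \<comment> \<open>Here s only serves to push the first alternative of the coupling below e; the
    bound on the potential does not see it, so e may be arbitrarily small.\<close>
  have step: "\<exists>f' g'. coupled a k f g f' g' \<and> (LINT x|lb01. f' x) \<le> 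
       max e ((2 * (r powr - (1/2) * (LINT x|lb01. f x) + L * r powr \<delta>) + B * (LINT x|lb01. f x)) / k)"
    if k: "k \<ge> 1" and a: "\<And>i. a i \<in> {0..b}" and f: "decr_cone b f" and g: "decr_cone b g" and eq: "(LINT x|lb01. f x) = (LINT x|lb01. g x)"
     and r: "0 < r" "r \<le> 1" and e: "0 < e" for k a f g r e
  proof -
    obtain s where s: "0 < s" "s \<le> 1" "4 * K0 b * s powr (1 - b) \<le> e"
      using powr_small_le[of "1 - b" e "4 * K0 b"] b K e by auto
    obtain f' g' where c: "coupled a k f g f' g'" "(LINT x|lb01. f' x) \<le> 4 * (K0 b * s powr (1 - b)) \<or>
       real k * (LINT x|lb01. f' x) \<le> Pot (1/2) s f + Pot (1/2) s g + B * (LINT x|lb01. f x)"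
      by (rule coupling_boundD[OF B s(1,2) a f g eq])
    have "Pot (1/2) s f + Pot (1/2) s g \<le> 2 * (r powr - (1/2) * (LINT x|lb01. f x) + L * r powr \<delta>)"
      using add_mono[OF Pot_cone_le[OF f b(2) s(1) r] Pot_cone_le[OF g b(2) s(1) r]]
      unfolding L_def \<delta>_def eq mult_2 .
    then have "(LINT x|lb01. f' x) \<le> e \<or> real k * (LINT x|lb01. f' x) \<le> 2 * (r powr - (1/2) * (LINT x|lb01. f x) + L * r powr \<delta>) + B * (LINT x|lb01. f x)"
      using c(2) s(3) by linarith
    then have "(LINT x|lb01. f' x) \<le> 
       max e ((2 * (r powr - (1/2) * (LINT x|lb01. f x) + L * r powr \<delta>) + B * (LINT x|lb01. f x)) / k)"
      using k by (auto simp: field_simps le_max_iff_disj)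
    then show ?thesis using c(1) by blast
  qed
  define C1 where "C1 = 1 + 2 * (1 + L) + B"
  define C2 where "C2 = 1 + 2 * (C1 + L) + B * C1"
  have C: "1 \<le> C1" "1 \<le> C2" using L B0 by (auto simp: C1_def C2_def)
  \<comment> \<open>The first k steps, with r = 1, leave mass at most C1 / k. In the next k steps r
    = 1 / k makes the potential of order \<open>k powr - (1/2) + k powr - \<delta>\<close>; the
    second term dominates since \<delta> < 1/2, and division by k gives the exponent.\<close>
  have step2: "\<exists>f' g'. coupled a (k + k) f g f' g' \<and> (LINT x|lb01. f' x) \<le> C2 * real k powr - (1 + \<delta>)"
    if k: "k \<ge> 1" and a: "\<And>i. a i \<in> {0..b}" and f: "decr_cone b f" and g: "decr_cone b g" and eq: "(LINT x|lb01. f x) = (LINT x|lb01. g x)"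
    for k a f g
  proof -
    obtain f1 g1 where c1: "coupled a k f g f1 g1" and m1: "(LINT x|lb01. f1 x) \<le> 
       max (1/k) ((2 * (1 powr - (1/2) * (LINT x|lb01. f x) + L * 1 powr \<delta>) + B * (LINT x|lb01. f x)) / k)"
      using step[where a=a, OF k a f g eq, of 1 "1/k"] k by auto
    have a0: "\<And>i. 0 \<le> a i" using a by auto
    note cc = coupled_cone[where a=a, OF c1 a b1 f g]
    have "2 * ((LINT x|lb01. f x) + L) + B * (LINT x|lb01. f x) \<le> C1"
      using cone_mass[OF f] B0 mult_left_mono[of "LINT x|lb01. f x" 1 B] by (simp add: C1_def)
    then have m1: "(LINT x|lb01. f1 x) \<le> C1 / k"
      using m1 C(1) k by (auto simp: max_def divide_right_mono split: if_splits elim: order_trans)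
    have eq1: "(LINT x|lb01. f1 x) = (LINT x|lb01. g1 x)" using c1 by (simp add: coupled_def)
    obtain f2 g2 where c2: "coupled (\<lambda>i. a (k + i)) k f1 g1 f2 g2" and m2: "(LINT x|lb01. f2 x) \<le> 
       max (k powr - 2) ((2 * ((1/k) powr - (1/2) * (LINT x|lb01. f1 x) + L * (1/k) powr \<delta>) + B * (LINT x|lb01. f1 x)) / k)"
      using step[where a="\<lambda>i. a (k + i)", OF k a cc eq1, of "1/k" "k powr - 2"] k by auto
    have k1: "1 \<le> real k" "0 < real k" using k by auto
    have "2 * ((1/k) powr - (1/2) * (LINT x|lb01. f1 x) + L * (1/k) powr \<delta>) + B * (LINT x|lb01. f1 x)
       \<le> 2 * ((1/k) powr - (1/2) * (C1 / k) + L * (1/k) powr \<delta>) + B * (C1 / k)"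
      using m1 B0 L by (intro add_mono mult_left_mono) auto
    also have "\<dots> = 2 * (C1 * k powr (- 1/2) + L * k powr - \<delta>) + B * (C1 * k powr - 1)"
    proof -
      have e: "(1/k) powr p = k powr - p" for p using k1 by (simp add: powr_minus_divide powr_divide)
      have "(1/k) powr - (1/2) * (C1 / k) = C1 * (k powr (1/2) * (1 / k))" by (simp add: e)
      also have "k powr (1/2) * (1 / k) = k powr (1/2) * k powr - 1"
        using k1 by (simp add: powr_minus_divide)
      also have "\<dots> = k powr (- 1/2)" unfolding powr_add[symmetric] by simp
      finally have e1: "(1/k) powr - (1/2) * (C1 / k) = C1 * k powr (- 1/2)" .
      have e2: "C1 / k = C1 * k powr - 1" using k1 by (simp add: powr_minus_divide)
      show ?thesis unfolding e1 unfolding e unfolding e2 ..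
    qed
    also have "\<dots> \<le> 2 * (C1 * k powr - \<delta> + L * k powr - \<delta>) + B * (C1 * k powr - \<delta>)"
      using C L B0 k1 \<delta> by (intro add_mono mult_left_mono powr_mono mult_nonneg_nonneg) auto
    also have "\<dots> \<le> C2 * k powr - \<delta>"
      by (simp add: C2_def algebra_simps)
    finally have "(2 * ((1/k) powr - (1/2) * (LINT x|lb01. f1 x) + L * (1/k) powr \<delta>) + B * (LINT x|lb01. f1 x)) / k \<le> C2 * k powr - \<delta> / k"
      by (rule divide_right_mono) auto
    also have "\<dots> = C2 * k powr - (1 + \<delta>)"
      
    proof -
      have "- (1 + \<delta>) = - \<delta> + - 1" by simp
      then have "k powr - (1 + \<delta>) = k powr (- \<delta> + - 1)" by (rule arg_cong)
      also have "\<dots> = k powr - \<delta> * k powr - 1" by (rule powr_add)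
      also have "k powr - 1 = 1 / k" using k1 by (simp add: powr_minus_divide)
      finally show ?thesis by simp
    qed
    finally have A: "(2 * ((1/k) powr - (1/2) * (LINT x|lb01. f1 x) + L * (1/k) powr \<delta>) + B * (LINT x|lb01. f1 x)) / k \<le> C2 * k powr - (1 + \<delta>)" .
    have "1 * k powr - 2 \<le> C2 * k powr - (1 + \<delta>)"
      using C k1 \<delta> by (intro mult_mono powr_mono) auto
    with A m2 have "(LINT x|lb01. f2 x) \<le> C2 * k powr - (1 + \<delta>)" by linarith
    then show ?thesis using coupled_trans[where a=a, OF a0 c1 c2] by blast
  qed
  \<comment> \<open>The factor 2 comes from the passage to test functions. The 4 covers n < 2, where
    the mass is at most 1 and the power is at least 1/4; 36 bounds
    \<open>6 powr (1 + \<delta>)\<close>, from 1 + n \<le> 6 * k with k the half of n.\<close>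
  define C where "C = 2 * max 4 (36 * C2)"
  have "memory_loss b (\<lambda>k. C * (1 + real k) powr - (1 + \<delta>))"
  proof (rule memory_lossI)
    fix a :: "nat \<Rightarrow> real" and n f g
    assume a: "\<And>i. a i \<in> {0..b}" and f: "decr_cone b f" and g: "decr_cone b g" and eq: "(LINT x|lb01. f x) = (LINT x|lb01. g x)"
    have a0: "\<And>i. 0 \<le> a i" using a by auto
    show "\<exists>f' g'. coupled a n f g f' g' \<and> 2 * (LINT x|lb01. f' x) \<le> C * (1 + real n) powr - (1 + \<delta>)"
    proof (cases "n < 2")
      case True
      have c: "coupled a n f g (trs a n f) (trs a n g)"
        by (rule coupled_trivial) (use a f g eq cone_decr in auto)
      have "1 / 4 \<le> 2 powr - (1 + \<delta>)"
        using powr_mono[of "-2" "-(1+\<delta>)" "2::real"] \<delta> by (simp add: powr_minus)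
      also have "\<dots> \<le> (1 + real n) powr - (1 + \<delta>)" using True \<delta> by (intro powr_mono2') auto
      finally have "2 * 4 * (1/4) \<le> C * (1 + real n) powr - (1 + \<delta>)" unfolding C_def by (intro mult_mono) auto
      then show ?thesis using c coupled_mass_le[OF c f] by fastforce
    next
      case False
      define k where "k = n div 2"
      have k: "k \<ge> 1" "k + k + n mod 2 = n" "1 + n \<le> 6 * k" using False unfolding k_def by presburger+
      obtain f1 g1 where c1: "coupled a (k + k) f g f1 g1" and m1: "(LINT x|lb01. f1 x) \<le> C2 * real k powr - (1 + \<delta>)"
        using step2[where a=a, OF k(1) a f g eq] by auto
      let ?a = "\<lambda>i. a (k + k + i)"
      have "coupled ?a (n mod 2) f1 g1 (trs ?a (n mod 2) f1) (trs ?a (n mod 2) g1)"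
        by (rule coupled_trivial) (use c1 a0 in \<open>auto simp: coupled_def\<close>)
      from coupled_trans[where a=a, OF a0 c1 this]
      have c: "coupled a n f g (trs ?a (n mod 2) f1) (trs ?a (n mod 2) g1)" unfolding k(2) .
      have m2: "(LINT x|lb01. trs ?a (n mod 2) f1 x) = (LINT x|lb01. f1 x)"
        by (rule trs_integrable(2)) (use a0 c1 in \<open>auto simp: coupled_def decr_integrable\<close>)
      have "real k powr - (1 + \<delta>) \<le> ((1 + real n) / 6) powr - (1 + \<delta>)"
        using k \<delta> by (intro powr_mono2') auto
      also have "\<dots> = (1 + real n) powr - (1 + \<delta>) * 6 powr (1 + \<delta>)"
        by (subst powr_divide, subst powr_minus_divide[of 6]) simp
      also have "\<dots> \<le> (1 + real n) powr - (1 + \<delta>) * 36"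
        using powr_mono[of "1+\<delta>" 2 "6::real"] \<delta> by (intro mult_left_mono) auto
      finally have "C2 * real k powr - (1 + \<delta>) \<le> C2 * ((1 + real n) powr - (1 + \<delta>) * 36)"
        using C by (intro mult_left_mono) auto
      also have "\<dots> = 36 * C2 * (1 + real n) powr - (1 + \<delta>)" by simp
      also have "\<dots> \<le> max 4 (36 * C2) * (1 + real n) powr - (1 + \<delta>)" by (intro mult_right_mono) auto
      finally have "2 * (LINT x|lb01. trs ?a (n mod 2) f1 x) \<le> C * (1 + real n) powr - (1 + \<delta>)"
        using m1 m2 by (simp add: C_def)
      then show ?thesis using c by blast
    qed
  qed
  then show ?thesis using that[of C \<delta>] \<delta> C by (auto simp: C_def max_def)
qed

section \<open>Correlations\<close>

primrec orb :: "(nat \<Rightarrow> real) \<Rightarrow> nat \<Rightarrow> real \<Rightarrow> real" where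
  "orb a 0 x = x"
| "orb a (Suc k) x = PM_map (a k) (orb a k x)"

lemma orb_add: "orb a (j + k) x = orb (\<lambda>i. a (j + i)) k (orb a j x)"
  by (induction k) simp_all

lemma orb_measurable [measurable]: "orb a k \<in> borel_measurable borel"
proof (induction k)
  case (Suc k)
  have "(\<lambda>x. PM_map (a k) (orb a k x)) \<in> borel_measurable borel"
    using measurable_compose[OF Suc PM_map_measurable] .
  then show ?case by simp
qed (simp add: measurable_ident_sets)

lemma orb_in: "(\<And>i. 0 \<le> a i) \<Longrightarrow> x \<in> {0..1} \<Longrightarrow> orb a k x \<in> {0..1}"
  by (induction k) (auto intro!: PM_map_in simp del: atLeastAtMost_iff)

lemma orb_dual:
  fixes f \<psi> :: "real \<Rightarrow> real"
  assumes a: "\<And>i. 0 \<le> a i" and f: "integrable lb01 f"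
  shows "\<psi> \<in> borel_measurable borel \<Longrightarrow> (\<And>x. \<bar>\<psi> x\<bar> \<le> C) \<Longrightarrow>
    (LINT x|lb01. \<psi> x * trs a k f x) = (LINT x|lb01. \<psi> (orb a k x) * f x)"
proof (induction k arbitrary: \<psi>)
  case (Suc k)
  have "(LINT x|lb01. \<psi> x * trs a (Suc k) f x) = (LINT x|lb01. \<psi> (PM_map (a k) x) * trs a k f x)"
    using integral_tr[OF a trs_integrable(1)[where a=a and k=k, OF a f] Suc.prems] by simp
  also have "\<dots> = (LINT x|lb01. \<psi> (PM_map (a k) (orb a k x)) * f x)"
    using Suc.prems by (intro Suc.IH) auto
  finally show ?case by simp
qed simp

lemma trs_cmult: "trs a k (\<lambda>x. c * f x) = (\<lambda>x. c * trs a k f x)"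
  by (induction k) (simp_all add: tr_def fun_eq_iff algebra_simps)

text \<open>The bounds hold on the whole line, so compositions with orbits are bounded everywhere;
  monotonicity is asked on [0,1] only, where multiplication by w must preserve the cone.\<close>

definition test_fun :: "(real \<Rightarrow> real) \<Rightarrow> bool" where
  "test_fun w \<longleftrightarrow> w \<in> borel_measurable borel \<and> (\<forall>x. 0 \<le> w x \<and> w x \<le> 1) \<and>
     (\<forall>x y. 0 \<le> x \<longrightarrow> x \<le> y \<longrightarrow> y \<le> 1 \<longrightarrow> w y \<le> w x)"

text \<open>The law of the orbit at time \<open>j\<close>, weighted by an observable \<open>Z\<close> of the first \<open>j\<close> steps,
  has a density which is \<open>K\<close> times the difference of two functions in the cone.\<close>

definition past :: "real \<Rightarrow> (nat \<Rightarrow> real) \<Rightarrow> nat \<Rightarrow> real \<Rightarrow> (real \<Rightarrow> real) \<Rightarrow> bool" where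
  "past b a j K Z \<longleftrightarrow> (\<exists>\<xi>1 \<xi>2. decr_cone b \<xi>1 \<and> decr_cone b \<xi>2 \<and>
     (\<forall>\<Theta> C. \<Theta> \<in> borel_measurable borel \<longrightarrow> (\<forall>x. \<bar>\<Theta> x\<bar> \<le> C) \<longrightarrow>
       (LINT x|lb01. Z x * \<Theta> (orb a j x)) = K * ((LINT x|lb01. \<Theta> x * \<xi>1 x) - (LINT x|lb01. \<Theta> x * \<xi>2 x))))"

lemma past_0: "0 \<le> b \<Longrightarrow> b < 1 \<Longrightarrow> past b a 0 1 (\<lambda>_. 1)"
  unfolding past_def by (intro exI[of _ "\<lambda>_. 1"] exI[of _ "\<lambda>_. 0"]) (auto intro: cone_const)

lemma past_Suc:
  assumes a: "\<And>i. a i \<in> {0..b}" and b: "b < 1" and p: "past b a j K Z"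
  shows "past b a (Suc j) K Z"
proof -
  obtain \<xi>1 \<xi>2 where x: "decr_cone b \<xi>1" "decr_cone b \<xi>2" and eq: "\<And>\<Theta> C. \<Theta> \<in> borel_measurable borel \<Longrightarrow> (\<forall>x. \<bar>\<Theta> x\<bar> \<le> C) \<Longrightarrow>
       (LINT x|lb01. Z x * \<Theta> (orb a j x)) = K * ((LINT x|lb01. \<Theta> x * \<xi>1 x) - (LINT x|lb01. \<Theta> x * \<xi>2 x))"
    using p unfolding past_def by blast
  have a': "0 \<le> a j" "a j \<le> b" using a[of j] by auto
  show ?thesis unfolding past_def
  proof (intro exI conjI allI impI)
    show "decr_cone b (tr (a j) \<xi>1)" "decr_cone b (tr (a j) \<xi>2)" using cone_tr a' b x by auto
    fix \<Theta> :: "real \<Rightarrow> real" and C assume T: "\<Theta> \<in> borel_measurable borel" "\<forall>x. \<bar>\<Theta> x\<bar> \<le> C"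
    have "(LINT x|lb01. \<Theta> x * tr (a j) \<xi> x) = (LINT x|lb01. \<Theta> (PM_map (a j) x) * \<xi> x)" if "decr_cone b \<xi>" for \<xi>
      using T(2) by (intro integral_tr a' decr_integrable cone_decr[OF that] T(1)) auto
    then show "(LINT x|lb01. Z x * \<Theta> (orb a (Suc j) x)) = K * ((LINT x|lb01. \<Theta> x * tr (a j) \<xi>1 x) - (LINT x|lb01. \<Theta> x * tr (a j) \<xi>2 x))"
      using eq[of "\<lambda>x. \<Theta> (PM_map (a j) x)" C] T x by simp
  qed
qed

lemma past_le:
  assumes a: "\<And>i. a i \<in> {0..b}" and b: "b < 1" and p: "past b a j K Z" and "j \<le> k"
  shows "past b a k K Z"
  using \<open>j \<le> k\<close> by (induction rule: dec_induct) (auto intro: p past_Suc[OF a b])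

text \<open>Although w - c may change sign, \<open>(w - c) * (\<xi>1 - \<xi>2) = (w * \<xi>1 + c *
  \<xi>2) - (w * \<xi>2 + c * \<xi>1)\<close>. Halving brings both brackets into the cone by
  convexity, which doubles K.\<close>

lemma past_mult:
  assumes b: "b < 1" and p: "past b a j K Z" and w: "test_fun w" and c: "0 \<le> c" "c \<le> 1"
  shows "past b a j (2 * K) (\<lambda>x. Z x * (w (orb a j x) - c))"
proof -
  obtain \<xi>1 \<xi>2 where x: "decr_cone b \<xi>1" "decr_cone b \<xi>2" and eq: "\<And>\<Theta> C. \<Theta> \<in> borel_measurable borel \<Longrightarrow> (\<forall>x. \<bar>\<Theta> x\<bar> \<le> C) \<Longrightarrow>
       (LINT x|lb01. Z x * \<Theta> (orb a j x)) = K * ((LINT x|lb01. \<Theta> x * \<xi>1 x) - (LINT x|lb01. \<Theta> x * \<xi>2 x))"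
    using p unfolding past_def by blast
  have w': "w \<in> borel_measurable borel" "\<And>x. 0 \<le> w x \<and> w x \<le> 1" "\<And>x y. 0 \<le> x \<Longrightarrow> x \<le> y \<Longrightarrow> y \<le> 1 \<Longrightarrow> w y \<le> w x"
    using w by (auto simp: test_fun_def)
  let ?h = "\<lambda>u v x. 1/2 * (w x * u x) + c/2 * v x"
  have h: "decr_cone b (?h u v)" if "decr_cone b u" "decr_cone b v" for u v
    using c that by (intro cone_convex cone_mult w' b) auto
  show ?thesis unfolding past_def
  proof (intro exI conjI allI impI)
    show "decr_cone b (?h \<xi>1 \<xi>2)" "decr_cone b (?h \<xi>2 \<xi>1)" using h x by auto
    fix \<Theta> :: "real \<Rightarrow> real" and C assume T: "\<Theta> \<in> borel_measurable borel" "\<forall>x. \<bar>\<Theta> x\<bar> \<le> C"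
    let ?T = "\<lambda>x. \<Theta> x * (w x - c)"
    have C: "0 \<le> C" using T(2) abs_ge_zero order_trans by blast
    have "\<bar>w x - c\<bar> \<le> 1" for x using w'(2)[of x] c by auto
    then have bd: "\<bar>?T x\<bar> \<le> C" for x using T(2) C mult_mono[of "\<bar>\<Theta> x\<bar>" C "\<bar>w x - c\<bar>" 1] by (simp add: abs_mult)
    have I: "integrable lb01 (\<lambda>x. \<Theta> x * f x)" if "integrable lb01 f" for f
      using T by (intro integrable_bounded_mult[OF that, of _ C] borel_imp_lb01) auto
    have J: "integrable lb01 (\<lambda>x. ?T x * f x)" if "integrable lb01 f" for f
      using T bd w'(1) by (intro integrable_bounded_mult[OF that, of _ C] borel_imp_lb01) auto
    note i = decr_integrable[OF cone_decr]
    have "(LINT x|lb01. Z x * (w (orb a j x) - c) * \<Theta> (orb a j x)) = (LINT x|lb01. Z x * ?T (orb a j x))"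
      by (simp add: mult_ac)
    also have "\<dots> = K * ((LINT x|lb01. ?T x * \<xi>1 x) - (LINT x|lb01. ?T x * \<xi>2 x))"
      using T(1) w'(1) bd by (intro eq[of ?T C]) auto
    also have "(LINT x|lb01. ?T x * \<xi>1 x) - (LINT x|lb01. ?T x * \<xi>2 x) = (LINT x|lb01. ?T x * \<xi>1 x - ?T x * \<xi>2 x)"
      by (rule Bochner_Integration.integral_diff[OF J[OF i[OF x(1)]] J[OF i[OF x(2)]], symmetric])
    also have "\<dots> = (LINT x|lb01. 2 * (\<Theta> x * ?h \<xi>1 \<xi>2 x - \<Theta> x * ?h \<xi>2 \<xi>1 x))"
      by (intro Bochner_Integration.integral_cong refl) (simp add: field_simps)
    also have "\<dots> = 2 * (LINT x|lb01. \<Theta> x * ?h \<xi>1 \<xi>2 x - \<Theta> x * ?h \<xi>2 \<xi>1 x)"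
      by (rule integral_mult_right_zero)
    also have "\<dots> = 2 * ((LINT x|lb01. \<Theta> x * ?h \<xi>1 \<xi>2 x) - (LINT x|lb01. \<Theta> x * ?h \<xi>2 \<xi>1 x))"
      by (subst Bochner_Integration.integral_diff[OF I[OF i[OF h[OF x]]] I[OF i[OF h[OF x(2,1)]]]]) simp
    finally show "(LINT x|lb01. Z x * (w (orb a j x) - c) * \<Theta> (orb a j x)) = 2 * K * ((LINT x|lb01. \<Theta> x * ?h \<xi>1 \<xi>2 x) - (LINT x|lb01. \<Theta> x * ?h \<xi>2 \<xi>1 x))"
      by simp
  qed
qed

text \<open>Each of the two cone functions that represent the past at time j is compared with its
  own mass times the true density at time j. Memory is lost over the remaining k - j steps, and the
  two comparisons give the factor 2.\<close>

proposition past_mixing: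
  assumes ml: "memory_loss b \<rho>" and a: "\<And>i. a i \<in> {0..b}" and b: "0 < b" "b < 1" and p: "past b a j K Z" and K: "0 \<le> K"
    and P: "\<Psi> \<in> borel_measurable borel" "\<And>x. \<bar>\<Psi> x\<bar> \<le> 1" and jk: "j \<le> k"
  shows "\<bar>(LINT x|lb01. Z x * \<Psi> (orb a k x)) - (LINT x|lb01. Z x) * (LINT x|lb01. \<Psi> (orb a k x))\<bar> \<le> 2 * K * \<rho> (k - j)"
proof -
  obtain \<xi>1 \<xi>2 where x: "decr_cone b \<xi>1" "decr_cone b \<xi>2" and eq: "\<And>\<Theta> C. \<Theta> \<in> borel_measurable borel \<Longrightarrow> (\<forall>x. \<bar>\<Theta> x\<bar> \<le> C) \<Longrightarrow>
       (LINT x|lb01. Z x * \<Theta> (orb a j x)) = K * ((LINT x|lb01. \<Theta> x * \<xi>1 x) - (LINT x|lb01. \<Theta> x * \<xi>2 x))"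
    using p unfolding past_def by blast
  let ?a = "\<lambda>i. a (j + i)" and ?r = "k - j"
  let ?S = "\<lambda>f. LINT x|lb01. \<Psi> x * trs ?a ?r f x"
  let ?m = "\<lambda>f. LINT x|lb01. f x :: real"
  \<comment> \<open>The density of the orbit at time j when it starts from Lebesgue measure.\<close>
  define h where "h = trs a j (\<lambda>_. 1)"
  have a0: "\<And>i. 0 \<le> a i" using a by auto
  have h: "decr_cone b h" unfolding h_def by (intro cone_trs a b cone_const) (use b in auto)
  have hm: "?m h = 1" unfolding h_def using trs_integrable(2)[where a=a, OF a0] lb01.prob_space by simp
  note i = decr_integrable[OF cone_decr]
  have dual: "(LINT x|lb01. \<Psi> (orb ?a ?r x) * f x) = ?S f" if "integrable lb01 f" for f
    using orb_dual[of ?a f \<Psi> 1 ?r] a0 that P by simp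
  have orb: "orb a k x = orb ?a ?r (orb a j x)" for x using orb_add[of a j ?r x] jk by simp
  have 1: "(LINT x|lb01. Z x * \<Psi> (orb a k x)) = K * (?S \<xi>1 - ?S \<xi>2)"
    unfolding orb using eq[of "\<lambda>x. \<Psi> (orb ?a ?r x)" 1] P dual i x by simp
  have 2: "(LINT x|lb01. Z x) = K * (?m \<xi>1 - ?m \<xi>2)"
    using eq[of "\<lambda>x. 1" 1] by simp
  have 3: "(LINT x|lb01. \<Psi> (orb a k x)) = ?S h"
    unfolding orb dual[OF i[OF h], symmetric]
    using orb_dual[of a "\<lambda>_. 1" "\<lambda>x. \<Psi> (orb ?a ?r x)" 1 j] a0 P by (simp add: h_def)
  have 4: "\<bar>?S \<xi> - ?m \<xi> * ?S h\<bar> \<le> \<rho> ?r" if xi: "decr_cone b \<xi>" for \<xi>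
  proof -
    have m: "0 \<le> ?m \<xi>" "?m \<xi> \<le> 1" using cone_mass[OF xi] decr_nonneg[OF cone_decr[OF xi]] by (auto intro: integral_lb01_nonneg)
    have "?m \<xi> * ?S h = (LINT x|lb01. ?m \<xi> * (\<Psi> x * trs ?a ?r h x))" by simp
    also have "\<dots> = ?S (\<lambda>x. ?m \<xi> * h x)" unfolding trs_cmult by (simp add: mult_ac)
    finally have e: "?m \<xi> * ?S h = ?S (\<lambda>x. ?m \<xi> * h x)" .
    show ?thesis unfolding e
      by (rule memory_lossD[OF ml]) (use a cone_cmult[OF h m] xi hm P in auto)
  qed
  have "\<bar>(LINT x|lb01. Z x * \<Psi> (orb a k x)) - (LINT x|lb01. Z x) * (LINT x|lb01. \<Psi> (orb a k x))\<bar>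
     = K * \<bar>(?S \<xi>1 - ?m \<xi>1 * ?S h) - (?S \<xi>2 - ?m \<xi>2 * ?S h)\<bar>"
    unfolding 1 2 3 using K by (simp add: abs_mult[symmetric, of K] abs_mult_pos' algebra_simps)
  also have "\<dots> \<le> K * (\<rho> ?r + \<rho> ?r)"
    using add_mono[OF 4[OF x(1)] 4[OF x(2)]] K by (intro mult_left_mono order_trans[OF abs_triangle_ineq4])
  finally show ?thesis by simp
qed

lemma bounded_integrable: "f \<in> borel_measurable borel \<Longrightarrow> (\<And>x. \<bar>f x\<bar> \<le> C) \<Longrightarrow> integrable lb01 f" for f :: "real \<Rightarrow> real"
proof -
  assume f: "f \<in> borel_measurable borel" "\<And>x. \<bar>f x\<bar> \<le> C"
  have "integrable lb01 (\<lambda>x. f x * 1)"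
    by (rule integrable_bounded_mult[OF _ borel_imp_lb01[OF f(1)] f(2)]) simp
  then show ?thesis by simp
qed

locale observed_orbit =
  fixes b :: real and \<rho> :: "nat \<Rightarrow> real" and a :: "nat \<Rightarrow> real" and w :: "real \<Rightarrow> real"
  assumes ml: "memory_loss b \<rho>" and a: "\<And>i. a i \<in> {0..b}" and b: "0 < b" "b < 1" and w: "test_fun w"
begin

definition cen :: "nat \<Rightarrow> real" where "cen i = (LINT x|lb01. w (orb a i x))"

definition dev :: "nat \<Rightarrow> real \<Rightarrow> real" where "dev i x = w (orb a i x) - cen i"

lemma w_measurable [measurable]: "w \<in> borel_measurable borel" and w_bounds: "0 \<le> w x" "w x \<le> 1"
  using w by (auto simp: test_fun_def)

lemma cen_bounds: "0 \<le> cen i" "cen i \<le> 1"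
proof -
  show "0 \<le> cen i" unfolding cen_def by (intro integral_lb01_nonneg w_bounds)
  have "integrable lb01 (\<lambda>x. w (orb a i x))"
    by (rule bounded_integrable[of _ 1]) (auto simp: w_bounds)
  then have "cen i \<le> (LINT x|lb01. 1)"
    unfolding cen_def by (intro integral_lb01_mono) (auto simp: w_bounds)
  then show "cen i \<le> 1" using lb01.prob_space by simp
qed

lemma dev_measurable [measurable]: "dev i \<in> borel_measurable borel"
  unfolding dev_def by measurable

lemma w_cen_bound: "\<bar>w x - cen i\<bar> \<le> 1"
  using w_bounds[of x] cen_bounds[of i] by (auto simp: abs_le_iff)

lemma dev_bound: "\<bar>dev i x\<bar> \<le> 1"
  unfolding dev_def by (rule w_cen_bound)

lemma dev_integral: "(LINT x|lb01. w (orb a i x) - cen i) = 0" "(LINT x|lb01. dev i x) = 0"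
proof -
  have "integrable lb01 (\<lambda>x. w (orb a i x))" by (rule bounded_integrable[of _ 1]) (auto simp: w_bounds)
  then show "(LINT x|lb01. w (orb a i x) - cen i) = 0" using lb01.prob_space by (simp add: cen_def)
  then show "(LINT x|lb01. dev i x) = 0" by (simp add: dev_def)
qed

lemma past_dev: "past b a j K Z \<Longrightarrow> j \<le> k \<Longrightarrow> past b a k (2 * K) (\<lambda>x. Z x * dev k x)"
  unfolding dev_def using past_mult[OF b(2) past_le[where a=a, OF a b(2)] w cen_bounds] by blast

lemma past_dev1: "past b a i 2 (dev i)"
  using past_dev[OF past_0, of i] b by simp

lemma correlation2:
  assumes "i \<le> j" shows "\<bar>LINT x|lb01. dev i x * dev j x\<bar> \<le> 4 * \<rho> (j - i)"
  using past_mixing[where a=a and \<Psi>="\<lambda>y. w y - cen j", OF ml a b past_dev1 _ _ w_cen_bound assms] dev_integral(1)[of j]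
  by (simp add: dev_def)

text \<open>The product is cut at one of the three gaps between the times. With one, two or three
  factors in the past the constant of \<open>past\<close> is 2, 4 or 8, and mixing doubles it.
  Centring kills the product of the means when a single factor stands alone.\<close>

lemma correlation4:
  assumes "i \<le> j" "j \<le> k" "k \<le> l"
  defines "E \<equiv> (LINT x|lb01. dev i x * dev j x * dev k x * dev l x)"
  shows "\<bar>E\<bar> \<le> 16 * \<rho> (l - k)" "\<bar>E\<bar> \<le> 4 * \<rho> (j - i)"
    "\<bar>E - (LINT x|lb01. dev i x * dev j x) * (LINT x|lb01. dev k x * dev l x)\<bar> \<le> 8 * \<rho> (k - j)"
proof -
  have p2: "past b a j 4 (\<lambda>x. dev i x * dev j x)"
    using past_dev[OF past_dev1 assms(1)] by simp
  have p3: "past b a k 8 (\<lambda>x. dev i x * dev j x * dev k x)"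
    using past_dev[OF p2 assms(2)] by simp
  show "\<bar>E\<bar> \<le> 16 * \<rho> (l - k)"
    using past_mixing[where a=a and \<Psi>="\<lambda>y. w y - cen l", OF ml a b p3 _ _ w_cen_bound assms(3)] dev_integral(1)[of l]
    by (simp add: dev_def E_def)
  \<comment> \<open>The deviation at time k as a function of the state at time j, since
    \<open>past_mixing\<close> wants the future as a function of the state at the cut.\<close>
  define sh where "sh j k x = w (orb (\<lambda>i. a (j + i)) (k - j) x) - cen k" for j k x
  have sh: "sh j k (orb a j x) = dev k x" if "j \<le> k" for j k x
    using orb_add[of a j "k - j" x] that by (simp add: sh_def dev_def)
  have shm [measurable]: "sh j k \<in> borel_measurable borel" for j k unfolding sh_def by measurable
  have shb: "\<bar>sh j k x\<bar> \<le> 1" for j k x unfolding sh_def by (rule w_cen_bound)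
  have m: "\<bar>x * y\<bar> \<le> 1" if "\<bar>x\<bar> \<le> 1" "\<bar>y\<bar> \<le> 1" for x y :: real
    using that by (simp add: abs_mult mult_le_one)
  have "\<bar>(LINT x|lb01. dev i x * (sh j j (orb a j x) * (sh j k (orb a j x) * sh j l (orb a j x)))) -
     (LINT x|lb01. dev i x) * (LINT x|lb01. sh j j (orb a j x) * (sh j k (orb a j x) * sh j l (orb a j x)))\<bar> \<le> 2 * 2 * \<rho> (j - i)"
    by (intro past_mixing[where a=a, OF ml a b past_dev1 _ _ _ assms(1)] m shb) auto
  then show "\<bar>E\<bar> \<le> 4 * \<rho> (j - i)" using sh assms by (simp add: dev_integral E_def mult_ac)
  have "\<bar>(LINT x|lb01. dev i x * dev j x * (sh k k (orb a k x) * sh k l (orb a k x))) -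
     (LINT x|lb01. dev i x * dev j x) * (LINT x|lb01. sh k k (orb a k x) * sh k l (orb a k x))\<bar> \<le> 2 * 4 * \<rho> (k - j)"
    by (intro past_mixing[where a=a, OF ml a b p2 _ _ _ assms(2)] m shb) auto
  then show "\<bar>E - (LINT x|lb01. dev i x * dev j x) * (LINT x|lb01. dev k x * dev l x)\<bar> \<le> 8 * \<rho> (k - j)"
    using sh assms by (simp add: E_def mult_ac)
qed

end

section \<open>Second and fourth moments\<close>

definition ndist :: "nat \<Rightarrow> nat \<Rightarrow> nat" where "ndist i j = (i - j) + (j - i)"

lemma ndist_commute: "ndist i j = ndist j i" by (simp add: ndist_def)

lemma ndist_le: "i \<le> j \<Longrightarrow> ndist i j = j - i" by (simp add: ndist_def)

text \<open>Each distance occurs at most twice, once on either side of i.\<close>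

lemma sum_ndist_le:
  fixes h :: "nat \<Rightarrow> real"
  assumes h: "\<And>r. 0 \<le> h r" and i: "i \<le> n"
  shows "(\<Sum>j\<le>n. h (ndist i j)) \<le> 2 * (\<Sum>r\<le>n. h r)"
proof -
  have "{..n} = {..i} \<union> {i<..n}" using i by auto
  then have "(\<Sum>j\<le>n. h (ndist i j)) = (\<Sum>j\<le>i. h (ndist i j)) + (\<Sum>j\<in>{i<..n}. h (ndist i j))"
    by (simp add: sum.union_disjoint disjoint_iff)
  also have "(\<Sum>j\<le>i. h (ndist i j)) = (\<Sum>r\<le>i. h r)"
    by (rule sum.reindex_bij_witness[of _ "\<lambda>r. i - r" "\<lambda>j. i - j"]) (auto simp: ndist_def)
  also have "\<dots> \<le> (\<Sum>r\<le>n. h r)" using i h by (intro sum_mono2) auto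
  also have "(\<Sum>j\<in>{i<..n}. h (ndist i j)) = (\<Sum>r\<in>{0<..n-i}. h r)"
    by (rule sum.reindex_bij_witness[of _ "\<lambda>r. i + r" "\<lambda>j. j - i"]) (auto simp: ndist_def)
  also have "\<dots> \<le> (\<Sum>r\<le>n. h r)" using i h by (intro sum_mono2) auto
  finally show ?thesis by simp
qed

lemma symmetric_wlog3:
  fixes R :: "nat \<Rightarrow> nat \<Rightarrow> nat \<Rightarrow> bool"
  assumes s: "\<And>i j k. i \<le> j \<Longrightarrow> j \<le> k \<Longrightarrow> R i j k"
    and sw1: "\<And>i j k. R i j k \<Longrightarrow> R j i k" and sw2: "\<And>i j k. R i j k \<Longrightarrow> R i k j"
  shows "R i j k"
proof -
  have *: "R i j k" if "i \<le> j" for i j k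
  proof -
    consider "j \<le> k" | "i \<le> k" "k \<le> j" | "k \<le> i" by linarith
    then show ?thesis
    proof cases
      case 1 then show ?thesis using s that by blast
    next
      case 2 then show ?thesis using sw2[OF s[of i k j]] by blast
    next
      case 3 then show ?thesis using sw2[OF sw1[OF s[of k i j]]] that by blast
    qed
  qed
  show ?thesis using *[of i j k] sw1[OF *[of j i k]] by linarith
qed

text \<open>Adjacent transpositions sort any quadruple: three indices are handled by
  \<open>symmetric_wlog3\<close>, and the fourth is then inserted.\<close>

lemma symmetric_wlog4:
  fixes P :: "nat \<Rightarrow> nat \<Rightarrow> nat \<Rightarrow> nat \<Rightarrow> bool"
  assumes s: "\<And>i j k l. i \<le> j \<Longrightarrow> j \<le> k \<Longrightarrow> k \<le> l \<Longrightarrow> P i j k l"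
    and sw1: "\<And>i j k l. P i j k l \<Longrightarrow> P j i k l" and sw2: "\<And>i j k l. P i j k l \<Longrightarrow> P i k j l"
    and sw3: "\<And>i j k l. P i j k l \<Longrightarrow> P i j l k"
  shows "P i j k l"
proof (rule symmetric_wlog3[of "\<lambda>i j k. P i j k l"])
  fix i j k :: nat assume ij: "i \<le> j" "j \<le> k"
  consider "k \<le> l" | "j \<le> l" "l \<le> k" | "i \<le> l" "l \<le> j" | "l \<le> i" by linarith
  then show "P i j k l"
  proof cases
    case 1 then show ?thesis using s ij by blast
  next
    case 2 then show ?thesis using sw3[OF s[of i j l k]] ij by blast
  next
    case 3 then show ?thesis using sw3[OF sw2[OF s[of i l j k]]] ij by blast
  next
    case 4 then show ?thesis using sw3[OF sw2[OF sw1[OF s[of l i j k]]]] ij by blast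
  qed
qed (use sw1 sw2 in blast)+

lemma sum_power2_expand: "(\<Sum>i\<in>A. u i :: real)^2 = (\<Sum>i\<in>A. \<Sum>j\<in>A. u i * u j)"
  by (simp add: power2_eq_square sum_product)

lemma sum_power4_expand:
  "(\<Sum>i\<in>A. u i :: real)^4 = (\<Sum>i\<in>A. \<Sum>j\<in>A. \<Sum>k\<in>A. \<Sum>l\<in>A. u i * u j * u k * u l)"
proof -
  have "(\<Sum>i\<in>A. u i)^4 = (\<Sum>i\<in>A. \<Sum>j\<in>A. u i * u j) * (\<Sum>i\<in>A. u i) * (\<Sum>i\<in>A. u i)"
    by (simp add: power4_eq_xxxx sum_product)
  also have "\<dots> = (\<Sum>i\<in>A. \<Sum>j\<in>A. \<Sum>k\<in>A. \<Sum>l\<in>A. u i * u j * u k * u l)"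
    by (simp only: sum_distrib_right, simp only: sum_distrib_left sum_distrib_right,
      rule sum.cong[OF refl], rule sum.cong[OF refl], rule sum.swap)
  finally show ?thesis .
qed

lemma memory_loss_nonneg:
  assumes ml: "memory_loss b \<rho>" and b: "0 < b" "b < 1" shows "0 \<le> \<rho> k"
  using memory_lossD[OF ml, of "\<lambda>_. 0" "\<lambda>_. 0" "\<lambda>_. 0" "\<lambda>_. 0" k] cone_const[of b 0] b by simp

context observed_orbit begin

lemma rho_nonneg: "0 \<le> \<rho> k" by (rule memory_loss_nonneg[OF ml b])

lemma prod_integrable:
  "integrable lb01 (\<lambda>x. dev i x * dev j x)" "integrable lb01 (\<lambda>x. dev i x * dev j x * dev k x * dev l x)"
proof -
  have m: "\<bar>x * y\<bar> \<le> 1" if "\<bar>x\<bar> \<le> 1" "\<bar>y\<bar> \<le> 1" for x y :: real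
    using that by (simp add: abs_mult mult_le_one)
  show "integrable lb01 (\<lambda>x. dev i x * dev j x)" by (rule bounded_integrable[of _ 1]) (auto intro!: m dev_bound)
  show "integrable lb01 (\<lambda>x. dev i x * dev j x * dev k x * dev l x)"
    by (rule bounded_integrable[of _ 1]) (auto intro!: m dev_bound)
qed

lemma correlation2': "\<bar>LINT x|lb01. dev i x * dev j x\<bar> \<le> 4 * \<rho> (ndist i j)"
proof (cases "i \<le> j")
  case True then show ?thesis using correlation2 by (simp add: ndist_le)
next
  case False then show ?thesis using correlation2[of j i] by (simp add: ndist_commute[of i j] ndist_le mult.commute)
qed

text \<open>Covariances decay with the distance of the times, so each row of the covariance matrix
  sums to a multiple of \<open>\<Sum>r\<le>n. \<rho> r\<close>. With weights of order 1/n the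
  variance is bounded by a multiple of a Cesaro mean of \<rho>.\<close>

lemma second_moment:
  assumes l: "\<And>k. k \<le> n \<Longrightarrow> 0 \<le> v k \<and> v k \<le> 1 / real n"
  shows "(LINT x|lb01. (\<Sum>k\<le>n. v k * dev k x)^2) \<le> 8 * (1 + real n) / (real n)^2 * (\<Sum>r\<le>n. \<rho> r)"
proof -
  have eq: "(\<Sum>k\<le>n. v k * dev k x)^2 = (\<Sum>i\<le>n. \<Sum>j\<le>n. (v i * v j) * (dev i x * dev j x))" for x
    unfolding sum_power2_expand by (simp add: mult_ac)
  have "(LINT x|lb01. (\<Sum>k\<le>n. v k * dev k x)^2) = (\<Sum>i\<le>n. \<Sum>j\<le>n. (v i * v j) * (LINT x|lb01. dev i x * dev j x))"
    unfolding eq by (simp add: Bochner_Integration.integral_sum prod_integrable)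
  also have "\<dots> \<le> (\<Sum>i\<le>n. \<Sum>j\<le>n. (1 / real n * (1 / real n)) * (4 * \<rho> (ndist i j)))"
  proof (intro sum_mono)
    fix i j assume "i \<in> {..n}" "j \<in> {..n}"
    then have ij: "0 \<le> v i" "v i \<le> 1 / n" "0 \<le> v j" "v j \<le> 1 / n" using l by auto
    have "(v i * v j) * (LINT x|lb01. dev i x * dev j x) \<le> (v i * v j) * (4 * \<rho> (ndist i j))"
      using ij correlation2'[of i j] by (intro mult_left_mono) auto
    also have "\<dots> \<le> (1 / real n * (1 / real n)) * (4 * \<rho> (ndist i j))"
      using ij rho_nonneg by (intro mult_right_mono mult_mono) auto
    finally show "(v i * v j) * (LINT x|lb01. dev i x * dev j x) \<le> (1 / real n * (1 / real n)) * (4 * \<rho> (ndist i j))" .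
  qed
  also have "\<dots> = 4 / (real n)^2 * (\<Sum>i\<le>n. \<Sum>j\<le>n. \<rho> (ndist i j))"
    by (simp add: sum_distrib_left power2_eq_square)
  also have "\<dots> \<le> 4 / (real n)^2 * (\<Sum>i\<le>n. 2 * (\<Sum>r\<le>n. \<rho> r))"
    using rho_nonneg by (intro mult_left_mono sum_mono sum_ndist_le) auto
  also have "\<dots> = 8 * (1 + real n) / (real n)^2 * (\<Sum>r\<le>n. \<rho> r)" by simp
  finally show ?thesis .
qed

end

section \<open>Sums and products of decay rates\<close>

lemma average_tendsto_0:
  fixes \<rho> :: "nat \<Rightarrow> real"
  assumes nn: "\<And>k. 0 \<le> \<rho> k" and lim: "\<rho> \<longlonglongrightarrow> 0"
  shows "(\<lambda>n. (\<Sum>r\<le>n. \<rho> r) / real n) \<longlonglongrightarrow> 0"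
proof (rule LIMSEQ_I)
  fix e :: real assume e: "0 < e"
  obtain N where N: "\<And>k. k \<ge> N \<Longrightarrow> \<rho> k < e / 4"
    using LIMSEQ_D[OF lim, of "e/4"] e nn by auto
  define S where "S = (\<Sum>r<N. \<rho> r)"
  have S: "(\<Sum>r\<le>n. \<rho> r) \<le> S + (1 + real n) * (e / 4)" for n
  proof -
    have "(\<Sum>r\<le>n. \<rho> r) \<le> (\<Sum>r\<le>n. (if r < N then \<rho> r else 0) + e / 4)"
      using N e nn by (intro sum_mono) (auto simp: not_less less_imp_le)
    also have "\<dots> = (\<Sum>r\<in>{..n} \<inter> {..<N}. \<rho> r) + (1 + real n) * (e / 4)"
      by (simp add: sum.distrib sum.inter_restrict)
    also have "(\<Sum>r\<in>{..n} \<inter> {..<N}. \<rho> r) \<le> S" unfolding S_def using nn by (intro sum_mono2) auto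
    finally show ?thesis by simp
  qed
  obtain M :: nat where M: "real M > 4 * S / e" using reals_Archimedean2 by blast
  show "\<exists>no. \<forall>n\<ge>no. norm ((\<Sum>r\<le>n. \<rho> r) / real n - 0) < e"
  proof (intro exI[of _ "max 1 M"] allI impI)
    fix n assume n: "max 1 M \<le> n"
    then have n1: "1 \<le> real n" and "real M \<le> real n" by auto
    then have "4 * S / e < real n" using M by linarith
    then have "4 * S < real n * e" using e by (simp add: field_simps)
    then have "S + (1 + real n) * (e / 4) < real n * e"
    proof -
      have "e \<le> real n * e" using e n1 by simp
      moreover have "(1 + real n) * (e / 4) = e / 4 + real n * e / 4" by (simp add: distrib_right)
      ultimately show ?thesis using \<open>4 * S < real n * e\<close> e by linarith
    qed
    then have "(\<Sum>r\<le>n. \<rho> r) < e * real n" using S[of n] by (simp add: mult.commute)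
    then show "norm ((\<Sum>r\<le>n. \<rho> r) / real n - 0) < e"
      using n1 nn by (simp add: field_simps sum_nonneg)
  qed
qed

text \<open>Telescoping: from y - 1 to y the function \<open>y powr (1 - \<kappa>)\<close> grows by
  at least \<open>(1 - \<kappa>) / 2 * y powr - \<kappa>\<close>.\<close>

lemma sum_powr_le:
  assumes \<kappa>: "0 < \<kappa>" "\<kappa> < 1"
  shows "(\<Sum>r\<le>n. (1 + real r) powr - \<kappa>) \<le> 2 / (1 - \<kappa>) * (1 + real n) powr (1 - \<kappa>)"
proof -
  let ?p = "1 - \<kappa>"
  have step: "?p / 2 * y powr - \<kappa> \<le> y powr ?p - (y - 1) powr ?p" if y: "1 \<le> y" for y :: real
  proof (cases "y = 1")
    case True then show ?thesis using \<kappa> by simp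
  next
    case False
    let ?t = "?p / y"
    have y1: "1 < y" and t: "0 \<le> ?t" "?t \<le> 1" using y False \<kappa> by (auto simp: field_simps)
    have "ln (1 - 1/y) \<le> - (1 / y)" using ln_le_minus_one[of "1 - 1/y"] y1 by simp
    then have "?p * ln (1 - 1/y) \<le> - ?t" using \<kappa> mult_left_mono[of "ln (1 - 1/y)" "-(1/y)" ?p] by simp
    then have "(1 - 1/y) powr ?p \<le> exp (- ?t)" using y1 by (simp add: powr_def)
    also have "\<dots> = 1 / exp ?t" by (simp add: exp_minus field_simps)
    also have "\<dots> \<le> 1 / (1 + ?t)" using t exp_ge_add_one_self[of ?t] by (intro divide_left_mono mult_pos_pos) auto
    also have "\<dots> \<le> 1 - ?t / 2"
    proof -
      have "1 \<le> (1 - t / 2) * (1 + t)" if "0 \<le> t" "t \<le> 1" for t :: real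
        using that mult_left_mono[of t 1 t] by (simp add: algebra_simps)
      from this[OF t] show ?thesis using t by (simp add: pos_divide_le_eq add_pos_nonneg)
    qed
    finally have *: "(1 - 1/y) powr ?p \<le> 1 - ?t / 2" .
    have "(y - 1) powr ?p = (y * (1 - 1/y)) powr ?p" using y1 by (simp add: right_diff_distrib)
    also have "\<dots> = y powr ?p * (1 - 1/y) powr ?p" by (rule powr_mult)
    also have "\<dots> \<le> y powr ?p * (1 - ?t / 2)" using * by (intro mult_left_mono) auto
    also have "\<dots> = y powr ?p - ?p / 2 * (y powr ?p / y)"
    proof -
      have "A * (1 - P / y / 2) = A - P / 2 * (A / y)" for A P :: real by (simp add: right_diff_distrib mult_ac)
      then show ?thesis .
    qed
    also have "y powr ?p / y = y powr - \<kappa>"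
      using y1 powr_diff[of y 1 \<kappa>] by (simp add: powr_minus field_simps)
    finally show ?thesis by simp
  qed
  have "?p / 2 * (\<Sum>r\<le>n. (1 + real r) powr - \<kappa>) \<le> (1 + real n) powr ?p"
  proof (induction n)
    case 0 then show ?case using \<kappa> by simp
  next
    case (Suc n)
    then show ?case using step[of "1 + real (Suc n)"] by (simp add: distrib_left)
  qed
  then show ?thesis using \<kappa> by (simp add: field_simps)
qed

text \<open>The diameter dominates the three distances from i. Splitting the exponent into thirds
  separates j, k and l, so their sums factorise; each third stays below 1 when \<delta> < 2.\<close>

lemma powr_diam_le:
  assumes "0 < \<delta>"
  shows "(1 + real (max (max i j) (max k l) - min (min i j) (min k l))) powr - (1 + \<delta>)
    \<le> (1 + real (ndist i j)) powr - ((1 + \<delta>) / 3) * (1 + real (ndist i k)) powr - ((1 + \<delta>) / 3) * (1 + real (ndist i l)) powr - ((1 + \<delta>) / 3)"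
proof -
  let ?D = "1 + real (max (max i j) (max k l) - min (min i j) (min k l))"
  have e: "- (1 + \<delta>) = - ((1 + \<delta>) / 3) + - ((1 + \<delta>) / 3) + - ((1 + \<delta>) / 3)" by (simp add: field_simps)
  have "?D powr - (1 + \<delta>) = ?D powr - ((1 + \<delta>) / 3) * ?D powr - ((1 + \<delta>) / 3) * ?D powr - ((1 + \<delta>) / 3)"
    unfolding e powr_add ..
  also have "\<dots> \<le> (1 + real (ndist i j)) powr - ((1 + \<delta>) / 3) * (1 + real (ndist i k)) powr - ((1 + \<delta>) / 3) * (1 + real (ndist i l)) powr - ((1 + \<delta>) / 3)"
    using assms by (intro mult_mono powr_mono2') (auto simp: ndist_def intro!: mult_nonneg_nonneg)
  finally show ?thesis .
qed

context observed_orbit begin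

abbreviation E4 :: "nat \<Rightarrow> nat \<Rightarrow> nat \<Rightarrow> nat \<Rightarrow> real" where
  "E4 i j k l \<equiv> LINT x|lb01. dev i x * dev j x * dev k x * dev l x"

text \<open>For sorted times one gap is at least a third of the diameter. If it is an outer gap, the
  whole correlation is small; if it is the middle one, the correlation is close to a product of two
  covariances. Both sides are invariant under adjacent transpositions, which gives the other
  orders.\<close>

lemma correlation4_bound:
  assumes rho: "\<And>r. \<rho> r = C * (1 + real r) powr - (1 + \<delta>)" and C: "0 \<le> C" and \<delta>: "0 < \<delta>" "\<delta> < 1"
  shows "\<bar>E4 i j k l\<bar> \<le> 144 * C * (1 + real (max (max i j) (max k l) - min (min i j) (min k l))) powr - (1 + \<delta>)
     + 16 * (\<rho> (ndist i j) * \<rho> (ndist k l) + \<rho> (ndist i k) * \<rho> (ndist j l) + \<rho> (ndist i l) * \<rho> (ndist j k))"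
proof (rule symmetric_wlog4[of "\<lambda>i j k l. \<bar>E4 i j k l\<bar> \<le> 144 * C * (1 + real (max (max i j) (max k l) - min (min i j) (min k l))) powr - (1 + \<delta>)
     + 16 * (\<rho> (ndist i j) * \<rho> (ndist k l) + \<rho> (ndist i k) * \<rho> (ndist j l) + \<rho> (ndist i l) * \<rho> (ndist j k))"], goal_cases)
  case (1 i j k l)
  have rr: "0 \<le> \<rho> x * \<rho> y" for x y using rho_nonneg by simp
  have D: "max (max i j) (max k l) - min (min i j) (min k l) = l - i" using 1 by (auto simp: max_def min_def)
  \<comment> \<open>144 = 16 * 9, where 16 is the largest constant in \<open>correlation4\<close>
    and 9 bounds \<open>3 powr (1 + \<delta>)\<close>.\<close>
  have gap: "16 * \<rho> m \<le> 144 * C * (1 + real (l - i)) powr - (1 + \<delta>)" if m: "l - i \<le> 3 * m" for m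
  proof -
    have "(1 + real m) powr - (1 + \<delta>) \<le> ((1 + real (l - i)) / 3) powr - (1 + \<delta>)"
      using m \<delta> by (intro powr_mono2') auto
    also have "\<dots> = (1 + real (l - i)) powr - (1 + \<delta>) * 3 powr (1 + \<delta>)"
      by (subst powr_divide, subst powr_minus_divide[of 3]) simp
    also have "\<dots> \<le> (1 + real (l - i)) powr - (1 + \<delta>) * 9"
      using powr_mono[of "1+\<delta>" 2 "3::real"] \<delta> by (intro mult_left_mono) auto
    finally have "16 * C * (1 + real m) powr - (1 + \<delta>) \<le> 16 * C * ((1 + real (l - i)) powr - (1 + \<delta>) * 9)"
      using C by (intro mult_left_mono) auto
    then show ?thesis by (simp add: rho mult_ac)
  qed
  note c4 = correlation4[OF 1]
  have main: "\<bar>E4 i j k l\<bar> \<le> 144 * C * (1 + real (l - i)) powr - (1 + \<delta>) + 16 * (\<rho> (j - i) * \<rho> (l - k))"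
  proof -
    consider "l - i \<le> 3 * (l - k)" | "l - i \<le> 3 * (j - i)" | "l - i \<le> 3 * (k - j)" using 1 by linarith
    then show ?thesis
    proof cases
      case 1 then show ?thesis using c4(1) gap rr[of "j - i" "l - k"] by fastforce
    next
      case 2 then show ?thesis using c4(2) gap[OF 2] rr[of "j - i" "l - k"] rho_nonneg[of "j - i"] by linarith
    next
      case 3
      let ?x = "LINT x|lb01. dev i x * dev j x" and ?y = "LINT x|lb01. dev k x * dev l x"
      have "\<bar>?x\<bar> * \<bar>?y\<bar> \<le> (4 * \<rho> (j - i)) * (4 * \<rho> (l - k))"
        using correlation2[OF 1(1)] correlation2[OF 1(3)] rho_nonneg by (intro mult_mono) auto
      then have "\<bar>?x * ?y\<bar> \<le> 16 * (\<rho> (j - i) * \<rho> (l - k))" by (simp add: abs_mult)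
      then show ?thesis using c4(3) gap[OF 3] rho_nonneg[of "k - j"] by linarith
    qed
  qed
  have "\<rho> (j - i) * \<rho> (l - k) \<le> \<rho> (ndist i j) * \<rho> (ndist k l) + \<rho> (ndist i k) * \<rho> (ndist j l) + \<rho> (ndist i l) * \<rho> (ndist j k)"
    using rr[of "ndist i k" "ndist j l"] rr[of "ndist i l" "ndist j k"] 1 by (simp add: ndist_le)
  then have "16 * (\<rho> (j - i) * \<rho> (l - k)) \<le> 16 * (\<rho> (ndist i j) * \<rho> (ndist k l) + \<rho> (ndist i k) * \<rho> (ndist j l) + \<rho> (ndist i l) * \<rho> (ndist j k))"
    by (rule mult_left_mono) simp
  then show ?case unfolding D by (rule order_trans[OF main add_left_mono])
next
  case (2 i j k l)
  have e: "E4 j i k l = E4 i j k l" by (simp add: mult_ac)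
  show ?case using 2 unfolding e
    by (simp only: max.commute[of j i] min.commute[of j i] ndist_commute[of j i] add_ac mult_ac)
next
  case (3 i j k l)
  have e: "E4 i k j l = E4 i j k l" by (simp add: mult_ac)
  have m: "max (max i k) (max j l) = max (max i j) (max k l)" "min (min i k) (min j l) = min (min i j) (min k l)"
    by (auto simp: max_def min_def)
  show ?case using 3 unfolding e m by (simp only: ndist_commute[of k j] add_ac)
next
  case (4 i j k l)
  have e: "E4 i j l k = E4 i j k l" by (simp add: mult_ac)
  show ?case using 4 unfolding e
    by (simp only: max.commute[of l k] min.commute[of l k] ndist_commute[of l k] add_ac)
qed

text \<open>With N = 1 + n, the diameter terms sum to order
  \<open>N powr (4 - (1 + \<delta>))\<close>: three free sums of order
  \<open>N powr (1 - (1 + \<delta>) / 3)\<close> and one factor N for i. The pair terms give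
  \<open>N powr 2\<close>, which is smaller as \<delta> < 1. The weights contribute
  \<open>1 / n ^ 4\<close>, and 16 bounds \<open>((1 + n) / n) ^ 4\<close>.\<close>

lemma fourth_moment:
  assumes rho: "\<And>r. \<rho> r = C * (1 + real r) powr - (1 + \<delta>)" and C: "0 \<le> C" and \<delta>: "0 < \<delta>" "\<delta> < 1"
    and R: "\<And>n. (\<Sum>r\<le>n. \<rho> r) \<le> R"
    and v: "\<And>k. k \<le> n \<Longrightarrow> 0 \<le> v k \<and> v k \<le> 1 / real n" and n: "n \<ge> 1"
  shows "(LINT x|lb01. (\<Sum>k\<le>n. v k * dev k x)^4) \<le> 16 * (144 * C * (4 / (1 - (1 + \<delta>) / 3))^3 + 192 * R\<^sup>2) * (1 + real n) powr - (1 + \<delta>)"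
proof -
  define \<kappa> where "\<kappa> = (1 + \<delta>) / 3"
  have \<kappa>: "0 < \<kappa>" "\<kappa> < 1" using \<delta> by (auto simp: \<kappa>_def)
  define \<phi> where "\<phi> r = (1 + real r) powr - \<kappa>" for r
  have \<phi>: "0 \<le> \<phi> r" for r by (simp add: \<phi>_def)
  define B where "B i j k l = 144 * C * (\<phi> (ndist i j) * \<phi> (ndist i k) * \<phi> (ndist i l))
     + 16 * (\<rho> (ndist i j) * \<rho> (ndist k l) + \<rho> (ndist i k) * \<rho> (ndist j l) + \<rho> (ndist i l) * \<rho> (ndist j k))" for i j k l
  have EB: "\<bar>E4 i j k l\<bar> \<le> B i j k l" for i j k l
  proof -
    have "144 * C * (1 + real (max (max i j) (max k l) - min (min i j) (min k l))) powr - (1 + \<delta>)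
       \<le> 144 * C * (\<phi> (ndist i j) * \<phi> (ndist i k) * \<phi> (ndist i l))"
      unfolding \<phi>_def \<kappa>_def using C by (intro mult_left_mono powr_diam_le \<delta>) auto
    then show ?thesis using correlation4_bound[OF rho C \<delta>, of i j k l] unfolding B_def by linarith
  qed
  have eq: "(\<Sum>k\<le>n. v k * dev k x)^4 = (\<Sum>i\<le>n. \<Sum>j\<le>n. \<Sum>k\<le>n. \<Sum>l\<le>n. (v i * v j * v k * v l) * (dev i x * dev j x * dev k x * dev l x))" for x
    unfolding sum_power4_expand by (simp add: mult_ac)
  have "(LINT x|lb01. (\<Sum>k\<le>n. v k * dev k x)^4) = (\<Sum>i\<le>n. \<Sum>j\<le>n. \<Sum>k\<le>n. \<Sum>l\<le>n. (v i * v j * v k * v l) * E4 i j k l)"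
    unfolding eq by (simp add: Bochner_Integration.integral_sum prod_integrable)
  also have "\<dots> \<le> (\<Sum>i\<le>n. \<Sum>j\<le>n. \<Sum>k\<le>n. \<Sum>l\<le>n. (1 / real n)^4 * B i j k l)"
  proof (intro sum_mono)
    fix i j k l assume "i \<in> {..n}" "j \<in> {..n}" "k \<in> {..n}" "l \<in> {..n}"
    then have ij: "0 \<le> v i" "v i \<le> 1 / n" "0 \<le> v j" "v j \<le> 1 / n" "0 \<le> v k" "v k \<le> 1 / n" "0 \<le> v l" "v l \<le> 1 / n" using v by auto
    have B0: "0 \<le> B i j k l" using EB[of i j k l] by linarith
    have "(v i * v j * v k * v l) * E4 i j k l \<le> (v i * v j * v k * v l) * B i j k l"
      using ij EB[of i j k l] by (intro mult_left_mono mult_nonneg_nonneg) auto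
    also have "\<dots> \<le> (1 / n * (1 / n) * (1 / n) * (1 / n)) * B i j k l"
      using ij B0 by (intro mult_right_mono mult_mono mult_nonneg_nonneg) auto
    finally show "(v i * v j * v k * v l) * E4 i j k l \<le> (1 / real n)^4 * B i j k l" by (simp add: power4_eq_xxxx)
  qed
  also have "\<dots> = (1 / real n)^4 * (\<Sum>i\<le>n. \<Sum>j\<le>n. \<Sum>k\<le>n. \<Sum>l\<le>n. B i j k l)"
    by (simp add: sum_distrib_left)
  also have "(\<Sum>i\<le>n. \<Sum>j\<le>n. \<Sum>k\<le>n. \<Sum>l\<le>n. B i j k l) =
     144 * C * (\<Sum>i\<le>n. (\<Sum>j\<le>n. \<phi> (ndist i j))^3) + 48 * (\<Sum>i\<le>n. \<Sum>j\<le>n. \<rho> (ndist i j))\<^sup>2"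
  proof -
    have 1: "(\<Sum>j\<le>n. \<Sum>k\<le>n. \<Sum>l\<le>n. 144 * C * (\<phi> (ndist i j) * \<phi> (ndist i k) * \<phi> (ndist i l))) = 144 * C * (\<Sum>j\<le>n. \<phi> (ndist i j))^3" for i
    proof -
      have "(\<Sum>j\<le>n. \<Sum>k\<le>n. \<Sum>l\<le>n. \<phi> (ndist i j) * \<phi> (ndist i k) * \<phi> (ndist i l)) = (\<Sum>j\<le>n. \<phi> (ndist i j))^3"
        by (simp only: power3_eq_cube mult.assoc sum_distrib_left[symmetric] sum_distrib_right[symmetric])
      then show ?thesis by (simp add: sum_distrib_left[symmetric])
    qed
    \<comment> \<open>The three pairings of four times yield the same square after exchanging sums,
      hence 3 * 16 = 48 above.\<close>
    let ?S = "(\<Sum>i\<le>n. \<Sum>j\<le>n. \<rho> (ndist i j))\<^sup>2"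
    have 2: "(\<Sum>i\<le>n. \<Sum>j\<le>n. \<Sum>k\<le>n. \<Sum>l\<le>n. \<rho> (ndist i j) * \<rho> (ndist k l)) = ?S"
      by (simp only: power2_eq_square sum_distrib_left[symmetric] sum_distrib_right[symmetric])
    have 3: "(\<Sum>i\<le>n. \<Sum>j\<le>n. \<Sum>k\<le>n. \<Sum>l\<le>n. \<rho> (ndist i k) * \<rho> (ndist j l)) = ?S"
      unfolding 2[symmetric] by (rule sum.cong[OF refl], rule sum.swap)
    have 4: "(\<Sum>i\<le>n. \<Sum>j\<le>n. \<Sum>k\<le>n. \<Sum>l\<le>n. \<rho> (ndist i l) * \<rho> (ndist j k)) = ?S"
      unfolding 3[symmetric] by (rule sum.cong[OF refl], rule sum.cong[OF refl], rule sum.swap)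
    have "(\<Sum>i\<le>n. \<Sum>j\<le>n. \<Sum>k\<le>n. \<Sum>l\<le>n. B i j k l) =
       (\<Sum>i\<le>n. \<Sum>j\<le>n. \<Sum>k\<le>n. \<Sum>l\<le>n. 144 * C * (\<phi> (ndist i j) * \<phi> (ndist i k) * \<phi> (ndist i l))) +
       16 * (\<Sum>i\<le>n. \<Sum>j\<le>n. \<Sum>k\<le>n. \<Sum>l\<le>n. \<rho> (ndist i j) * \<rho> (ndist k l) + \<rho> (ndist i k) * \<rho> (ndist j l) + \<rho> (ndist i l) * \<rho> (ndist j k))"
      unfolding B_def by (simp only: sum.distrib sum_distrib_left distrib_left)
    also have "\<dots> = 144 * C * (\<Sum>i\<le>n. (\<Sum>j\<le>n. \<phi> (ndist i j))^3) + 16 * (?S + ?S + ?S)"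
      unfolding sum.distrib 1 2 3 4 by (simp add: sum_distrib_left)
    finally show ?thesis by simp
  qed
  also have "(\<Sum>i\<le>n. (\<Sum>j\<le>n. \<phi> (ndist i j))^3) \<le> (\<Sum>i\<le>n. (4 / (1 - \<kappa>) * (1 + real n) powr (1 - \<kappa>))^3)"
  proof (intro sum_mono power_mono)
    fix i assume i: "i \<in> {..n}"
    show "0 \<le> (\<Sum>j\<le>n. \<phi> (ndist i j))" by (intro sum_nonneg \<phi>)
    have "(\<Sum>j\<le>n. \<phi> (ndist i j)) \<le> 2 * (\<Sum>r\<le>n. \<phi> r)" using i by (intro sum_ndist_le \<phi>) auto
    also have "\<dots> \<le> 2 * (2 / (1 - \<kappa>) * (1 + real n) powr (1 - \<kappa>))"
      unfolding \<phi>_def by (intro mult_left_mono sum_powr_le \<kappa>) auto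
    finally show "(\<Sum>j\<le>n. \<phi> (ndist i j)) \<le> 4 / (1 - \<kappa>) * (1 + real n) powr (1 - \<kappa>)" by simp
  qed
  also have "\<dots> = (4 / (1 - \<kappa>))^3 * (1 + real n) powr (4 - (1 + \<delta>))"
  proof -
    have "(1 + real n) * ((1 + real n) powr (1 - \<kappa>))^3 = (1 + real n) powr 1 * (1 + real n) powr (1 - \<kappa>) * (1 + real n) powr (1 - \<kappa>) * (1 + real n) powr (1 - \<kappa>)"
      by (simp add: power3_eq_cube)
    also have "\<dots> = (1 + real n) powr (1 + (1 - \<kappa>) + (1 - \<kappa>) + (1 - \<kappa>))"
      by (simp only: powr_add[symmetric])
    also have "1 + (1 - \<kappa>) + (1 - \<kappa>) + (1 - \<kappa>) = 4 - (1 + \<delta>)" by (simp add: \<kappa>_def field_simps)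
    finally have f1: "(1 + real n) * ((1 + real n) powr (1 - \<kappa>))^3 = (1 + real n) powr (4 - (1 + \<delta>))" .
    have f2: "(\<Sum>i\<le>n. (c * X)^3) = c^3 * ((1 + real n) * X^3)" for c X :: real
      by (simp add: power_mult_distrib)
    show ?thesis unfolding f2 f1 ..
  qed
  also have "(\<Sum>i\<le>n. \<Sum>j\<le>n. \<rho> (ndist i j))\<^sup>2 \<le> ((1 + real n) * (2 * R))\<^sup>2"
  proof (intro power_mono)
    have "(\<Sum>i\<le>n. \<Sum>j\<le>n. \<rho> (ndist i j)) \<le> (\<Sum>i\<le>n. 2 * (\<Sum>r\<le>n. \<rho> r))"
      using rho_nonneg by (intro sum_mono sum_ndist_le) auto
    also have "\<dots> \<le> (\<Sum>i\<le>n. 2 * R)" by (intro sum_mono mult_left_mono R) auto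
    finally show "(\<Sum>i\<le>n. \<Sum>j\<le>n. \<rho> (ndist i j)) \<le> (1 + real n) * (2 * R)" by simp
  qed (auto intro!: sum_nonneg rho_nonneg)
  also have "((1 + real n) * (2 * R))\<^sup>2 = 4 * R\<^sup>2 * (1 + real n) powr 2" by (simp add: power_mult_distrib)
  also have "(1 + real n) powr 2 \<le> (1 + real n) powr (4 - (1 + \<delta>))" using \<delta> by (intro powr_mono) auto
  finally have "(LINT x|lb01. (\<Sum>k\<le>n. v k * dev k x)^4) \<le> (1 / real n)^4 *
      (144 * C * ((4 / (1 - \<kappa>))^3 * (1 + real n) powr (4 - (1 + \<delta>))) + 48 * (4 * R\<^sup>2 * (1 + real n) powr (4 - (1 + \<delta>))))"
    using C by (simp add: mult_left_mono)
  also have "\<dots> = (144 * C * (4 / (1 - \<kappa>))^3 + 192 * R\<^sup>2) * ((1 / real n)^4 * (1 + real n) powr (4 - (1 + \<delta>)))"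
    by (simp add: algebra_simps)
  also have "\<dots> \<le> (144 * C * (4 / (1 - \<kappa>))^3 + 192 * R\<^sup>2) * (16 * (1 + real n) powr - (1 + \<delta>))"
  proof (intro mult_left_mono)
    have "(1 + real n) powr (4 - (1 + \<delta>)) = (1 + real n)^4 * (1 + real n) powr - (1 + \<delta>)"
    proof -
      have "4 - (1 + \<delta>) = 4 + - (1 + \<delta>)" by simp
      then have "(1 + real n) powr (4 - (1 + \<delta>)) = (1 + real n) powr 4 * (1 + real n) powr - (1 + \<delta>)"
        by (simp only: powr_add)
      then show ?thesis by simp
    qed
    moreover have "(1 / real n)^4 * (1 + real n)^4 \<le> 16"
    proof -
      have "(1 / real n)^4 * (1 + real n)^4 = ((1 + real n) / n)^4" by (simp add: power_divide)
      also have "\<dots> \<le> 2^4" using n by (intro power_mono) (auto simp: field_simps)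
      finally show ?thesis by simp
    qed
    ultimately show "(1 / real n)^4 * (1 + real n) powr (4 - (1 + \<delta>)) \<le> 16 * (1 + real n) powr - (1 + \<delta>)"
      using mult_right_mono[of "(1 / real n)^4 * (1 + real n)^4" 16 "(1 + real n) powr - (1 + \<delta>)"]
      by (simp only: mult.assoc powr_ge_zero)
    show "0 \<le> 144 * C * (4 / (1 - \<kappa>))^3 + 192 * R\<^sup>2" using C \<kappa> by simp
  qed
  finally show ?thesis unfolding \<kappa>_def by (simp only: mult_ac)
qed

end

lemma sum_powr_bounded:
  assumes "0 < \<delta>" obtains R :: real where "\<And>n. (\<Sum>r\<le>n. (1 + real r) powr - (1 + \<delta>)) \<le> R"
proof -
  have "summable (\<lambda>n. real n powr - (1 + \<delta>))" using assms by (simp add: summable_real_powr_iff)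
  then have s: "summable (\<lambda>n. real (Suc n) powr - (1 + \<delta>))"
    using summable_ignore_initial_segment[of _ 1] by fastforce
  have "(\<Sum>r\<le>n. (1 + real r) powr - (1 + \<delta>)) \<le> (\<Sum>n. real (Suc n) powr - (1 + \<delta>))" for n
    using sum_le_suminf[OF s, of "{..n}"] by (simp add: add.commute)
  then show ?thesis using that by blast
qed

section \<open>Invariant measures\<close>

abbreviation iter :: "real \<Rightarrow> nat \<Rightarrow> real \<Rightarrow> real" where
  "iter a k \<equiv> orb (\<lambda>_. a) k"

lemma trs_const_add: "trs (\<lambda>_. a) (j + k) f = trs (\<lambda>_. a) k (trs (\<lambda>_. a) j f)"
  by (rule trs_add)

text \<open>The sign of u is the test function that recovers the L1 norm from a bound on bounded
  test functions. It is cut off outside [0,1] to be Borel on the line.\<close>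

lemma L1_via_sgn:
  fixes u :: "real \<Rightarrow> real"
  assumes u: "integrable lb01 u"
  shows "\<exists>\<psi>. \<psi> \<in> borel_measurable borel \<and> (\<forall>x. \<bar>\<psi> x\<bar> \<le> (1::real)) \<and> (LINT x|lb01. \<psi> x * u x) = (LINT x|lb01. \<bar>u x\<bar>)"
proof (intro exI conjI allI)
  let ?p = "\<lambda>x. indicator {0..1} x *\<^sub>R sgn (u x)"
  have "(\<lambda>x. sgn (u x)) \<in> borel_measurable (restrict_space borel {0..1})"
    using u measurable_lb01_cong[of borel] by auto
  then show "?p \<in> borel_measurable borel"
    by (subst (asm) borel_measurable_restrict_space_iff) auto
  show "\<bar>?p x\<bar> \<le> 1" for x by (auto simp: indicator_def sgn_if)
  show "(LINT x|lb01. ?p x * u x) = (LINT x|lb01. \<bar>u x\<bar>)"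
    by (rule Bochner_Integration.integral_cong) (auto simp: sgn_if)
qed

lemma cone_integrable: "decr_cone b f \<Longrightarrow> integrable lb01 f"
  by (rule decr_integrable[OF cone_decr])

lemma mult_integrable:
  fixes \<psi> u :: "real \<Rightarrow> real"
  assumes "\<psi> \<in> borel_measurable borel" "\<And>x. \<bar>\<psi> x\<bar> \<le> C" "integrable lb01 u"
  shows "integrable lb01 (\<lambda>x. \<psi> x * u x)"
  using integrable_bounded_mult[OF assms(3) borel_imp_lb01[OF assms(1)] assms(2)] .

lemma memory_loss_L1:
  assumes ml: "memory_loss b \<rho>" and a: "\<And>i. a i \<in> {0..b}" and b: "b < 1" and f: "decr_cone b f" and g: "decr_cone b g" and eq: "(LINT x|lb01. f x) = (LINT x|lb01. g x)"
  shows "(LINT x|lb01. \<bar>trs a k f x - trs a k g x\<bar>) \<le> \<rho> k"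
proof -
  have i: "integrable lb01 (trs a k f)" "integrable lb01 (trs a k g)"
    using cone_integrable cone_trs[where a=a, OF a b] f g by auto
  then have "integrable lb01 (\<lambda>x. trs a k f x - trs a k g x)" by simp
  then obtain \<psi> where p: "\<psi> \<in> borel_measurable borel" "\<And>x. \<bar>\<psi> x\<bar> \<le> (1::real)"
    "(LINT x|lb01. \<psi> x * (trs a k f x - trs a k g x)) = (LINT x|lb01. \<bar>trs a k f x - trs a k g x\<bar>)" using L1_via_sgn by blast
  have "(LINT x|lb01. \<bar>trs a k f x - trs a k g x\<bar>) = (LINT x|lb01. \<psi> x * trs a k f x) - (LINT x|lb01. \<psi> x * trs a k g x)"
    unfolding p(3)[symmetric] right_diff_distrib
    by (rule Bochner_Integration.integral_diff[OF mult_integrable[OF p(1,2) i(1)] mult_integrable[OF p(1,2) i(2)]])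
  also have "\<dots> \<le> \<rho> k" using memory_lossD[where a=a and k=k, OF ml a f g eq p(1,2)] by linarith
  finally show ?thesis .
qed

text \<open>The images of the constant density 1 form a Cauchy sequence in L1 by loss of memory. A
  subsequence converges almost everywhere, dominated by \<open>K0 b * x powr - b\<close>, and the
  rate \<rho> carries weak convergence over to the whole sequence.\<close>

lemma invariant_density:
  assumes b: "0 < b" "b < 1" and a: "a \<in> {0..b}" and ml: "memory_loss b \<rho>" and lim: "\<rho> \<longlonglongrightarrow> 0"
  obtains h :: "real \<Rightarrow> real" where "integrable lb01 h" "AE x in lb01. 0 < h x" 
    "\<And>\<psi> :: real \<Rightarrow> real. \<psi> \<in> borel_measurable borel \<Longrightarrow> (\<And>x. \<bar>\<psi> x\<bar> \<le> 1) \<Longrightarrow> (\<lambda>k. LINT x|lb01. \<psi> (iter a k x)) \<longlonglongrightarrow> (LINT x|lb01. \<psi> x * h x)"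
proof -
  define H where "H k = trs (\<lambda>_. a) k (\<lambda>_. 1)" for k
  have a': "\<And>i. (\<lambda>_. a) i \<in> {0..b}" using a by simp
  have a0: "\<And>i::nat. 0 \<le> a" using a by simp
  have H: "decr_cone b (H k)" for k unfolding H_def by (rule cone_trs) (use a b cone_const in auto)
  have Hm: "(LINT x|lb01. H k x) = 1" for k
    unfolding H_def using trs_integrable(2)[of "\<lambda>_. a" "\<lambda>_. 1"] a0 lb01.prob_space by simp
  \<comment> \<open>Stationarity of the parameter: the image after j + k steps is also a k-step
    image of a unit density in the cone, so any two late images differ by at most
    \<open>\<rho> k\<close>.\<close>
  have Hk: "\<exists>f. decr_cone b f \<and> (LINT x|lb01. f x) = 1 \<and> H (j + k) = trs (\<lambda>_. a) k f" for j k
    using H[of j] Hm[of j] by (intro exI[of _ "H j"]) (simp add: H_def trs_const_add)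
  have L1: "(LINT x|lb01. \<bar>H i x - H j x\<bar>) \<le> \<rho> k" if "k \<le> i" "k \<le> j" for i j k
    using Hk[of "i - k" k] Hk[of "j - k" k] that memory_loss_L1[where a="\<lambda>_. a", OF ml a' b(2)] by fastforce
  have Hi: "integrable lb01 (H k)" for k using cone_integrable[OF H] .
  have "\<exists>N. \<forall>i\<ge>N. \<forall>j\<ge>N. LINT x|lb01. norm (H i x - H j x) < e" if "e > 0" for e
  proof -
    obtain N where "norm (\<rho> N - 0) < e" using LIMSEQ_D[OF lim \<open>e > 0\<close>] by blast
    then have "\<rho> N < e" by (simp add: abs_less_iff)
    then show ?thesis using L1[of N] by (intro exI[of _ N]) (auto intro: order.strict_trans1)
  qed
  then obtain r where r: "strict_mono r" "AE x in lb01. Cauchy (\<lambda>i. H (r i) x)"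
    using cauchy_L1_AE_cauchy_subseq[of lb01 H] Hi by blast
  define h where "h x = lim (\<lambda>i. H (r i) x)" for x
  have hm: "h \<in> borel_measurable lb01" unfolding h_def
    by (rule borel_measurable_lim_metric) (use Hi in auto)
  have conv: "AE x in lb01. (\<lambda>i. H (r i) x) \<longlonglongrightarrow> h x"
    using r(2) by eventually_elim (simp add: h_def Cauchy_convergent_iff convergent_LIMSEQ_iff)
  define D where "D x = K0 b * (indicator {0..1} x * x powr - b)" for x :: real
  have Di: "integrable lb01 D" unfolding D_def
    using powr_lb01(1)[of "-b" 1] b by (intro integrable_mult_right) auto
  have HD: "AE x in lb01. \<bar>H k x\<bar> \<le> D x" for k
  proof (rule AE_lb01I)
    fix x :: real assume x: "0 < x" "x \<le> 1"
    show "\<bar>H k x\<bar> \<le> D x" using cone_bound[OF H x, of k] decr_nonneg[OF cone_decr[OF H] x, of k] x by (simp add: D_def)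
  qed
  have hD: "AE x in lb01. \<bar>h x\<bar> \<le> D x"
  proof -
    have "AE x in lb01. \<forall>k. \<bar>H k x\<bar> \<le> D x" using HD by (simp add: AE_all_countable)
    with conv show ?thesis
    proof eventually_elim
      case (elim x)
      then show ?case by (intro LIMSEQ_le_const2[OF tendsto_rabs[OF elim(1)]]) auto
    qed
  qed
  have hi: "integrable lb01 h"
    by (rule Bochner_Integration.integrable_bound[OF Di hm]) (use hD in \<open>eventually_elim; auto\<close>)
  have sub: "(\<lambda>i. LINT x|lb01. \<psi> x * H (r i) x) \<longlonglongrightarrow> (LINT x|lb01. \<psi> x * h x)"
    if p: "\<psi> \<in> borel_measurable borel" "\<And>x. \<bar>\<psi> x\<bar> \<le> (1::real)" for \<psi>
  proof (rule integral_dominated_convergence[where w=D])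
    show "AE x in lb01. (\<lambda>i. \<psi> x * H (r i) x) \<longlonglongrightarrow> \<psi> x * h x"
      using conv by eventually_elim (intro tendsto_intros)
    show "AE x in lb01. norm (\<psi> x * H (r i) x) \<le> D x" for i
      using HD[of "r i"]
    proof eventually_elim
      case (elim x)
      have "\<bar>\<psi> x\<bar> * \<bar>H (r i) x\<bar> \<le> 1 * D x" using p(2) elim by (intro mult_mono) auto
      then show ?case by (simp add: abs_mult)
    qed
  qed (use mult_integrable[OF p hi] mult_integrable[OF p Hi] Di in auto)
  have weak: "(\<lambda>k. LINT x|lb01. \<psi> (iter a k x)) \<longlonglongrightarrow> (LINT x|lb01. \<psi> x * h x)"
    if p: "\<psi> \<in> borel_measurable borel" "\<And>x. \<bar>\<psi> x\<bar> \<le> (1::real)" for \<psi>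
  proof -
    have eq: "(LINT x|lb01. \<psi> (iter a k x)) = (LINT x|lb01. \<psi> x * H k x)" for k
      using orb_dual[of "\<lambda>_. a" "\<lambda>_. 1" \<psi> 1 k] a0 p by (simp add: H_def)
    \<comment> \<open>The k-th image is compared with the terms of the subsequence beyond k, whose
      distance from it is at most \<open>\<rho> k\<close>; this survives in the limit.\<close>
    have bd: "\<bar>(LINT x|lb01. \<psi> x * H k x) - (LINT x|lb01. \<psi> x * h x)\<bar> \<le> \<rho> k" for k
    proof (rule LIMSEQ_le_const2[OF tendsto_rabs[OF tendsto_diff[OF tendsto_const sub[OF p]]]], intro exI allI impI)
      fix i assume i: "k \<le> i"
      have ri: "k \<le> r i" using i seq_suble[OF r(1), of i] by simp
      have "(LINT x|lb01. \<psi> x * H k x) - (LINT x|lb01. \<psi> x * H (r i) x) = (LINT x|lb01. \<psi> x * (H k x - H (r i) x))"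
        unfolding right_diff_distrib by (intro Bochner_Integration.integral_diff[symmetric] mult_integrable[OF p Hi])
      also have "\<bar>\<dots>\<bar> \<le> 1 * (LINT x|lb01. \<bar>H k x - H (r i) x\<bar>)"
        by (rule integral_bounded_mult_le) (use Hi borel_imp_lb01 p in auto)
      finally show "\<bar>(LINT x|lb01. \<psi> x * H k x) - (LINT x|lb01. \<psi> x * H (r i) x)\<bar> \<le> \<rho> k"
        using L1[of k k "r i"] ri by simp
    qed
    show ?thesis unfolding eq
      by (rule Lim_null_comparison[OF _ lim, of "\<lambda>k. (LINT x|lb01. \<psi> x * H k x) - (LINT x|lb01. \<psi> x * h x)", THEN LIM_zero_cancel])
        (use bd in auto)
  qed
  \<comment> \<open>No image has more than half of its mass in [0,d], so each is at least 1/2 at d.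
    After N more steps this spreads to a positive lower bound on (0,1] that does not depend on
    k.\<close>
  have pos: "AE x in lb01. 0 < h x"
  proof -
    obtain d where d: "0 < d" "d \<le> 1" "K0 b * d powr (1 - b) \<le> 1/2"
      using powr_small_le[of "1 - b" "1/2" "K0 b"] b by (auto simp: K0_def)
    have Hd: "1/2 \<le> H k d" for k
      using decr_spread[OF cone_decr[OF H] d(1,2), of k] cone_near_zero[OF H, of d k] d Hm[of k] by simp
    obtain N where N: "N \<ge> 1" "\<And>a f. (\<And>i. a i \<in> {0..1}) \<Longrightarrow> decr f \<Longrightarrow> f d / 3 ^ N \<le> trs a N f 1"
      using trs_lower_unif[of d] d by auto
    define c :: real where "c = 1/2 / 3 ^ N"
    have c: "0 < c" by (simp add: c_def)
    have Hc: "c \<le> H k x" if "k \<ge> N" "0 < x" "x \<le> 1" for k x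
    proof -
      have "c \<le> H (k - N) d / 3 ^ N" unfolding c_def using Hd[of "k - N"] by (intro divide_right_mono) auto
      also have "\<dots> \<le> trs (\<lambda>_. a) N (H (k - N)) 1" using N(2)[of "\<lambda>_. a" "H (k - N)"] a b cone_decr[OF H] by auto
      also have "trs (\<lambda>_. a) N (H (k - N)) = H k" using that(1) trs_const_add[of a "k - N" N "\<lambda>_. 1"] by (simp add: H_def)
      also have "H k 1 \<le> H k x" using decr_antimono[OF cone_decr[OF H], of x 1] that by simp
      finally show ?thesis .
    qed
    from conv AE_lb01_pos show ?thesis
    proof eventually_elim
      case (elim x)
      have "c \<le> h x"
      proof (rule LIMSEQ_le_const[OF elim(1)], intro exI allI impI)
        fix n assume "N \<le> n"
        then show "c \<le> H (r n) x" using elim(2) seq_suble[OF r(1), of n] by (intro Hc) auto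
      qed
      then show ?case using c by simp
    qed
  qed
  show ?thesis
    by (rule that[OF hi pos]) (rule weak, assumption+)
qed

text \<open>Uniqueness of the invariant measure requires densities in \<open>L\<^sup>1\<close>, not only monotone ones.\<close>

lemma iter_forgets:
  assumes b: "0 < b" "b < 1" and a: "a \<in> {0..b}" and ml: "memory_loss b \<rho>" and lim: "\<rho> \<longlonglongrightarrow> 0"
    and p: "\<psi> \<in> borel_measurable borel" "\<And>x. \<bar>\<psi> x\<bar> \<le> (1::real)"
    and m: "(\<lambda>k. LINT x|lb01. \<psi> (iter a k x)) \<longlonglongrightarrow> m"
    and u: "integrable lb01 (u :: real \<Rightarrow> real)"
  shows "(\<lambda>k. LINT x|lb01. \<psi> (iter a k x) * u x) \<longlonglongrightarrow> (LINT x|lb01. u x) * m"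
proof -
  \<comment> \<open>F collects the densities whose images forget their origin. It is shown to be
    linear and closed under L1 limits, so that it only has to be filled from the cone.\<close>
  define F where "F u \<longleftrightarrow> integrable lb01 u \<and> (\<lambda>k. LINT x|lb01. \<psi> (iter a k x) * u x) \<longlonglongrightarrow> (LINT x|lb01. u x) * m" for u :: "real \<Rightarrow> real"
  have pk: "(\<lambda>x. \<psi> (iter a k x)) \<in> borel_measurable borel" "\<And>x. \<bar>\<psi> (iter a k x)\<bar> \<le> 1" for k
    using p by auto
  have a0: "0 \<le> a" using a by simp
  have m1: "\<bar>m\<bar> \<le> 1"
  proof (rule LIMSEQ_le_const2[OF tendsto_rabs[OF m]], intro exI allI impI)
    fix k :: nat
    show "\<bar>LINT x|lb01. \<psi> (iter a k x)\<bar> \<le> 1"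
      using integral_bounded_mult_le[of "\<lambda>_. 1" "\<lambda>x. \<psi> (iter a k x)" 1] borel_imp_lb01[OF pk(1)] pk(2) lb01.prob_space by simp
  qed
  have F_add: "F (\<lambda>x. u x + v x)" if "F u" "F v" for u v
    unfolding F_def
  proof (intro conjI)
    have i: "integrable lb01 u" "integrable lb01 v" using that F_def by auto
    then show "integrable lb01 (\<lambda>x. u x + v x)" by simp
    have "(LINT x|lb01. \<psi> (iter a k x) * (u x + v x)) = (LINT x|lb01. \<psi> (iter a k x) * u x) + (LINT x|lb01. \<psi> (iter a k x) * v x)" for k
      unfolding distrib_left by (intro Bochner_Integration.integral_add mult_integrable[OF pk] i)
    moreover have "(LINT x|lb01. u x + v x) = (LINT x|lb01. u x) + (LINT x|lb01. v x)" using i by simp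
    ultimately show "(\<lambda>k. LINT x|lb01. \<psi> (iter a k x) * (u x + v x)) \<longlonglongrightarrow> (LINT x|lb01. u x + v x) * m"
      using that unfolding F_def by (simp only: distrib_right) (intro tendsto_add, auto)
  qed
  have F_cmult: "F (\<lambda>x. c * u x)" if "F u" for c u
    unfolding F_def
  proof (intro conjI)
    have i: "integrable lb01 u" using that F_def by auto
    then show "integrable lb01 (\<lambda>x. c * u x)" by simp
    have "(LINT x|lb01. \<psi> (iter a k x) * (c * u x)) = c * (LINT x|lb01. \<psi> (iter a k x) * u x)" for k
      by (simp only: mult.left_commute[of _ c] integral_mult_right_zero)
    moreover have "(LINT x|lb01. c * u x) * m = c * ((LINT x|lb01. u x) * m)" by simp
    ultimately show "(\<lambda>k. LINT x|lb01. \<psi> (iter a k x) * (c * u x)) \<longlonglongrightarrow> (LINT x|lb01. c * u x) * m"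
      using that unfolding F_def by (simp only:) (intro tendsto_mult_left, auto)
  qed
  have F_lim: "F u" if u: "integrable lb01 u" and s: "\<And>i. F (s i)" and l: "(\<lambda>i. LINT x|lb01. \<bar>s i x - u x\<bar>) \<longlonglongrightarrow> 0"
    for u :: "real \<Rightarrow> real" and s :: "nat \<Rightarrow> real \<Rightarrow> real"
    unfolding F_def
  proof (intro conjI u LIMSEQ_I)
    fix e :: real assume e: "0 < e"
    obtain i where i: "(LINT x|lb01. \<bar>s i x - u x\<bar>) < e / 3"
      using LIMSEQ_D[OF l, of "e/3"] e by auto
    have si: "integrable lb01 (s i)" using s F_def by blast
    have si_lim: "(\<lambda>k. LINT x|lb01. \<psi> (iter a k x) * s i x) \<longlonglongrightarrow> (LINT x|lb01. s i x) * m" using s F_def by blast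
    obtain N where N: "\<And>k. k \<ge> N \<Longrightarrow> \<bar>(LINT x|lb01. \<psi> (iter a k x) * s i x) - (LINT x|lb01. s i x) * m\<bar> < e / 3"
      using LIMSEQ_D[OF si_lim, of "e/3"] e by auto
    show "\<exists>no. \<forall>k\<ge>no. norm ((LINT x|lb01. \<psi> (iter a k x) * u x) - (LINT x|lb01. u x) * m) < e"
    proof (intro exI allI impI)
      fix k assume k: "N \<le> k"
      have d: "integrable lb01 (\<lambda>x. s i x - u x)" using si u by simp
      have "(LINT x|lb01. \<psi> (iter a k x) * s i x) - (LINT x|lb01. \<psi> (iter a k x) * u x) = (LINT x|lb01. \<psi> (iter a k x) * (s i x - u x))"
        unfolding right_diff_distrib by (intro Bochner_Integration.integral_diff[symmetric] mult_integrable[OF pk] si u)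
      also have "\<bar>\<dots>\<bar> \<le> 1 * (LINT x|lb01. \<bar>s i x - u x\<bar>)"
        by (rule integral_bounded_mult_le[OF d borel_imp_lb01[OF pk(1)] pk(2)])
      finally have 1: "\<bar>(LINT x|lb01. \<psi> (iter a k x) * s i x) - (LINT x|lb01. \<psi> (iter a k x) * u x)\<bar> < e / 3" using i by simp
      have "\<bar>(LINT x|lb01. s i x) - (LINT x|lb01. u x)\<bar> = \<bar>LINT x|lb01. s i x - u x\<bar>" using si u by simp
      also have "\<dots> \<le> (LINT x|lb01. \<bar>s i x - u x\<bar>)" using integral_norm_bound[of lb01 "\<lambda>x. s i x - u x"] by simp
      finally have "\<bar>(LINT x|lb01. s i x) - (LINT x|lb01. u x)\<bar> * \<bar>m\<bar> \<le> (LINT x|lb01. \<bar>s i x - u x\<bar>) * 1"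
        using m1 by (intro mult_mono) auto
      then have 2: "\<bar>(LINT x|lb01. s i x) * m - (LINT x|lb01. u x) * m\<bar> < e / 3"
        using i by (simp add: abs_mult[symmetric] left_diff_distrib)
      show "norm ((LINT x|lb01. \<psi> (iter a k x) * u x) - (LINT x|lb01. u x) * m) < e"
        using 1 2 N[OF k] unfolding real_norm_def by linarith
    qed
  qed
  have F_cone: "F u" if u: "decr_cone b u" for u
  proof -
    let ?m = "LINT x|lb01. u x"
    have mm: "0 \<le> ?m" "?m \<le> 1" using cone_mass[OF u] decr_nonneg[OF cone_decr[OF u]] by (auto intro: integral_lb01_nonneg)
    have bd: "\<bar>(LINT x|lb01. \<psi> (iter a k x) * u x) - ?m * (LINT x|lb01. \<psi> (iter a k x))\<bar> \<le> \<rho> k" for k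
    proof -
      have "\<bar>(LINT x|lb01. \<psi> x * trs (\<lambda>_. a) k u x) - (LINT x|lb01. \<psi> x * trs (\<lambda>_. a) k (\<lambda>_. ?m) x)\<bar> \<le> \<rho> k"
        by (rule memory_lossD[OF ml _ u]) (use a b mm lb01.prob_space cone_const[of b ?m] p in auto)
      moreover have "(LINT x|lb01. \<psi> x * trs (\<lambda>_. a) k u x) = (LINT x|lb01. \<psi> (iter a k x) * u x)"
        by (rule orb_dual) (use a0 p cone_integrable[OF u] in auto)
      moreover have "(LINT x|lb01. \<psi> x * trs (\<lambda>_. a) k (\<lambda>_. ?m) x) = (LINT x|lb01. \<psi> (iter a k x) * ?m)"
        by (rule orb_dual) (use a0 p in auto)
      ultimately show ?thesis by (simp add: mult.commute)
    qed
    have "(\<lambda>k. (LINT x|lb01. \<psi> (iter a k x) * u x) - ?m * (LINT x|lb01. \<psi> (iter a k x))) \<longlonglongrightarrow> 0"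
      by (rule Lim_null_comparison[OF _ lim]) (use bd in auto)
    from tendsto_add[OF this tendsto_mult_left[OF m, of ?m]] show ?thesis
      using cone_integrable[OF u] by (simp add: F_def)
  qed
  \<comment> \<open>Half-lines \<open>{..y}\<close> generate the Borel sets and are stable under
    intersection; on [0,1] their indicators are decreasing and at most 1, hence in the cone.\<close>
  have F_ind: "F (indicator A)" if "A \<in> sets borel" for A
  proof -
    have "Int_stable (range (\<lambda>a::real. {..a}))" by (auto simp: Int_stable_def)
    moreover have "range (\<lambda>a::real. {..a}) \<subseteq> Pow UNIV" by simp
    moreover have "A \<in> sigma_sets UNIV (range (\<lambda>a::real. {..a}))"
      using that by (subst (asm) borel_eq_atMost) auto
    ultimately show ?thesis
    proof (induct rule: sigma_sets_induct_disjoint)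
      case (basic A)
      then obtain y where A: "A = {..y}" by auto
      have "decr (indicator A)"
        unfolding decr_def
      proof (intro conjI)
        show "integrable lb01 (indicator A :: real \<Rightarrow> real)"
          by (rule bounded_integrable[of _ 1]) (auto simp: A indicator_def)
      qed (auto simp: A indicator_def)
      have c1: "decr_cone b (\<lambda>_. 1)" by (rule cone_const) (use b in auto)
      from \<open>decr (indicator A)\<close> have "decr_cone b (indicator A)"
        by (rule cone_mono[OF c1]) (simp add: indicator_def)
      then show ?case by (rule F_cone)
    next
      case empty
      then show ?case by (simp add: F_def)
    next
      case (compl A)
      have "F (\<lambda>x. 1 + (-1) * indicator A x)"
        by (intro F_add F_cmult compl F_cone cone_const) (use b in auto)
      moreover have "indicator (UNIV - A) = (\<lambda>x. 1 + (-1) * indicator A x :: real)"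
        by (auto simp: indicator_def)
      ultimately show ?case by simp
    next
      case (union A)
      have Ab: "A i \<in> sets borel" for i using union(2) by (subst borel_eq_atMost) auto
      define s where "s n x = (\<Sum>i<n. indicator (A i) x :: real)" for n :: nat and x :: real
      have s: "F (s n)" for n
      proof (induction n)
        case 0 then show ?case by (simp add: s_def F_def)
      next
        case (Suc n) then show ?case using F_add[OF Suc union(3)[of n]] by (simp add: s_def)
      qed
      have s_eq: "s n = indicator (\<Union>i<n. A i)" for n
        using union(1) by (auto simp: s_def fun_eq_iff indicator_UN_disjoint disjoint_family_on_def)
      let ?U = "indicator (\<Union>i. A i) :: real \<Rightarrow> real"
      have U: "integrable lb01 ?U"
        by (rule bounded_integrable[of _ 1]) (use Ab in \<open>auto simp: indicator_def intro!: borel_measurable_indicator\<close>)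
      have "(\<lambda>n. s n x) \<longlonglongrightarrow> ?U x" for x
        unfolding s_eq by (rule LIMSEQ_indicator_UN)
      then have l: "(\<lambda>n. \<bar>s n x - ?U x\<bar>) \<longlonglongrightarrow> 0" for x
        by (intro tendsto_rabs_zero LIM_zero)
      have "(\<lambda>n. LINT x|lb01. \<bar>s n x - ?U x\<bar>) \<longlonglongrightarrow> (LINT x|lb01. 0)"
      proof (rule integral_dominated_convergence[where w="\<lambda>_. 1"])
        show "(\<lambda>x. \<bar>s n x - ?U x\<bar>) \<in> borel_measurable lb01" for n using s[of n] U by (auto simp: F_def)
        show "AE x in lb01. (\<lambda>n. \<bar>s n x - ?U x\<bar>) \<longlonglongrightarrow> 0" using l by (intro AE_I2)
        show "AE x in lb01. norm \<bar>s n x - ?U x\<bar> \<le> 1" for n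
          unfolding s_eq by (intro AE_I2) (simp add: indicator_def)
      qed simp_all
      then have "(\<lambda>n. LINT x|lb01. \<bar>s n x - ?U x\<bar>) \<longlonglongrightarrow> 0" by simp
      with U s show ?case by (rule F_lim)
    qed
  qed
  from u have "F u"
  proof (induct rule: integrable_induct)
    case (base A c)
    then obtain B where B: "B \<in> sets borel" "A = B \<inter> {0..1}" by (auto simp: sets_restrict_space)
    have "F (\<lambda>x. c * indicator A x)" using B by (intro F_cmult F_ind) auto
    then show ?case by (simp add: mult.commute)
  next
    case (add f g) then show ?case by (intro F_add)
  next
    case (lim f s)
    have "(\<lambda>n. LINT x|lb01. \<bar>s n x - f x\<bar>) \<longlonglongrightarrow> (LINT x|lb01. 0)"
    proof (rule integral_dominated_convergence[where w="\<lambda>x. 3 * \<bar>f x\<bar>"])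
      show "AE x in lb01. (\<lambda>n. \<bar>s n x - f x\<bar>) \<longlonglongrightarrow> 0"
      proof (rule AE_I2)
        fix x assume "x \<in> space lb01"
        then have "(\<lambda>n. s n x) \<longlonglongrightarrow> f x" by (rule lim(3))
        then show "(\<lambda>n. \<bar>s n x - f x\<bar>) \<longlonglongrightarrow> 0" by (intro tendsto_rabs_zero LIM_zero)
      qed
      show "AE x in lb01. norm \<bar>s n x - f x\<bar> \<le> 3 * \<bar>f x\<bar>" for n
      proof (rule AE_I2)
        fix x assume "x \<in> space lb01"
        then have "\<bar>s n x\<bar> \<le> 2 * \<bar>f x\<bar>" using lim(4)[of x n] by simp
        then show "norm \<bar>s n x - f x\<bar> \<le> 3 * \<bar>f x\<bar>" by simp
      qed
    qed (use lim in auto)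
    then have "(\<lambda>n. LINT x|lb01. \<bar>s n x - f x\<bar>) \<longlonglongrightarrow> 0" by simp
    with lim(5) lim(2) show ?case by (rule F_lim)
  qed
  then show ?thesis by (simp add: F_def)
qed

lemma integral_SRB_density:
  fixes h \<psi> :: "real \<Rightarrow> real"
  assumes h: "integrable lb01 h" "AE x in lb01. 0 < h x" and p: "\<psi> \<in> borel_measurable borel"
  shows "(LINT x|density lb01 (\<lambda>x. ennreal (h x)). \<psi> x) = (LINT x|lb01. \<psi> x * h x :: real)"
proof -
  have "AE x in lb01. 0 \<le> h x" using h(2) by eventually_elim simp
  then have "(LINT x|density lb01 (\<lambda>x. ennreal (h x)). \<psi> x) = (LINT x|lb01. h x * \<psi> x)"
    using h(1) borel_imp_lb01[OF p] by (subst integral_real_density) auto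
  then show ?thesis by (simp add: mult.commute)
qed

text \<open>Moves invariance from the trace sigma-algebra to integrals of Borel indicators on the
  line, the form in which weak limits and iterates are available.\<close>

lemma PM_map_invariant_iff:
  assumes a: "0 \<le> a" and sets: "sets \<mu> = sets lb01" and fin: "finite_measure \<mu>"
  shows "distr \<mu> \<mu> (PM_map a) = \<mu> \<longleftrightarrow> (\<forall>B\<in>sets borel. (LINT x|\<mu>. indicator B (PM_map a x) :: real) = (LINT x|\<mu>. indicator B x))"
proof -
  interpret finite_measure \<mu> by fact
  have sp: "space \<mu> = {0..1}" using sets_eq_imp_space_eq[OF sets] by simp
  have T: "PM_map a \<in> measurable \<mu> \<mu>"
    using PM_map_measurable_lb01[OF a] by (simp add: measurable_cong_sets[OF sets sets])
  have meas: "measure \<mu> (PM_map a -` B \<inter> {0..1}) = (LINT x|\<mu>. indicator B (PM_map a x))"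
    "measure \<mu> (B \<inter> {0..1}) = (LINT x|\<mu>. indicator B x)" for B
  proof -
    have "(LINT x|\<mu>. indicator B (PM_map a x) :: real) = (LINT x|\<mu>. indicator (PM_map a -` B) x)"
      by (simp add: indicator_vimage[symmetric])
    then show "measure \<mu> (PM_map a -` B \<inter> {0..1}) = (LINT x|\<mu>. indicator B (PM_map a x))" using sp by simp
    show "measure \<mu> (B \<inter> {0..1}) = (LINT x|\<mu>. indicator B x)" using sp by simp
  qed
  have S: "B \<inter> {0..1} \<in> sets \<mu>" if "B \<in> sets borel" for B
    using that sets by (auto simp: sets_restrict_space)
  have E: "emeasure (distr \<mu> \<mu> (PM_map a)) (B \<inter> {0..1}) = ennreal (LINT x|\<mu>. indicator B (PM_map a x))"
     "emeasure \<mu> (B \<inter> {0..1}) = ennreal (LINT x|\<mu>. indicator B x)" if "B \<in> sets borel" for B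
  proof -
    have "PM_map a -` (B \<inter> {0..1}) \<inter> {0..1} = PM_map a -` B \<inter> {0..1}" using PM_map_in[OF a] by auto
    then show "emeasure (distr \<mu> \<mu> (PM_map a)) (B \<inter> {0..1}) = ennreal (LINT x|\<mu>. indicator B (PM_map a x))"
      using emeasure_distr[OF T S[OF that]] sp meas(1) by (simp add: emeasure_eq_measure)
    show "emeasure \<mu> (B \<inter> {0..1}) = ennreal (LINT x|\<mu>. indicator B x)"
      using meas(2) by (simp add: emeasure_eq_measure)
  qed
  show ?thesis
  proof
    assume inv: "distr \<mu> \<mu> (PM_map a) = \<mu>"
    show "\<forall>B\<in>sets borel. (LINT x|\<mu>. indicator B (PM_map a x) :: real) = (LINT x|\<mu>. indicator B x)"
    proof
      fix B :: "real set" assume B: "B \<in> sets borel"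
      have "ennreal (LINT x|\<mu>. indicator B (PM_map a x)) = ennreal (LINT x|\<mu>. indicator B x)"
        using E[OF B] inv by simp
      then show "(LINT x|\<mu>. indicator B (PM_map a x) :: real) = (LINT x|\<mu>. indicator B x)"
        by (simp add: integral_nonneg_AE)
    qed
  next
    assume *: "\<forall>B\<in>sets borel. (LINT x|\<mu>. indicator B (PM_map a x) :: real) = (LINT x|\<mu>. indicator B x)"
    show "distr \<mu> \<mu> (PM_map a) = \<mu>"
    proof (rule measure_eqI)
      fix A assume "A \<in> sets (distr \<mu> \<mu> (PM_map a))"
      then obtain B where "B \<in> sets borel" "A = B \<inter> {0..1}" using sets by (auto simp: sets_restrict_space)
      then show "emeasure (distr \<mu> \<mu> (PM_map a)) A = emeasure \<mu> A" using E * by simp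
    qed simp
  qed
qed

section \<open>Existence and uniqueness of the SRB measure\<close>

lemma indicator_abs_le_1: "\<bar>indicator B x :: real\<bar> \<le> 1"
  by (simp add: indicator_def)

text \<open>A limit is unchanged when the sequence is shifted by one map, which gives invariance.
  Convergence holds against bounded Borel functions, so the discontinuity of the map is harmless;
  positivity of the density gives equivalence with Lebesgue measure.\<close>

lemma SRB_exists:
  assumes b: "0 < b" "b < 1" and a: "a \<in> {0..b}"
  obtains \<mu> where "is_SRB a \<mu>"
    "\<And>\<psi> :: real \<Rightarrow> real. \<psi> \<in> borel_measurable borel \<Longrightarrow> (\<And>x. \<bar>\<psi> x\<bar> \<le> 1) \<Longrightarrow> (\<lambda>k. LINT x|lb01. \<psi> (iter a k x)) \<longlonglongrightarrow> (LINT x|\<mu>. \<psi> x)"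
proof -
  obtain \<rho> where ml: "memory_loss b \<rho>" "\<rho> \<longlonglongrightarrow> 0" using memory_loss_tendsto[OF b] by blast
  obtain h where h: "integrable lb01 h" "AE x in lb01. 0 < h x" and
    w: "\<And>\<psi> :: real \<Rightarrow> real. \<psi> \<in> borel_measurable borel \<Longrightarrow> (\<And>x. \<bar>\<psi> x\<bar> \<le> 1) \<Longrightarrow> (\<lambda>k. LINT x|lb01. \<psi> (iter a k x)) \<longlonglongrightarrow> (LINT x|lb01. \<psi> x * h x)"
    by (rule invariant_density[OF b a ml]) blast
  have a0: "0 \<le> a" using a by simp
  define \<mu> where "\<mu> = density lb01 (\<lambda>x. ennreal (h x))"
  have W: "(\<lambda>k. LINT x|lb01. \<psi> (iter a k x)) \<longlonglongrightarrow> (LINT x|\<mu>. \<psi> x)" if "\<psi> \<in> borel_measurable borel" "\<And>x. \<bar>\<psi> x\<bar> \<le> 1" for \<psi> :: "real \<Rightarrow> real"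
    unfolding \<mu>_def integral_SRB_density[OF h that(1)] by (rule w[OF that])
  have one: "(LINT x|lb01. h x) = 1"
    using LIMSEQ_unique[OF w[of "\<lambda>_. 1"], of 1] lb01.prob_space by simp
  have hm [measurable]: "h \<in> borel_measurable lb01" using h(1) by simp
  have sets: "sets \<mu> = sets lb01" by (simp add: \<mu>_def)
  have prob: "prob_space \<mu>"
  proof (rule prob_spaceI)
    have "emeasure \<mu> (space \<mu>) = (\<integral>\<^sup>+x. ennreal (h x) \<partial>lb01)"
      unfolding \<mu>_def using sets.top[of lb01]
      by (subst emeasure_density) (auto intro!: nn_integral_cong)
    also have "\<dots> = ennreal (LINT x|lb01. h x)"
      by (rule nn_integral_eq_integral[OF h(1)]) (use h(2) in \<open>eventually_elim; simp\<close>)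
    finally show "emeasure \<mu> (space \<mu>) = 1" using one by simp
  qed
  interpret \<mu>: prob_space \<mu> by (rule prob)
  have "is_SRB a \<mu>"
    unfolding is_SRB_def
  proof (intro conjI prob)
    show "sets \<mu> = sets (restrict_space borel {0..1})" by (simp add: sets sets_lb01)
    show "distr \<mu> \<mu> (PM_map a) = \<mu>"
      unfolding PM_map_invariant_iff[OF a0 sets \<mu>.finite_measure_axioms]
    proof
      fix B :: "real set" assume B: "B \<in> sets borel"
      have "(\<lambda>k. LINT x|lb01. indicator B (PM_map a (iter a k x))) \<longlonglongrightarrow> (LINT x|\<mu>. indicator B (PM_map a x) :: real)"
        using B by (intro W indicator_abs_le_1) auto
      moreover have "(\<lambda>k. LINT x|lb01. indicator B (iter a (Suc k) x)) \<longlonglongrightarrow> (LINT x|\<mu>. indicator B x :: real)"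
        using B by (intro LIMSEQ_Suc[of "\<lambda>k. LINT x|lb01. indicator B (iter a k x)"] W indicator_abs_le_1) auto
      ultimately show "(LINT x|\<mu>. indicator B (PM_map a x) :: real) = (LINT x|\<mu>. indicator B x)"
        by (simp add: LIMSEQ_unique)
    qed
    show "absolutely_continuous lb01 \<mu>" unfolding \<mu>_def by (rule absolutely_continuousI_density) simp
    show "absolutely_continuous \<mu> lb01"
      unfolding absolutely_continuous_def
    proof
      fix A assume A: "A \<in> null_sets \<mu>"
      then have "A \<in> sets lb01" "AE x in lb01. x \<in> A \<longrightarrow> ennreal (h x) = 0"
        using null_sets_density_iff[of "\<lambda>x. ennreal (h x)" lb01 A] by (auto simp: \<mu>_def)
      with h(2) have "AE x in lb01. x \<notin> A"
        by (auto elim!: eventually_elim2 simp: ennreal_eq_0_iff)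
      then show "A \<in> null_sets lb01" using \<open>A \<in> sets lb01\<close> AE_iff_null_sets by blast
    qed
  qed
  then show ?thesis using W by (rule that)
qed

text \<open>By Radon-Nikodym N has a density. Its integrals along the iterates are constant by
  invariance, but they converge to those of the limit measure because the iterates forget an
  arbitrary L1 density.\<close>

lemma SRB_unique:
  assumes b: "0 < b" "b < 1" and a: "a \<in> {0..b}" and N: "is_SRB a N"
    and w: "\<And>\<psi> :: real \<Rightarrow> real. \<psi> \<in> borel_measurable borel \<Longrightarrow> (\<And>x. \<bar>\<psi> x\<bar> \<le> 1) \<Longrightarrow> (\<lambda>k. LINT x|lb01. \<psi> (iter a k x)) \<longlonglongrightarrow> (LINT x|\<mu>. \<psi> x)"
    and B: "B \<in> sets borel"
  shows "(LINT x|N. indicator B x :: real) = (LINT x|\<mu>. indicator B x)"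
proof -
  obtain \<rho> where ml: "memory_loss b \<rho>" "\<rho> \<longlonglongrightarrow> 0" using memory_loss_tendsto[OF b] by blast
  have a0: "0 \<le> a" using a by simp
  have sets: "sets N = sets lb01" and pN: "prob_space N" and inv: "distr N N (PM_map a) = N"
    and ac: "absolutely_continuous lb01 N" using N by (auto simp: is_SRB_def sets_lb01)
  interpret N: prob_space N by (rule pN)
  obtain D where D: "D \<in> borel_measurable lb01" "AE x in lb01. RN_deriv lb01 N x = ennreal (D x)" "\<And>x. 0 \<le> D x"
    using lb01.real_RN_deriv[OF N.finite_measure_axioms ac sets] by metis
  have "N = density lb01 (RN_deriv lb01 N)"
    using lb01.density_RN_deriv[OF ac sets] by simp
  also have "\<dots> = density lb01 (\<lambda>x. ennreal (D x))"
    using D by (intro density_cong) auto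
  finally have ND: "N = density lb01 (\<lambda>x. ennreal (D x))" .
  have Nint: "(LINT x|N. \<psi> x) = (LINT x|lb01. \<psi> x * D x)" if "\<psi> \<in> borel_measurable borel" for \<psi> :: "real \<Rightarrow> real"
    unfolding ND using D(1,3) borel_imp_lb01[OF that] by (subst integral_real_density) (auto simp: mult.commute)
  have one: "(LINT x|lb01. D x) = 1" using Nint[of "\<lambda>_. 1"] N.prob_space by simp
  \<comment> \<open>The integral of a nonintegrable function is 0 by default; here it is 1.\<close>
  then have Di: "integrable lb01 D" using not_integrable_integral_eq by fastforce
  have step: "(LINT x|N. indicator B (iter a k x) :: real) = (LINT x|N. indicator B x)" for k
  proof (induction k)
    case (Suc k)
    have "(LINT x|N. indicator B (iter a (Suc k) x) :: real) = (LINT x|N. indicator (iter a k -` B) (PM_map a x))"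
    proof -
      have "iter a (Suc k) x = iter a k (PM_map a x)" for x using orb_add[of "\<lambda>_. a" 1 k x] by simp
      then show ?thesis by (simp add: indicator_def del: orb.simps)
    qed
    also have "\<dots> = (LINT x|N. indicator (iter a k -` B) x)"
      using inv B measurable_sets[OF orb_measurable B, of "\<lambda>_. a" k] unfolding PM_map_invariant_iff[OF a0 sets N.finite_measure_axioms] by simp
    also have "\<dots> = (LINT x|N. indicator B (iter a k x))" by (simp add: indicator_def)
    finally show ?case using Suc by simp
  qed simp
  have "(\<lambda>k. LINT x|lb01. indicator B (iter a k x) * D x) \<longlonglongrightarrow> (LINT x|lb01. D x) * (LINT x|\<mu>. indicator B x)"
    using B by (intro iter_forgets[OF b a ml _ _ w Di] indicator_abs_le_1) auto
  moreover have "(LINT x|lb01. indicator B (iter a k x) * D x) = (LINT x|N. indicator B x)" for k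
    using Nint[of "\<lambda>x. indicator B (iter a k x)"] B step[of k] by simp
  ultimately show ?thesis using one by (simp add: LIMSEQ_const_iff)
qed

lemma measure_eqI_lb01:
  assumes s: "sets M = sets lb01" "sets N = sets lb01" and f: "finite_measure M" "finite_measure N"
    and eq: "\<And>B. B \<in> sets borel \<Longrightarrow> (LINT x|M. indicator B x :: real) = (LINT x|N. indicator B x)"
  shows "M = N"
proof (rule measure_eqI)
  show "sets M = sets N" using s by simp
  fix A assume A: "A \<in> sets M"
  then obtain B where B: "B \<in> sets borel" "A = B \<inter> {0..1}" using s by (auto simp: sets_restrict_space)
  have sp: "space M = {0..1}" "space N = {0..1}" using s[THEN sets_eq_imp_space_eq] by auto
  have "measure M A = measure N A" using eq[OF B(1)] sp B(2) by simp
  then show "emeasure M A = emeasure N A"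
    using f by (simp add: finite_measure.emeasure_eq_measure)
qed

text \<open>Resolves the definite description in \<open>SRB\<close>; afterwards only these two facts
  about the measure are used.\<close>

lemma SRB_props:
  assumes b: "0 < b" "b < 1" and a: "a \<in> {0..b}"
  shows is_SRB_SRB: "is_SRB a (SRB a)"
    and SRB_weak: "\<And>\<psi> :: real \<Rightarrow> real. \<psi> \<in> borel_measurable borel \<Longrightarrow> (\<And>x. \<bar>\<psi> x\<bar> \<le> 1) \<Longrightarrow> (\<lambda>k. LINT x|lb01. \<psi> (iter a k x)) \<longlonglongrightarrow> (LINT x|SRB a. \<psi> x)"
proof -
  obtain \<mu> where \<mu>: "is_SRB a \<mu>" "\<And>\<psi> :: real \<Rightarrow> real. \<psi> \<in> borel_measurable borel \<Longrightarrow> (\<And>x. \<bar>\<psi> x\<bar> \<le> 1) \<Longrightarrow> (\<lambda>k. LINT x|lb01. \<psi> (iter a k x)) \<longlonglongrightarrow> (LINT x|\<mu>. \<psi> x)"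
    by (rule SRB_exists[OF b a]) blast
  have "SRB a = \<mu>" unfolding SRB_def
  proof (rule the_equality)
    fix N assume N: "is_SRB a N"
    show "N = \<mu>"
      by (rule measure_eqI_lb01) (use N \<mu>(1) SRB_unique[OF b a N \<mu>(2)] in \<open>auto simp: is_SRB_def sets_lb01 intro: prob_space.finite_measure\<close>)
  qed fact
  with \<mu> show "is_SRB a (SRB a)" "\<And>\<psi> :: real \<Rightarrow> real. \<psi> \<in> borel_measurable borel \<Longrightarrow> (\<And>x. \<bar>\<psi> x\<bar> \<le> 1) \<Longrightarrow> (\<lambda>k. LINT x|lb01. \<psi> (iter a k x)) \<longlonglongrightarrow> (LINT x|SRB a. \<psi> x)"
    by auto
qed

text \<open>The law of the orbit has a density at every time, so it charges no point. Applied to 0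
  and 1/2, where continuity in the parameter and the point could fail.\<close>

lemma AE_iter_neq:
  assumes a: "0 \<le> a" shows "AE x in lb01. iter a k x \<noteq> c"
proof -
  have "(LINT x|lb01. indicator {c} x * trs (\<lambda>_. a) k (\<lambda>_. 1) x) = (LINT x|lb01. indicator {c} (iter a k x) * 1)"
    by (rule orb_dual) (use a indicator_abs_le_1 in auto)
  moreover have "(LINT x|lb01. indicator {c} x * trs (\<lambda>_. a) k (\<lambda>_. 1) x) = 0"
  proof (rule integral_eq_zero_AE)
    have "AE x in lborel. x \<noteq> c" by (rule AE_lborel_singleton)
    then have "AE x in lborel. x \<in> {0..1} \<longrightarrow> x \<noteq> c" by eventually_elim simp
    then have "AE x in lb01. x \<noteq> c" by (simp add: AE_restrict_space_iff)
    then show "AE x in lb01. indicator {c} x * trs (\<lambda>_. a) k (\<lambda>_. 1) x = 0" by eventually_elim simp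
  qed
  ultimately have "(LINT x|lb01. indicator {c} (iter a k x) :: real) = 0" by simp
  moreover have "integrable lb01 (\<lambda>x. indicator {c} (iter a k x) :: real)"
    by (rule bounded_integrable[of _ 1]) (auto simp: indicator_abs_le_1)
  ultimately have "AE x in lb01. (indicator {c} (iter a k x) :: real) = 0"
    by (subst (asm) integral_nonneg_eq_0_iff_AE) auto
  then show ?thesis by eventually_elim (simp add: indicator_def split: if_splits)
qed

text \<open>Joint continuity in parameter and point. The value 1/2 is excluded because the map jumps
  there, and 0 because \<open>powr\<close> is not jointly continuous at base 0 and exponent
  0.\<close>

lemma PM_map_tendsto:
  assumes y: "(y \<longlongrightarrow> l) F" "0 < l" "l \<noteq> 1/2" and a: "(a \<longlongrightarrow> g) F"
  shows "((\<lambda>n. PM_map (a n) (y n)) \<longlongrightarrow> PM_map g l) F"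
proof (cases "l < 1/2")
  case True
  have ev: "eventually (\<lambda>n. y n < 1/2) F" using order_tendstoD(2)[OF y(1) True] .
  have "((\<lambda>n. y n * (1 + (2 * y n) powr a n)) \<longlongrightarrow> l * (1 + (2 * l) powr g)) F"
    using y a by (intro tendsto_intros) auto
  then have "((\<lambda>n. left_branch (a n) (y n)) \<longlongrightarrow> PM_map g l) F"
    using True by (simp add: PM_map_left left_branch_def)
  then show ?thesis
    by (rule Lim_transform_eventually) (use ev in \<open>eventually_elim; simp add: PM_map_left\<close>)
next
  case False
  then have ev: "eventually (\<lambda>n. 1/2 < y n) F" using order_tendstoD(1)[OF y(1), of "1/2"] y(3) by simp
  have "((\<lambda>n. 2 * y n - 1) \<longlongrightarrow> PM_map g l) F"
    using y False by (auto simp: PM_map_right intro!: tendsto_intros)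
  then show ?thesis
    by (rule Lim_transform_eventually) (use ev in \<open>eventually_elim; simp add: PM_map_right\<close>)
qed

lemma orb_tendsto:
  assumes a: "\<And>i. i < L \<Longrightarrow> (\<lambda>n. a n i) \<longlonglongrightarrow> g" and x: "\<And>j. j < L \<Longrightarrow> 0 < iter g j x \<and> iter g j x \<noteq> 1/2"
  shows "(\<lambda>n. orb (a n) L x) \<longlonglongrightarrow> iter g L x"
  using assms by (induction L) (auto intro!: PM_map_tendsto)

text \<open>The parameters are counted backwards from the time \<open>k n\<close>. The density at
  time \<open>k n - L\<close> may be replaced by 1 at the cost \<open>\<rho> L\<close>; for fixed L
  the orbit of L maps converges almost everywhere; and L iterates of the limit map nearly reach the
  SRB measure.\<close>

proposition orb_mean_tendsto:
  fixes \<psi> :: "real \<Rightarrow> real"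
  assumes b: "0 < b" "b < 1" and a: "\<And>n i. a n i \<in> {0..b}" and g: "g \<in> {0..b}"
    and k: "filterlim k at_top sequentially" and lim: "\<And>j. (\<lambda>n. a n (k n - Suc j)) \<longlonglongrightarrow> g"
    and p: "\<psi> \<in> borel_measurable borel" "\<And>x. \<bar>\<psi> x\<bar> \<le> 1" "continuous_on {0..1} \<psi>"
  shows "(\<lambda>n. LINT x|lb01. \<psi> (orb (a n) (k n) x)) \<longlonglongrightarrow> (LINT x|SRB g. \<psi> x)"
proof (rule LIMSEQ_I)
  fix e :: real assume e: "0 < e"
  obtain \<rho> where ml: "memory_loss b \<rho>" "\<rho> \<longlonglongrightarrow> 0" using memory_loss_tendsto[OF b] by blast
  have a0: "\<And>n i. 0 \<le> a n i" and g0: "0 \<le> g" using a g by auto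
  obtain L1 where L1: "\<And>L. L \<ge> L1 \<Longrightarrow> norm (\<rho> L - 0) < e / 3" using LIMSEQ_D[OF ml(2), of "e/3"] e by auto
  obtain L2 where L2: "\<And>L. L \<ge> L2 \<Longrightarrow> norm ((LINT x|lb01. \<psi> (iter g L x)) - (LINT x|SRB g. \<psi> x)) < e / 3"
    using LIMSEQ_D[OF SRB_weak[OF b g p(1,2)], of "e/3"] e by auto
  define L where "L = max L1 L2"
  \<comment> \<open>The last L parameters before time \<open>k n\<close>, indexed from 0.\<close>
  define a' where "a' n i = a n (k n - L + i)" for n i
  have a'lim: "(\<lambda>n. a' n i) \<longlonglongrightarrow> g" if i: "i < L" for i
  proof (rule Lim_transform_eventually[OF lim[of "L - Suc i"]])
    have "eventually (\<lambda>n. L \<le> k n) sequentially" using k by (simp add: filterlim_at_top)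
    then show "eventually (\<lambda>n. a n (k n - Suc (L - Suc i)) = a' n i) sequentially"
      by eventually_elim (use i in \<open>simp add: a'_def Suc_diff_Suc\<close>)
  qed
  have 1: "\<bar>(LINT x|lb01. \<psi> (orb (a n) (k n) x)) - (LINT x|lb01. \<psi> (orb (a' n) L x))\<bar> \<le> \<rho> L" if kn: "L \<le> k n" for n
  proof -
    define h where "h = trs (a n) (k n - L) (\<lambda>_. 1)"
    have h: "decr_cone b h" "(LINT x|lb01. h x) = 1" unfolding h_def
      using cone_trs[where a="a n", OF a b(2) cone_const[of b 1]] b trs_integrable(2)[where a="a n" and f="\<lambda>_. 1"] a0 lb01.prob_space by auto
    have "\<bar>(LINT x|lb01. \<psi> x * trs (a' n) L h x) - (LINT x|lb01. \<psi> x * trs (a' n) L (\<lambda>_. 1) x)\<bar> \<le> \<rho> L"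
      by (rule memory_lossD[OF ml(1) _ h(1)]) (use a a'_def b h p lb01.prob_space cone_const[of b 1] in auto)
    moreover have "(LINT x|lb01. \<psi> x * trs (a' n) L (\<lambda>_. 1) x) = (LINT x|lb01. \<psi> (orb (a' n) L x) * 1)"
      by (rule orb_dual) (use a0 p a'_def in auto)
    moreover have "trs (a' n) L h = trs (a n) (k n) (\<lambda>_. 1)"
      using trs_add[of "a n" "k n - L" L "\<lambda>_. 1"] kn by (simp add: h_def a'_def[abs_def])
    moreover have "(LINT x|lb01. \<psi> x * trs (a n) (k n) (\<lambda>_. 1) x) = (LINT x|lb01. \<psi> (orb (a n) (k n) x) * 1)"
      by (rule orb_dual) (use a0 p in auto)
    ultimately show ?thesis by simp
  qed
  have 2: "(\<lambda>n. LINT x|lb01. \<psi> (orb (a' n) L x)) \<longlonglongrightarrow> (LINT x|lb01. \<psi> (iter g L x))"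
  proof (rule integral_dominated_convergence[where w="\<lambda>_. 1"])
    have "AE x in lb01. \<forall>j. iter g j x \<noteq> 0" "AE x in lb01. \<forall>j. iter g j x \<noteq> 1/2"
      unfolding AE_all_countable by (intro allI AE_iter_neq[OF g0])+
    then show "AE x in lb01. (\<lambda>n. \<psi> (orb (a' n) L x)) \<longlonglongrightarrow> \<psi> (iter g L x)"
      using AE_space
    proof eventually_elim
      case (elim x)
      then have x: "x \<in> {0..1}" by simp
      have i: "iter g j x \<in> {0..1}" for j using orb_in[of "\<lambda>_. g" x j] g0 x by simp
      have o: "orb (a' n) L x \<in> {0..1}" for n using orb_in[of "a' n" x L] a0 x by (simp add: a'_def)
      have "(\<lambda>n. orb (a' n) L x) \<longlonglongrightarrow> iter g L x"
        using elim i by (intro orb_tendsto a'lim) (auto simp: less_le)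
      then show ?case
        using p(3) i o by (intro continuous_on_tendsto_compose[OF p(3)]) auto
    qed
  qed (use p in \<open>auto intro!: borel_imp_lb01\<close>)
  obtain N1 where N1: "\<And>n. n \<ge> N1 \<Longrightarrow> norm ((LINT x|lb01. \<psi> (orb (a' n) L x)) - (LINT x|lb01. \<psi> (iter g L x))) < e / 3"
    using LIMSEQ_D[OF 2, of "e/3"] e by auto
  obtain N2 where N2: "\<And>n. n \<ge> N2 \<Longrightarrow> L \<le> k n"
    using k by (auto simp: filterlim_at_top eventually_sequentially)
  show "\<exists>no. \<forall>n\<ge>no. norm ((LINT x|lb01. \<psi> (orb (a n) (k n) x)) - (LINT x|SRB g. \<psi> x)) < e"
  proof (intro exI[of _ "max N1 N2"] allI impI)
    fix n assume n: "max N1 N2 \<le> n"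
    have "\<rho> L < e / 3" using L1[of L] by (simp add: L_def)
    then show "norm ((LINT x|lb01. \<psi> (orb (a n) (k n) x)) - (LINT x|SRB g. \<psi> x)) < e"
      using 1[OF N2[of n]] N1[of n] L2[of L] n unfolding L_def real_norm_def by linarith
  qed
qed

section \<open>Orbits of the array\<close>

text \<open>The time up to t that the step function spends at index k; it turns the time integrals
  into finite sums.\<close>

definition weight :: "nat \<Rightarrow> real \<Rightarrow> nat \<Rightarrow> real" where
  "weight n t k = measure lebesgue ({0..t} \<inter> {s. nat \<lfloor>real n * s\<rfloor> = k})"

lemma step_sets [measurable]: "{0..t} \<inter> {s. nat \<lfloor>real n * s\<rfloor> = k} \<in> sets borel"
proof -
  have "(\<lambda>s. nat \<lfloor>real n * s\<rfloor>) \<in> borel \<rightarrow>\<^sub>M count_space UNIV" by measurable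
  then have "(\<lambda>s. nat \<lfloor>real n * s\<rfloor>) -` {k} \<inter> space borel \<in> sets borel" by (rule measurable_sets) simp
  moreover have "{s. nat \<lfloor>real n * s\<rfloor> = k} = (\<lambda>s. nat \<lfloor>real n * s\<rfloor>) -` {k} \<inter> space borel" by auto
  ultimately show ?thesis by (metis atLeastAtMost_borel sets.Int)
qed

lemma weight_bounds:
  assumes "n \<ge> 1" shows "0 \<le> weight n t k" "weight n t k \<le> 1 / real n"
proof -
  show "0 \<le> weight n t k" by (simp add: weight_def)
  have "{0..t} \<inter> {s. nat \<lfloor>real n * s\<rfloor> = k} \<subseteq> {real k / n..(real k + 1) / n}"
  proof
    fix s assume "s \<in> {0..t} \<inter> {s. nat \<lfloor>real n * s\<rfloor> = k}"
    then have "0 \<le> s" "nat \<lfloor>real n * s\<rfloor> = k" by auto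
    then have "real k \<le> real n * s" "real n * s < real k + 1"
      using floor_correct[of "real n * s"] by (auto simp: of_nat_nat)
    then show "s \<in> {real k / n..(real k + 1) / n}" using assms by (auto simp: field_simps)
  qed
  then have "weight n t k \<le> measure lebesgue {real k / n..(real k + 1) / n}"
    unfolding weight_def using step_sets by (intro measure_mono_fmeasurable) auto
  also have "\<dots> = 1 / n" using assms by (simp add: divide_right_mono diff_divide_distrib[symmetric])
  finally show "weight n t k \<le> 1 / real n" .
qed

lemma floor_index_le: "0 \<le> s \<Longrightarrow> s \<le> 1 \<Longrightarrow> nat \<lfloor>real n * s\<rfloor> \<le> n"
proof -
  assume s: "0 \<le> s" "s \<le> 1"
  then have "real n * s \<le> real n" by (simp add: mult_left_le)
  then show ?thesis by (simp add: nat_le_iff floor_le_iff)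
qed

text \<open>The index n belongs to the sum because s = 1 is a possible time. For n \<ge> 1 it is the
  only such time, so the weight of this index is 0.\<close>

lemma step_integral:
  fixes y :: "nat \<Rightarrow> real"
  assumes t: "0 \<le> t" "t \<le> 1"
  shows "set_integrable lebesgue {0..t} (\<lambda>s. y (nat \<lfloor>real n * s\<rfloor>))"
    "(LINT s:{0..t}|lebesgue. y (nat \<lfloor>real n * s\<rfloor>)) = (\<Sum>k\<le>n. weight n t k * y k)"
proof -
  let ?A = "\<lambda>k. {0..t} \<inter> {s. nat \<lfloor>real n * s\<rfloor> = k}"
  have eq: "indicator {0..t} s *\<^sub>R y (nat \<lfloor>real n * s\<rfloor>) = (\<Sum>k\<le>n. indicator (?A k) s * y k)" for s
  proof (cases "s \<in> {0..t}")
    case True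
    then have le: "nat \<lfloor>real n * s\<rfloor> \<le> n" using t by (intro floor_index_le) auto
    have "(\<Sum>k\<le>n. indicator (?A k) s * y k) = (\<Sum>k\<le>n. if nat \<lfloor>real n * s\<rfloor> = k then y k else 0)"
      using True by (intro sum.cong) (auto simp: indicator_def)
    also have "\<dots> = y (nat \<lfloor>real n * s\<rfloor>)" using le by (simp add: sum.delta')
    finally show ?thesis using True by simp
  next
    case False
    then have "indicator (?A k) s = (0::real)" for k by (auto simp: indicator_def)
    then show ?thesis using False by simp
  qed
  have fin: "emeasure lebesgue (?A k) < \<infinity>" for k
  proof -
    have "emeasure lebesgue (?A k) \<le> emeasure lebesgue {0..t}"
      by (rule emeasure_mono) auto
    also have "\<dots> < \<infinity>" using t by simp
    finally show ?thesis .
  qed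
  have I: "integrable lebesgue (\<lambda>s. indicator (?A k) s * y k)" for k
    using fin[of k] step_sets[of t n k] by (intro integrable_mult_left integrable_real_indicator) auto
  show "set_integrable lebesgue {0..t} (\<lambda>s. y (nat \<lfloor>real n * s\<rfloor>))"
    unfolding set_integrable_def eq by (intro Bochner_Integration.integrable_sum I)
  show "(LINT s:{0..t}|lebesgue. y (nat \<lfloor>real n * s\<rfloor>)) = (\<Sum>k\<le>n. weight n t k * y k)"
    unfolding set_lebesgue_integral_def eq
    by (subst Bochner_Integration.integral_sum[OF I]) (simp add: weight_def)
qed

text \<open>The bound b must eventually cover the entries of the array as well as the curve, so it
  is to lie above the bound for the curve. F holds the possible jump times.\<close>

locale array_setup =
  fixes \<alpha> :: "nat \<Rightarrow> nat \<Rightarrow> real" and \<gamma> :: "real \<Rightarrow> real" and b :: real and D :: "nat \<Rightarrow> real" and F :: "real set"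
  assumes b: "0 < b" "b < 1" and \<gamma>_in: "\<And>t. t \<in> {0..1} \<Longrightarrow> \<gamma> t \<in> {0..b}"
    and \<alpha>_near: "\<And>n t. n \<ge> 1 \<Longrightarrow> t \<in> {0..1} \<Longrightarrow> \<bar>\<alpha> n (nat \<lfloor>real n * t\<rfloor>) - \<gamma> t\<bar> \<le> D n" and D: "D \<longlonglongrightarrow> 0"
    and \<alpha>_ev: "eventually (\<lambda>n. \<forall>k\<le>n. \<alpha> n k \<in> {0..b}) sequentially"
    and F: "finite F" "\<And>s. s \<in> {0..1} - F \<Longrightarrow> continuous (at s within {0..1}) \<gamma>"
begin

text \<open>The entries are clipped to \<open>[0,b]\<close> to get rid of finitely many \<open>n\<close> and of the entries beyond \<open>n\<close>.
  The index is shifted by one, since the first map applied is \<open>T\<^sub>n\<^sub>,\<^sub>1\<close>.\<close>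

definition par :: "nat \<Rightarrow> nat \<Rightarrow> real" where
  "par n i = max 0 (min b (\<alpha> n (Suc i)))"

lemma par_in: "par n i \<in> {0..b}"
  using b by (auto simp: par_def)

definition good :: "nat \<Rightarrow> bool" where
  "good n \<longleftrightarrow> n \<ge> 1 \<and> (\<forall>k\<le>n. \<alpha> n k \<in> {0..b})"

lemma eventually_good: "eventually good sequentially"
  using \<alpha>_ev eventually_ge_at_top[of 1] by eventually_elim (simp add: good_def)

lemma par_good: "good n \<Longrightarrow> i < n \<Longrightarrow> par n i = \<alpha> n (Suc i)"
  by (auto simp: good_def par_def)

lemma PM_orbit_eq: "good n \<Longrightarrow> k \<le> n \<Longrightarrow> PM_orbit \<alpha> n k x = orb (par n) k x"
  by (induction k) (simp_all add: par_good)

lemma zeta_n_eq: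
  assumes n: "good n" and t: "t \<in> {0..1}"
  shows "zeta_n \<alpha> f n x t = (\<Sum>k\<le>n. weight n t k * f (orb (par n) k x))"
  unfolding zeta_n_def using t PM_orbit_eq[OF n] by (subst step_integral(2)) auto

lemma index_at_top: "0 < s \<Longrightarrow> filterlim (\<lambda>n. nat \<lfloor>real n * s\<rfloor>) at_top sequentially"
proof -
  assume s: "0 < s"
  have "filterlim (\<lambda>n. s * real n) at_top sequentially"
    using s by (intro filterlim_tendsto_pos_mult_at_top[OF tendsto_const] filterlim_real_sequentially) auto
  then have "filterlim (\<lambda>n. real n * s) at_top sequentially" by (simp add: mult.commute)
  from filterlim_compose[OF filterlim_floor_sequentially this]
  have "filterlim (\<lambda>n. \<lfloor>real n * s\<rfloor>) at_top sequentially" .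
  from filterlim_compose[OF filterlim_nat_sequentially this] show ?thesis .
qed

text \<open>Backward counting: index k - j belongs to a time within (1 + j)/n of s, and \<gamma> is
  continuous at s. The \<open>Suc j\<close> accounts for the shift by one in
  \<open>par\<close>.\<close>

lemma par_tendsto:
  assumes s: "s \<in> {0<..1}" "s \<notin> F"
  shows "(\<lambda>n. par n (nat \<lfloor>real n * s\<rfloor> - Suc j)) \<longlonglongrightarrow> \<gamma> s"
proof -
  define k where "k n = nat \<lfloor>real n * s\<rfloor>" for n
  \<comment> \<open>At this time \<open>real n * u n\<close> is exactly the integer k n - j, so the
    uniform bound on the array applies to this very entry.\<close>
  define u where "u n = real (k n - j) / real n" for n
  have kn: "k n \<le> n" for n unfolding k_def using s by (intro floor_index_le) auto
  have u01: "u n \<in> {0..1}" for n using kn[of n] by (auto simp: u_def divide_le_eq_1)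
  have "u \<longlonglongrightarrow> s"
  proof (rule tendsto_sandwich[where f="\<lambda>n. s - (1 + real j) / real n" and h="\<lambda>n. s"])
    show "eventually (\<lambda>n. s - (1 + real j) / real n \<le> u n) sequentially" using eventually_ge_at_top[of 1]
    proof eventually_elim
      case (elim n)
      have "real n * s - 1 \<le> real (k n)" unfolding k_def by linarith
      then have "real n * s - 1 - real j \<le> real (k n - j)" by linarith
      then have "(real n * s - 1 - real j) / n \<le> u n" unfolding u_def by (intro divide_right_mono) auto
      moreover have "(real n * s - 1 - real j) / n = s - (1 + real j) / n" using elim by (simp add: field_simps)
      ultimately show ?case by simp
    qed
    show "eventually (\<lambda>n. u n \<le> s) sequentially" using eventually_ge_at_top[of 1]
    proof eventually_elim
      case (elim n)
      have "0 \<le> real n * s" using s by simp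
      then have "real (k n) \<le> real n * s" unfolding k_def by linarith
      then have "real (k n - j) \<le> real n * s" by linarith
      then show ?case unfolding u_def using elim by (simp add: field_simps)
    qed
    have "(\<lambda>n. s - (1 + real j) / real n) \<longlonglongrightarrow> s - 0" by (intro tendsto_intros lim_const_over_n)
    then show "(\<lambda>n. s - (1 + real j) / real n) \<longlonglongrightarrow> s" by simp
  qed simp
  then have \<gamma>u: "(\<lambda>n. \<gamma> (u n)) \<longlonglongrightarrow> \<gamma> s"
    using F(2)[of s] s u01 unfolding continuous_within_sequentially by (auto simp: o_def)
  have "(\<lambda>n. \<alpha> n (k n - j) - \<gamma> (u n)) \<longlonglongrightarrow> 0"
  proof (rule Lim_null_comparison[OF _ D])
    show "eventually (\<lambda>n. norm (\<alpha> n (k n - j) - \<gamma> (u n)) \<le> D n) sequentially" using eventually_ge_at_top[of 1]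
    proof eventually_elim
      case (elim n)
      then have "real n * u n = real (k n - j)" by (simp add: u_def)
      then have "nat \<lfloor>real n * u n\<rfloor> = k n - j" by simp
      then show ?case using \<alpha>_near[OF elim u01[of n]] by simp
    qed
  qed
  from tendsto_add[OF this \<gamma>u] have "(\<lambda>n. \<alpha> n (k n - j)) \<longlonglongrightarrow> \<gamma> s" by simp
  moreover have "eventually (\<lambda>n. \<alpha> n (k n - j) = par n (k n - Suc j)) sequentially"
  proof -
    have "eventually (\<lambda>n. Suc j \<le> k n) sequentially"
      using index_at_top[of s] s by (auto simp: k_def filterlim_at_top)
    then show ?thesis using eventually_good
    proof eventually_elim
      case (elim n)
      have "k n - Suc j < n" using elim kn[of n] by linarith
      then show ?case using par_good[OF elim(2), of "k n - Suc j"] elim(1) by (simp add: Suc_diff_Suc)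
    qed
  qed
  ultimately show ?thesis unfolding k_def by (rule Lim_transform_eventually)
qed

lemma mean_tendsto_pointwise:
  fixes \<psi> :: "real \<Rightarrow> real"
  assumes p: "\<psi> \<in> borel_measurable borel" "\<And>x. \<bar>\<psi> x\<bar> \<le> 1" "continuous_on {0..1} \<psi>" and s: "s \<in> {0<..1}" "s \<notin> F"
  shows "(\<lambda>n. LINT x|lb01. \<psi> (orb (par n) (nat \<lfloor>real n * s\<rfloor>) x)) \<longlonglongrightarrow> (LINT x|SRB (\<gamma> s). \<psi> x)"
  using orb_mean_tendsto[where a=par and k="\<lambda>n. nat \<lfloor>real n * s\<rfloor>", OF b par_in \<gamma>_in index_at_top par_tendsto[OF s] p] s
  by simp

text \<open>A pointwise limit of step functions in s. At 0 and at the jump times, finitely many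
  points, the approximants are redefined as the limit so that convergence holds everywhere.\<close>

lemma SRB_integral_measurable:
  fixes \<psi> :: "real \<Rightarrow> real"
  assumes p: "\<psi> \<in> borel_measurable borel" "\<And>x. \<bar>\<psi> x\<bar> \<le> 1" "continuous_on {0..1} \<psi>"
  shows "(\<lambda>s. LINT x|SRB (\<gamma> s). \<psi> x) \<in> borel_measurable leb01"
proof (rule borel_measurable_LIMSEQ_real)
  let ?c = "\<lambda>n k. LINT x|lb01. \<psi> (orb (par n) k x)"
  let ?u = "\<lambda>n s. if s \<in> insert 0 F then (LINT x|SRB (\<gamma> s). \<psi> x) else ?c n (nat \<lfloor>real n * s\<rfloor>)"
  show "?u n \<in> borel_measurable leb01" for n
  proof (rule measurable_discrete_difference[where X="insert 0 F \<inter> {0..1}" and f="\<lambda>s. ?c n (nat \<lfloor>real n * s\<rfloor>)"])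
    have "(\<lambda>s. nat \<lfloor>real n * s\<rfloor>) \<in> borel \<rightarrow>\<^sub>M count_space UNIV" by measurable
    from measurable_compose[OF this, of "?c n" borel]
    have "(\<lambda>s. ?c n (nat \<lfloor>real n * s\<rfloor>)) \<in> borel_measurable borel" by simp
    then show "(\<lambda>s. ?c n (nat \<lfloor>real n * s\<rfloor>)) \<in> borel_measurable leb01"
      by (intro measurable_restrict_space1 measurable_completion) simp
    show "countable (insert 0 F \<inter> {0..1})" using F(1) by (intro countable_finite) auto
  qed (auto simp: sets_restrict_space)
  fix s assume "s \<in> space leb01"
  then have s: "s \<in> {0..1}" by simp
  show "(\<lambda>n. ?u n s) \<longlonglongrightarrow> (LINT x|SRB (\<gamma> s). \<psi> x)"
    using mean_tendsto_pointwise[OF p, of s] s by (cases "s \<in> insert 0 F") (auto simp: less_le)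
qed

lemma abs_integral_SRB_le:
  fixes \<psi> :: "real \<Rightarrow> real"
  assumes p: "\<psi> \<in> borel_measurable borel" "\<And>x. \<bar>\<psi> x\<bar> \<le> 1" and s: "s \<in> {0..1}"
  shows "\<bar>LINT x|SRB (\<gamma> s). \<psi> x\<bar> \<le> 1"
proof -
  have "is_SRB (\<gamma> s) (SRB (\<gamma> s))" using is_SRB_SRB[OF b \<gamma>_in[OF s]] .
  then interpret prob_space "SRB (\<gamma> s)" by (simp add: is_SRB_def)
  have "\<bar>LINT x|SRB (\<gamma> s). \<psi> x\<bar> \<le> (LINT x|SRB (\<gamma> s). \<bar>\<psi> x\<bar>)"
    using integral_norm_bound[of "SRB (\<gamma> s)" \<psi>] by simp
  also have "\<dots> \<le> 1"
  proof (cases "integrable (SRB (\<gamma> s)) (\<lambda>x. \<bar>\<psi> x\<bar>)")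
    case True
    then have "(LINT x|SRB (\<gamma> s). \<bar>\<psi> x\<bar>) \<le> (LINT x|SRB (\<gamma> s). 1)" using p(2) by (intro integral_mono) auto
    then show ?thesis using prob_space by simp
  qed (simp add: not_integrable_integral_eq)
  finally show ?thesis .
qed

lemma SRB_integral_set_integrable:
  fixes \<psi> :: "real \<Rightarrow> real"
  assumes p: "\<psi> \<in> borel_measurable borel" "\<And>x. \<bar>\<psi> x\<bar> \<le> 1" "continuous_on {0..1} \<psi>" and t: "t \<in> {0..1}"
  shows "set_integrable lebesgue {0..t} (\<lambda>s. LINT x|SRB (\<gamma> s). \<psi> x)"
proof -
  have "(\<lambda>s. indicator {0..1} s *\<^sub>R (LINT x|SRB (\<gamma> s). \<psi> x)) \<in> borel_measurable lebesgue"
    using SRB_integral_measurable[OF p] by (subst (asm) borel_measurable_restrict_space_iff) auto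
  then have "set_integrable lebesgue {0..1} (\<lambda>s. LINT x|SRB (\<gamma> s). \<psi> x)"
    unfolding set_integrable_def
    by (rule Bochner_Integration.integrable_bound[where f="indicator {0..1} :: real \<Rightarrow> real", rotated])
       (use abs_integral_SRB_le[OF p(1,2)] in \<open>auto simp: indicator_def integrable_real_indicator intro!: AE_I2\<close>)
  then show ?thesis by (rule set_integrable_subset) (use t in auto)
qed

lemma mean_tendsto:
  fixes \<psi> :: "real \<Rightarrow> real"
  assumes p: "\<psi> \<in> borel_measurable borel" "\<And>x. \<bar>\<psi> x\<bar> \<le> 1" "continuous_on {0..1} \<psi>" and t: "t \<in> {0..1}"
  shows "(\<lambda>n. \<Sum>k\<le>n. weight n t k * (LINT x|lb01. \<psi> (orb (par n) k x))) \<longlonglongrightarrow> family_integral (\<lambda>s. SRB (\<gamma> s)) \<psi> t"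
proof -
  let ?c = "\<lambda>n k. LINT x|lb01. \<psi> (orb (par n) k x)"
  have c1: "\<bar>?c n k\<bar> \<le> 1" for n k
  proof -
    have "\<bar>LINT x|lb01. \<psi> (orb (par n) k x) * 1\<bar> \<le> 1 * (LINT x|lb01. \<bar>1\<bar>)"
      by (rule integral_bounded_mult_le) (use p in \<open>auto intro!: borel_imp_lb01\<close>)
    then show ?thesis using lb01.prob_space by simp
  qed
  have st: "set_integrable lebesgue {0..t} (\<lambda>s. ?c n (nat \<lfloor>real n * s\<rfloor>))" for n
    using step_integral(1)[of t "?c n" n] t by auto
  have "(\<lambda>n. LINT s:{0..t}|lebesgue. ?c n (nat \<lfloor>real n * s\<rfloor>)) \<longlonglongrightarrow> (LINT s:{0..t}|lebesgue. LINT x|SRB (\<gamma> s). \<psi> x)"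
    unfolding set_lebesgue_integral_def
  proof (rule integral_dominated_convergence[where w="indicator {0..t}"])
    show "(\<lambda>s. indicator {0..t} s *\<^sub>R (LINT x|SRB (\<gamma> s). \<psi> x)) \<in> borel_measurable lebesgue"
      using SRB_integral_set_integrable[OF p t] by (simp add: set_integrable_def borel_measurable_integrable)
    show "(\<lambda>s. indicator {0..t} s *\<^sub>R ?c n (nat \<lfloor>real n * s\<rfloor>)) \<in> borel_measurable lebesgue" for n
      using st[of n] unfolding set_integrable_def by (rule borel_measurable_integrable)
    show "integrable lebesgue (indicator {0..t} :: real \<Rightarrow> real)"
      by (rule integrable_real_indicator) (use t in auto)
    have "insert 0 F \<in> null_sets lebesgue" using F(1) by (intro null_sets_completionI finite_imp_null_set_lborel) auto
    then have "AE s in lebesgue. s \<notin> insert 0 F" by (rule AE_not_in)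
    then show "AE s in lebesgue. (\<lambda>n. indicator {0..t} s *\<^sub>R ?c n (nat \<lfloor>real n * s\<rfloor>)) \<longlonglongrightarrow> indicator {0..t} s *\<^sub>R (LINT x|SRB (\<gamma> s). \<psi> x)"
    proof eventually_elim
      case (elim s)
      show ?case
      proof (cases "s \<in> {0..t}")
        case True
        then show ?thesis using mean_tendsto_pointwise[OF p, of s] elim t by auto
      qed simp
    qed
    show "AE s in lebesgue. norm (indicator {0..t} s *\<^sub>R ?c n (nat \<lfloor>real n * s\<rfloor>)) \<le> indicator {0..t} s" for n
      using c1 by (intro AE_I2) (auto simp: indicator_def)
  qed
  then show ?thesis using step_integral(2)[of t "?c n" n for n] t by (simp add: family_integral_def)
qed

end

section \<open>Deviation of the averages from their means\<close>

context array_setup begin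

abbreviation S :: "(real \<Rightarrow> real) \<Rightarrow> nat \<Rightarrow> real \<Rightarrow> real \<Rightarrow> real" where
  "S w n t x \<equiv> \<Sum>k\<le>n. weight n t k * w (orb (par n) k x)"

abbreviation MS :: "(real \<Rightarrow> real) \<Rightarrow> nat \<Rightarrow> real \<Rightarrow> real" where
  "MS w n t \<equiv> \<Sum>k\<le>n. weight n t k * (LINT x|lb01. w (orb (par n) k x))"

lemma test_funD:
  assumes "test_fun w" shows "w \<in> borel_measurable borel" "\<bar>w x\<bar> \<le> 1"
  using assms by (auto simp: test_fun_def)

lemma S_measurable: "test_fun w \<Longrightarrow> S w n t \<in> borel_measurable borel"
  using test_funD(1)[of w] by measurable

text \<open>Markov's inequality for an even power, used with p = 2 for convergence in probability
  and p = 4 for almost sure convergence.\<close>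

lemma deviation_prob:
  assumes w: "test_fun w" and e: "0 < e" and p: "even p" and I: "integrable lb01 (\<lambda>x. (S w n t x - MS w n t) ^ p)"
    and le: "(LINT x|lb01. (S w n t x - MS w n t) ^ p) \<le> K"
  shows "measure lb01 {x \<in> {0..1}. \<bar>S w n t x - MS w n t\<bar> \<ge> e} \<le> K / e ^ p"
proof -
  have "measure lb01 {x \<in> space lb01. (S w n t x - MS w n t) ^ p \<ge> e ^ p} \<le> (LINT x|lb01. (S w n t x - MS w n t) ^ p) / e ^ p"
    by (rule integral_Markov_inequality_measure[OF I, of "{}"]) (use e p in \<open>auto simp: zero_le_even_power\<close>)
  also have "\<dots> \<le> K / e ^ p" using le e by (intro divide_right_mono) auto
  finally have *: "measure lb01 {x \<in> {0..1}. (S w n t x - MS w n t) ^ p \<ge> e ^ p} \<le> K / e ^ p" by simp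
  have "{x \<in> space lb01. (S w n t x - MS w n t) ^ p \<ge> e ^ p} \<in> sets lb01"
    using borel_measurable_integrable[OF I] by measurable
  then have m: "{x \<in> {0..1}. (S w n t x - MS w n t) ^ p \<ge> e ^ p} \<in> sets lb01" by simp
  have sub: "{x \<in> {0..1}. \<bar>S w n t x - MS w n t\<bar> \<ge> e} \<subseteq> {x \<in> {0..1}. (S w n t x - MS w n t) ^ p \<ge> e ^ p}"
  proof
    fix x assume "x \<in> {x \<in> {0..1}. \<bar>S w n t x - MS w n t\<bar> \<ge> e}"
    then show "x \<in> {x \<in> {0..1}. (S w n t x - MS w n t) ^ p \<ge> e ^ p}"
      using power_mono[of e "\<bar>S w n t x - MS w n t\<bar>" p] e p by (simp add: power_even_abs)
  qed
  have "measure lb01 {x \<in> {0..1}. \<bar>S w n t x - MS w n t\<bar> \<ge> e} \<le> measure lb01 {x \<in> {0..1}. (S w n t x - MS w n t) ^ p \<ge> e ^ p}"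
    by (rule lb01.finite_measure_mono[OF sub m])
  then show ?thesis using * by simp
qed

lemma deviation_integrable:
  assumes w: "test_fun w"
  shows "integrable lb01 (\<lambda>x. (S w n t x - MS w n t) ^ p)"
proof -
  have "integrable lb01 (\<lambda>x. (S w n t x - MS w n t) ^ p)"
  proof (rule bounded_integrable)
    show "(\<lambda>x. (S w n t x - MS w n t) ^ p) \<in> borel_measurable borel" using S_measurable[OF w] by measurable
    have "\<bar>S w n t x\<bar> \<le> (\<Sum>k\<le>n. \<bar>weight n t k\<bar>)" for x
      using test_funD(2)[OF w] by (intro order_trans[OF sum_abs] sum_mono) (simp add: abs_mult mult_left_le)
    then have "\<bar>S w n t x - MS w n t\<bar> \<le> (\<Sum>k\<le>n. \<bar>weight n t k\<bar>) + \<bar>MS w n t\<bar>" for x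
      by (intro order_trans[OF abs_triangle_ineq4] add_mono) auto
    then show "\<bar>(S w n t x - MS w n t) ^ p\<bar> \<le> ((\<Sum>k\<le>n. \<bar>weight n t k\<bar>) + \<bar>MS w n t\<bar>) ^ p" for x
      unfolding power_abs by (intro power_mono) auto
  qed
  then show ?thesis .
qed

lemma S_dev:
  assumes "observed_orbit b \<rho> (par n) w"
  shows "S w n t x - MS w n t = (\<Sum>k\<le>n. weight n t k * observed_orbit.dev (par n) w k x)"
proof -
  interpret observed_orbit b \<rho> "par n" w by fact
  show ?thesis by (simp add: dev_def cen_def right_diff_distrib sum_subtractf)
qed

lemma observed: "memory_loss b \<rho> \<Longrightarrow> test_fun w \<Longrightarrow> observed_orbit b \<rho> (par n) w"
  using b par_in by (auto simp: observed_orbit_def)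

lemma S_tendsto_prob:
  assumes w: "test_fun w" "continuous_on {0..1} w" and t: "t \<in> {0..1}" and e: "0 < e"
  shows "(\<lambda>n. measure lb01 {x \<in> {0..1}. \<bar>S w n t x - family_integral (\<lambda>s. SRB (\<gamma> s)) w t\<bar> \<ge> e}) \<longlonglongrightarrow> 0"
proof -
  obtain \<rho> where ml: "memory_loss b \<rho>" "\<rho> \<longlonglongrightarrow> 0" using memory_loss_tendsto[OF b] by blast
  let ?Z = "family_integral (\<lambda>s. SRB (\<gamma> s)) w t"
  let ?K = "\<lambda>n. 8 * (1 + real n) / (real n)\<^sup>2 * (\<Sum>r\<le>n. \<rho> r)"
  have bd: "measure lb01 {x \<in> {0..1}. \<bar>S w n t x - MS w n t\<bar> \<ge> e / 2} \<le> ?K n / (e / 2)\<^sup>2" if n: "n \<ge> 1" for n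
  proof -
    interpret O: observed_orbit b \<rho> "par n" w by (rule observed[OF ml(1) w(1)])
    show ?thesis
      by (rule deviation_prob[OF w(1) _ _ deviation_integrable[OF w(1)]])
        (use e O.second_moment[of n "weight n t"] weight_bounds[OF n] S_dev[OF O.observed_orbit_axioms] in auto)
  qed
  have "eventually (\<lambda>n. norm (MS w n t - ?Z) < e / 2) sequentially"
    using tendstoD[OF mean_tendsto[OF test_funD[OF w(1)] w(2) t], of "e / 2"] e by (simp add: dist_norm)
  then have ev: "eventually (\<lambda>n. norm (measure lb01 {x \<in> {0..1}. \<bar>S w n t x - ?Z\<bar> \<ge> e}) \<le> ?K n / (e / 2)\<^sup>2) sequentially"
    using eventually_ge_at_top[of 1]
  proof eventually_elim
    case (elim n)
    have Sm: "(\<lambda>x. S w n t x) \<in> borel_measurable lb01" by (intro borel_imp_lb01 S_measurable w(1))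
    have "{x \<in> space lb01. \<bar>S w n t x - MS w n t\<bar> \<ge> e / 2} \<in> sets lb01" using Sm by measurable
    then have m: "{x \<in> {0..1}. \<bar>S w n t x - MS w n t\<bar> \<ge> e / 2} \<in> sets lb01" by simp
    have "measure lb01 {x \<in> {0..1}. \<bar>S w n t x - ?Z\<bar> \<ge> e} \<le> measure lb01 {x \<in> {0..1}. \<bar>S w n t x - MS w n t\<bar> \<ge> e / 2}"
    proof (rule lb01.finite_measure_mono[OF _ m])
      have "e / 2 \<le> \<bar>S w n t x - MS w n t\<bar>" if "e \<le> \<bar>S w n t x - ?Z\<bar>" for x
        using elim(1) that unfolding real_norm_def by linarith
      then show "{x \<in> {0..1}. \<bar>S w n t x - ?Z\<bar> \<ge> e} \<subseteq> {x \<in> {0..1}. \<bar>S w n t x - MS w n t\<bar> \<ge> e / 2}" by blast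
    qed
    then show ?case using bd[OF elim(2)] by simp
  qed
  have K: "?K \<longlonglongrightarrow> 0"
  proof -
    have 1: "(\<lambda>n. (\<Sum>r\<le>n. \<rho> r) / real n) \<longlonglongrightarrow> 0"
      by (rule average_tendsto_0[OF memory_loss_nonneg[OF ml(1) b] ml(2)])
    have 2: "(\<lambda>n. 8 * (1 / real n + 1)) \<longlonglongrightarrow> 8 * (0 + 1)" by (intro tendsto_intros lim_const_over_n)
    have "(\<lambda>n. 8 * (1 / real n + 1) * ((\<Sum>r\<le>n. \<rho> r) / real n)) \<longlonglongrightarrow> 0"
      using tendsto_mult[OF 2 1] by simp
    then show ?thesis
    proof (rule Lim_transform_eventually)
      show "eventually (\<lambda>n. 8 * (1 / real n + 1) * ((\<Sum>r\<le>n. \<rho> r) / real n) = ?K n) sequentially"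
        using eventually_ge_at_top[of 1]
      proof eventually_elim
        case (elim n) then show ?case by (simp add: power2_eq_square divide_simps)
      qed
    qed
  qed
  have "(\<lambda>n. ?K n / (e / 2)\<^sup>2) \<longlonglongrightarrow> 0 / (e / 2)\<^sup>2" using e by (intro tendsto_divide K tendsto_const) auto
  then have "(\<lambda>n. ?K n / (e / 2)\<^sup>2) \<longlonglongrightarrow> 0" by simp
  then show ?thesis by (rule Lim_null_comparison[OF ev])
qed

text \<open>The fourth moment makes the probabilities of a deviation by e summable in n.
  Borel--Cantelli asks nothing about how different rows are related.\<close>

lemma S_tendsto_AE:
  assumes b2: "b < 1/2" and w: "test_fun w" "continuous_on {0..1} w" and t: "t \<in> {0..1}"
  shows "AE x in lb01. (\<lambda>n. S w n t x) \<longlonglongrightarrow> family_integral (\<lambda>s. SRB (\<gamma> s)) w t"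
proof -
  let ?Z = "family_integral (\<lambda>s. SRB (\<gamma> s)) w t"
  obtain C \<delta> where C: "0 \<le> C" "0 < \<delta>" "\<delta> < 1" and ml: "memory_loss b (\<lambda>k. C * (1 + real k) powr - (1 + \<delta>))"
    by (rule memory_loss_summable[OF b(1) b2])
  obtain R0 where R0: "\<And>n. (\<Sum>r\<le>n. (1 + real r) powr - (1 + \<delta>)) \<le> R0" using sum_powr_bounded[OF C(2)] by blast
  have R: "(\<Sum>r\<le>n. C * (1 + real r) powr - (1 + \<delta>)) \<le> C * R0" for n
    using R0[of n] C(1) by (simp add: sum_distrib_left[symmetric] mult_left_mono)
  define K where "K = 16 * (144 * C * (4 / (1 - (1 + \<delta>) / 3))^3 + 192 * (C * R0)\<^sup>2)"
  have summ: "summable (\<lambda>n. K * real n powr - (1 + \<delta>) / e ^ 4)" for e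
    using C(2) by (intro summable_divide summable_mult) (simp add: summable_real_powr_iff)
  have bd: "measure lb01 {x \<in> {0..1}. \<bar>S w n t x - MS w n t\<bar> \<ge> e} \<le> K * real n powr - (1 + \<delta>) / e ^ 4" if n: "n \<ge> 1" and e: "0 < e" for n e
  proof -
    interpret O: observed_orbit b "\<lambda>k. C * (1 + real k) powr - (1 + \<delta>)" "par n" w by (rule observed[OF ml w(1)])
    have "(LINT x|lb01. (S w n t x - MS w n t) ^ 4) \<le> K * (1 + real n) powr - (1 + \<delta>)"
      unfolding S_dev[OF O.observed_orbit_axioms] K_def
      by (rule O.fourth_moment[OF refl C R]) (use weight_bounds[OF n] n in auto)
    also have "\<dots> \<le> K * real n powr - (1 + \<delta>)"
      using n C by (intro mult_left_mono powr_mono2') (auto simp: K_def)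
    finally show ?thesis by (intro deviation_prob[OF w(1) e _ deviation_integrable[OF w(1)]]) auto
  qed
  have ae: "AE x in lb01. eventually (\<lambda>n. \<bar>S w n t x - MS w n t\<bar> < e) sequentially" if e: "0 < e" for e
  proof -
    let ?A = "\<lambda>n. {x \<in> {0..1}. \<bar>S w n t x - MS w n t\<bar> \<ge> e}"
    have "AE x in lb01. eventually (\<lambda>n. x \<in> space lb01 - ?A n) sequentially"
    proof (rule borel_cantelli_AE1)
      show "?A n \<in> sets lb01" for n
      proof -
        have Sm: "(\<lambda>x. S w n t x) \<in> borel_measurable lb01" by (intro borel_imp_lb01 S_measurable w(1))
        have "{x \<in> space lb01. \<bar>S w n t x - MS w n t\<bar> \<ge> e} \<in> sets lb01" using Sm by measurable
        then show ?thesis by simp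
      qed
      show "emeasure lb01 (?A n) < \<infinity>" for n by (simp add: lb01.emeasure_eq_measure)
      show "summable (\<lambda>n. measure lb01 (?A n))"
        by (rule summable_comparison_test'[OF summ[of e], of 1]) (use bd e in auto)
    qed
    then show ?thesis using AE_space by eventually_elim (auto elim: eventually_mono)
  qed
  \<comment> \<open>Countably many tolerances, so that one null set serves them all.\<close>
  have "AE x in lb01. \<forall>m::nat. eventually (\<lambda>n. \<bar>S w n t x - MS w n t\<bar> < 1 / real (Suc m)) sequentially"
    unfolding AE_all_countable by (intro allI ae) simp
  then show ?thesis
  proof eventually_elim
    case (elim x)
    have "(\<lambda>n. S w n t x - MS w n t) \<longlonglongrightarrow> 0"
      unfolding tendsto_iff
    proof (intro allI impI)
      fix e :: real assume "0 < e"
      then obtain m where m: "1 / real (Suc m) < e" using nat_approx_posE by blast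
      from elim[rule_format, of m] show "eventually (\<lambda>n. dist (S w n t x - MS w n t) 0 < e) sequentially"
        by eventually_elim (use m in \<open>simp add: dist_norm\<close>)
    qed
    from tendsto_add[OF this mean_tendsto[OF test_funD[OF w(1)] w(2) t]]
    show ?case by simp
  qed
qed

end

section \<open>Test functions and families of measures\<close>

text \<open>A common frame for the SRB measures and for point masses along an orbit, so that one
  estimate compares their time integrals.\<close>

definition prob_family :: "(real \<Rightarrow> real measure) \<Rightarrow> bool" where
  "prob_family \<nu> \<longleftrightarrow> measurable_family \<nu> \<and> (\<forall>s\<in>{0..1}. prob_space (\<nu> s))"

lemma continuous_on_borel_lb01:
  fixes f :: "real \<Rightarrow> real"
  assumes "continuous_on {0..1} f" "sets M = sets (restrict_space borel {0..1})"
  shows "f \<in> borel_measurable M"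
  using borel_measurable_continuous_on_restrict[OF assms(1)] by (simp add: measurable_cong_sets[OF assms(2) refl])

lemma continuous_on_integrable:
  fixes f :: "real \<Rightarrow> real"
  assumes f: "continuous_on {0..1} f" and M: "sets M = sets (restrict_space borel {0..1})" "finite_measure M"
  shows "integrable M f"
proof -
  obtain C where C: "\<And>x. x \<in> {0..1} \<Longrightarrow> \<bar>f x\<bar> \<le> C"
    using compact_imp_bounded[OF compact_continuous_image[OF f]] by (force simp: bounded_iff)
  have "space M = {0..1}" using sets_eq_imp_space_eq[OF M(1)] by (simp add: space_restrict_space)
  then show ?thesis
    using C by (intro finite_measure.integrable_const_bound[OF M(2), of _ C] continuous_on_borel_lb01[OF f M(1)] AE_I2) auto
qed

section \<open>Time integrals of families of probability measures\<close>

context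
  fixes \<nu> :: "real \<Rightarrow> real measure"
  assumes \<nu>: "prob_family \<nu>"
begin

lemma family_sets: "s \<in> {0..1} \<Longrightarrow> sets (\<nu> s) = sets (restrict_space borel {0..1})"
  and family_finite: "s \<in> {0..1} \<Longrightarrow> finite_measure (\<nu> s)"
  and family_prob: "s \<in> {0..1} \<Longrightarrow> prob_space (\<nu> s)"
  using \<nu> by (auto simp: prob_family_def measurable_family_def)

lemma family_abs_le:
  fixes f :: "real \<Rightarrow> real"
  assumes f: "continuous_on {0..1} f" and C: "\<And>x. x \<in> {0..1} \<Longrightarrow> \<bar>f x\<bar> \<le> C" and s: "s \<in> {0..1}"
  shows "\<bar>LINT x|\<nu> s. f x\<bar> \<le> C"
proof -
  interpret prob_space "\<nu> s" using family_prob[OF s] .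
  have sp: "space (\<nu> s) = {0..1}" using sets_eq_imp_space_eq[OF family_sets[OF s]] by (simp add: space_restrict_space)
  have i: "integrable (\<nu> s) f" by (rule continuous_on_integrable[OF f family_sets[OF s] family_finite[OF s]])
  have "\<bar>LINT x|\<nu> s. f x\<bar> \<le> (LINT x|\<nu> s. \<bar>f x\<bar>)" using integral_norm_bound[of "\<nu> s" f] by simp
  also have "\<dots> \<le> (LINT x|\<nu> s. C)" using i C sp by (intro integral_mono) auto
  finally show ?thesis using prob_space by simp
qed

lemma family_set_integrable:
  fixes f :: "real \<Rightarrow> real"
  assumes f: "continuous_on {0..1} f" and t: "t \<le> 1"
  shows "set_integrable lebesgue {0..t} (\<lambda>s. LINT x|\<nu> s. f x)"
proof -
  obtain C where C: "\<And>x. x \<in> {0..1} \<Longrightarrow> \<bar>f x\<bar> \<le> C"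
    using compact_imp_bounded[OF compact_continuous_image[OF f]] by (force simp: bounded_iff)
  have "(\<lambda>s. LINT x|\<nu> s. f x) \<in> borel_measurable leb01" using \<nu> f by (simp add: prob_family_def measurable_family_def)
  then have "(\<lambda>s. indicator {0..1} s *\<^sub>R (LINT x|\<nu> s. f x)) \<in> borel_measurable lebesgue"
    by (subst (asm) borel_measurable_restrict_space_iff) auto
  moreover have "integrable lebesgue (\<lambda>s::real. C * indicator {0..1} s)"
    by (intro integrable_mult_right integrable_real_indicator) auto
  moreover have "AE s in lebesgue. norm (indicator {0..1} s *\<^sub>R (LINT x|\<nu> s. f x)) \<le> norm (C * indicator {0..1} s)"
    using family_abs_le[OF f C] by (intro AE_I2) (force simp: indicator_def)
  ultimately have "set_integrable lebesgue {0..1} (\<lambda>s. LINT x|\<nu> s. f x)"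
    unfolding set_integrable_def using Bochner_Integration.integrable_bound by blast
  then show ?thesis by (rule set_integrable_subset) (use t in auto)
qed

lemma family_integral_diff_time:
  fixes f :: "real \<Rightarrow> real"
  assumes f: "continuous_on {0..1} f" and C: "\<And>x. x \<in> {0..1} \<Longrightarrow> \<bar>f x\<bar> \<le> C" and t: "0 \<le> t" "t \<le> u" "u \<le> 1"
  shows "\<bar>family_integral \<nu> f u - family_integral \<nu> f t\<bar> \<le> C * (u - t)"
proof -
  let ?g = "\<lambda>s. LINT x|\<nu> s. f x"
  have C0: "0 \<le> C" using C[of 0] by simp
  have i: "set_integrable lebesgue {t<..u} ?g"
    by (rule set_integrable_subset[OF family_set_integrable[OF f t(3)]]) (use t in auto)
  have "family_integral \<nu> f u = (LINT s:{0..t} \<union> {t<..u}|lebesgue. ?g s)"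
    unfolding family_integral_def using t by (intro arg_cong[where f="\<lambda>A. LINT s:A|lebesgue. ?g s"]) auto
  also have "\<dots> = family_integral \<nu> f t + (LINT s:{t<..u}|lebesgue. ?g s)"
    unfolding family_integral_def using t by (intro set_integral_Un i family_set_integrable f) auto
  finally have "\<bar>family_integral \<nu> f u - family_integral \<nu> f t\<bar> = \<bar>LINT s:{t<..u}|lebesgue. ?g s\<bar>" by simp
  also have "\<dots> \<le> (LINT s|lebesgue. \<bar>indicator {t<..u} s *\<^sub>R ?g s\<bar>)"
    unfolding set_lebesgue_integral_def using integral_norm_bound[of lebesgue "\<lambda>s. indicator {t<..u} s *\<^sub>R ?g s"] by simp
  also have "\<dots> \<le> (LINT s|lebesgue. C * indicator {t<..u} s)"
  proof (rule integral_mono)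
    show "integrable lebesgue (\<lambda>s. \<bar>indicator {t<..u} s *\<^sub>R ?g s\<bar>)" using i by (simp add: set_integrable_def)
    show "integrable lebesgue (\<lambda>s. C * indicator {t<..u} s)"
      by (intro integrable_mult_right integrable_real_indicator) (use t in auto)
    show "\<bar>indicator {t<..u} s *\<^sub>R ?g s\<bar> \<le> C * indicator {t<..u} s" for s
      using family_abs_le[OF f C, of s] t by (auto simp: indicator_def)
  qed
  also have "\<dots> = C * (u - t)" using t by simp
  finally show ?thesis .
qed

lemma family_integral_abs_le:
  fixes f :: "real \<Rightarrow> real"
  assumes f: "continuous_on {0..1} f" and C: "\<And>x. x \<in> {0..1} \<Longrightarrow> \<bar>f x\<bar> \<le> C" and t: "t \<in> {0..1}"
  shows "\<bar>family_integral \<nu> f t\<bar> \<le> C"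
proof -
  have "family_integral \<nu> f 0 = 0"
  proof -
    have "AE s in lebesgue. indicator {0..0} s *\<^sub>R (LINT x|\<nu> s. f x) = 0"
      using AE_lborel_singleton[of 0, THEN AE_completion] by eventually_elim (simp add: indicator_def)
    then show ?thesis unfolding family_integral_def set_lebesgue_integral_def by (rule integral_eq_zero_AE)
  qed
  moreover have "0 \<le> C" using C[of 0] by simp
  ultimately show ?thesis using family_integral_diff_time[OF f C, of 0 t] t mult_left_le[of t C] by simp
qed

lemma family_integral_add:
  fixes f g :: "real \<Rightarrow> real"
  assumes f: "continuous_on {0..1} f" and g: "continuous_on {0..1} g" and t: "t \<in> {0..1}"
  shows "family_integral \<nu> (\<lambda>x. f x + g x) t = family_integral \<nu> f t + family_integral \<nu> g t"
proof -
  have "family_integral \<nu> (\<lambda>x. f x + g x) t = (LINT s:{0..t}|lebesgue. (LINT x|\<nu> s. f x) + (LINT x|\<nu> s. g x))"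
    unfolding family_integral_def
  proof (rule set_lebesgue_integral_cong)
    show "\<forall>s. s \<in> {0..t} \<longrightarrow> (LINT x|\<nu> s. f x + g x) = (LINT x|\<nu> s. f x) + (LINT x|\<nu> s. g x)"
      using t by (auto intro!: Bochner_Integration.integral_add continuous_on_integrable f g family_sets family_finite)
  qed simp
  also have "\<dots> = family_integral \<nu> f t + family_integral \<nu> g t"
    unfolding family_integral_def using t by (intro set_integral_add family_set_integrable f g) auto
  finally show ?thesis .
qed

lemma family_integral_cmult:
  fixes f :: "real \<Rightarrow> real"
  shows "family_integral \<nu> (\<lambda>x. c * f x) t = c * family_integral \<nu> f t"
  by (simp add: family_integral_def)

lemma family_integral_const:
  assumes "t \<in> {0..1}"
  shows "family_integral \<nu> (\<lambda>x. c) t = c * t"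
proof -
  have "family_integral \<nu> (\<lambda>x. c) t = (LINT s:{0..t}|lebesgue. c)"
    unfolding family_integral_def
  proof (rule set_lebesgue_integral_cong)
    show "\<forall>s. s \<in> {0..t} \<longrightarrow> (LINT x|\<nu> s. c) = c"
    proof (intro allI impI)
      fix s assume "s \<in> {0..t}"
      then interpret prob_space "\<nu> s" using assms by (intro family_prob) auto
      show "(LINT x|\<nu> s. c) = c" using prob_space by simp
    qed
  qed simp
  also have "\<dots> = c * t" using assms by (simp add: set_lebesgue_integral_def)
  finally show ?thesis .
qed

lemma family_integral_sum:
  fixes f :: "nat \<Rightarrow> real \<Rightarrow> real"
  assumes f: "\<And>i. continuous_on {0..1} (f i)" and t: "t \<in> {0..1}"
  shows "family_integral \<nu> (\<lambda>x. \<Sum>i<n. c i * f i x) t = (\<Sum>i<n. c i * family_integral \<nu> (f i) t)"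
proof (induction n)
  case 0 show ?case using family_integral_const[OF t, of 0] by simp
next
  case (Suc n)
  have "family_integral \<nu> (\<lambda>x. \<Sum>i<Suc n. c i * f i x) t = family_integral \<nu> (\<lambda>x. (\<Sum>i<n. c i * f i x) + c n * f n x) t"
    by simp
  also have "\<dots> = family_integral \<nu> (\<lambda>x. \<Sum>i<n. c i * f i x) t + family_integral \<nu> (\<lambda>x. c n * f n x) t"
    using f t by (intro family_integral_add continuous_intros) auto
  finally show ?case using Suc by (simp add: family_integral_cmult)
qed

end

text \<open>The powers themselves increase, so they are reflected to become decreasing; the
  indicator makes the bounds of \<open>test_fun\<close> hold on the whole line.\<close>

definition copow :: "nat \<Rightarrow> real \<Rightarrow> real" where
  "copow i x = indicator {0..1} x * (1 - x ^ i)"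

lemma copow_eq: "x \<in> {0..1} \<Longrightarrow> copow i x = 1 - x ^ i"
  by (simp add: copow_def)

lemma copow_continuous: "continuous_on {0..1} (copow i)"
proof -
  have "continuous_on {0..1} (\<lambda>x::real. 1 - x ^ i)" by (intro continuous_intros)
  then show ?thesis using continuous_on_cong[of "{0..1}" "{0..1}" "copow i" "\<lambda>x. 1 - x ^ i"] copow_eq by simp
qed

lemma copow_test_fun: "test_fun (copow i)"
  unfolding test_fun_def
proof (intro conjI allI impI)
  show "copow i \<in> borel_measurable borel" unfolding copow_def by measurable
  show "0 \<le> copow i x" "copow i x \<le> 1" for x by (auto simp: copow_def indicator_def power_le_one)
  show "copow i y \<le> copow i x" if "0 \<le> x" "x \<le> y" "y \<le> 1" for x y
    using that by (simp add: copow_def power_mono)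
qed

text \<open>Polynomials are linear combinations of \<open>1\<close> and the decreasing functions \<open>1 - x\<^sup>i\<close>; times are
  restricted to a grid by Lipschitz continuity in \<open>t\<close>.\<close>

proposition uniform_from_copow:
  fixes f :: "real \<Rightarrow> real"
  assumes f: "continuous_on {0..1} f" and e: "0 < e"
  obtains \<eta> d m where "0 < \<eta>" "m \<ge> (1::nat)"
    "\<And>\<nu> \<nu>' t. prob_family \<nu> \<Longrightarrow> prob_family \<nu>' \<Longrightarrow>
      (\<And>i (j::nat). i < d \<Longrightarrow> j \<le> m \<Longrightarrow> \<bar>family_integral \<nu> (copow i) (j / m) - family_integral \<nu>' (copow i) (j / m)\<bar> < \<eta>) \<Longrightarrow>
      t \<in> {0..1} \<Longrightarrow> \<bar>family_integral \<nu> f t - family_integral \<nu>' f t\<bar> \<le> e"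
proof -
  obtain g where g: "real_polynomial_function g" "\<And>x. x \<in> {0..1} \<Longrightarrow> \<bar>f x - g x\<bar> < e / 4"
    using Stone_Weierstrass_real_polynomial_function[OF _ f, of "e / 4"] e by auto
  obtain c N where gc: "g = (\<lambda>x. \<Sum>i\<le>N. c i * x ^ i)" using g(1) unfolding real_polynomial_function_iff_sum by blast
  define d where "d = Suc N"
  define A where "A = (\<Sum>i<d. \<bar>c i\<bar>)"
  have A0: "0 \<le> A" by (simp add: A_def sum_nonneg)
  define B where "B = (\<Sum>i<d. c i)"
  \<comment> \<open>Rewrites \<open>\<Sum> c i * x ^ i\<close> as
    \<open>\<Sum> c i - \<Sum> c i * (1 - x ^ i)\<close>, so p equals g on [0,1].\<close>
  define p where "p x = B + (\<Sum>i<d. (- c i) * copow i x)" for x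
  have gp: "g x = p x" if "x \<in> {0..1}" for x
    using that by (simp add: gc p_def B_def d_def copow_eq lessThan_Suc_atMost sum.distrib[symmetric] algebra_simps)
  have cont_p: "continuous_on {0..1} p" unfolding p_def by (intro continuous_intros copow_continuous)
  \<comment> \<open>1/m is both grid spacing and tolerance: moving t to the grid costs \<eta> for
    each family and comparing there costs another \<eta>. Then \<open>A * (3 * \<eta>)\<close> is at
    most e/2, and the polynomial approximation adds e/4 twice.\<close>
  obtain m :: nat where m: "6 * (A + 1) / e < m" using reals_Archimedean2 by blast
  have m1: "m \<ge> 1" using m e A0 by (metis One_nat_def Suc_leI add_nonneg_pos divide_pos_pos mult_pos_pos of_nat_0_less_iff order_less_trans zero_less_numeral zero_less_one)
  define \<eta> where "\<eta> = 1 / real m"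
  have \<eta>: "0 < \<eta>" using m1 by (simp add: \<eta>_def)
  have Am: "A * (3 * \<eta>) \<le> e / 2"
  proof -
    have "6 * (A + 1) < m * e" using m e by (simp add: field_simps)
    then have "A * 3 \<le> e / 2 * m" using A0 by (simp add: field_simps)
    then show ?thesis using m1 by (simp add: \<eta>_def field_simps)
  qed
  have main: "\<bar>family_integral \<nu> f t - family_integral \<nu>' f t\<bar> \<le> e"
    if \<nu>: "prob_family \<nu>" and \<nu>': "prob_family \<nu>'"
      and close: "\<And>i (j::nat). i < d \<Longrightarrow> j \<le> m \<Longrightarrow> \<bar>family_integral \<nu> (copow i) (j / m) - family_integral \<nu>' (copow i) (j / m)\<bar> < \<eta>"
      and t: "t \<in> {0..1}" for \<nu> \<nu>' t
  proof -
    define j where "j = nat \<lfloor>real m * t\<rfloor>"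
    have jm: "j \<le> m" unfolding j_def using t by (intro floor_index_le) auto
    have jt: "real j / m \<le> t" "t - real j / m \<le> \<eta>" 
    proof -
      have "0 \<le> real m * t" using t by simp
      then have "real j \<le> m * t" "m * t \<le> real j + 1" unfolding j_def by linarith+
      then have "real j / m \<le> t" "t \<le> (real j + 1) / m"
        using m1 by (auto simp: pos_le_divide_eq pos_divide_le_eq mult.commute)
      then show "real j / m \<le> t" "t - real j / m \<le> \<eta>" by (auto simp: \<eta>_def add_divide_distrib)
    qed
    have cb: "\<bar>copow i x\<bar> \<le> 1" for i x using copow_test_fun[of i] by (auto simp: test_fun_def)
    have time: "\<bar>family_integral \<mu> (copow i) t - family_integral \<mu> (copow i) (j / m)\<bar> \<le> \<eta>" if "prob_family \<mu>" for \<mu> i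
      using family_integral_diff_time[OF that copow_continuous cb, of "j / m" t i] jt t by simp
    have each: "\<bar>family_integral \<nu> (copow i) t - family_integral \<nu>' (copow i) t\<bar> \<le> 3 * \<eta>" if "i < d" for i
      using close[OF that jm] time[OF \<nu>, of i] time[OF \<nu>', of i] by linarith
    have P: "family_integral \<mu> p t = B * t + (\<Sum>i<d. (- c i) * family_integral \<mu> (copow i) t)" if "prob_family \<mu>" for \<mu>
      unfolding p_def
      by (subst family_integral_add[OF that _ _ t])
        (auto intro!: continuous_intros copow_continuous
          simp: family_integral_const[OF that t] family_integral_sum[where f=copow and n=d and c="\<lambda>i. - c i", OF that copow_continuous t, simplified])
    have "family_integral \<nu> p t - family_integral \<nu>' p t = (\<Sum>i<d. (- c i) * (family_integral \<nu> (copow i) t - family_integral \<nu>' (copow i) t))"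
      unfolding P[OF \<nu>] P[OF \<nu>'] by (simp add: right_diff_distrib sum_subtractf sum_negf)
    also have "\<bar>\<dots>\<bar> \<le> (\<Sum>i<d. \<bar>c i\<bar> * (3 * \<eta>))"
      using each by (intro order_trans[OF sum_abs] sum_mono) (auto simp: abs_mult intro!: mult_left_mono)
    also have "\<dots> = A * (3 * \<eta>)" by (simp add: A_def sum_distrib_right)
    finally have pp: "\<bar>family_integral \<nu> p t - family_integral \<nu>' p t\<bar> \<le> e / 2" using Am by simp
    have fp: "\<bar>family_integral \<mu> f t - family_integral \<mu> p t\<bar> \<le> e / 4" if mu: "prob_family \<mu>" for \<mu>
    proof -
      have cd: "continuous_on {0..1} (\<lambda>x. f x - p x)" by (intro continuous_intros f cont_p)
      have "family_integral \<mu> f t = family_integral \<mu> (\<lambda>x. (f x - p x) + p x) t" by simp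
      also have "\<dots> = family_integral \<mu> (\<lambda>x. f x - p x) t + family_integral \<mu> p t"
        by (rule family_integral_add[OF mu cd cont_p t])
      finally show ?thesis
        using family_integral_abs_le[OF mu cd _ t, of "e / 4"] g(2) gp by (simp add: less_imp_le)
    qed
    show "\<bar>family_integral \<nu> f t - family_integral \<nu>' f t\<bar> \<le> e"
      using pp fp[OF \<nu>] fp[OF \<nu>'] by linarith
  qed
  show ?thesis by (rule that[OF \<eta> m1, of d]) (rule main)
qed

text \<open>A Lebesgue measurable g is replaced by a Borel version h. Vanishing integrals over
  half-lines extend to all Borel sets, as half-lines are a generating family stable under
  intersection.\<close>

lemma interval_integrals_zero_imp_AE_zero:
  fixes g :: "real \<Rightarrow> real"
  assumes g: "set_integrable lebesgue {0..1} g" and z: "\<And>t. t \<in> {0..1} \<Longrightarrow> (LINT s:{0..t}|lebesgue. g s) = 0"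
  shows "AE s in leb01. g s = 0"
proof -
  have "(\<lambda>s. indicator {0..1} s *\<^sub>R g s) \<in> borel_measurable lebesgue"
    using g unfolding set_integrable_def by (rule borel_measurable_integrable)
  then obtain h where h: "h \<in> borel_measurable lborel" "AE s in lborel. indicator {0..1} s *\<^sub>R g s = h s"
    using completion_ex_borel_measurable_real by blast
  have hm: "h \<in> borel_measurable borel" using h(1) by simp
  have ae: "AE s in lebesgue. indicator {0..1} s *\<^sub>R g s = h s" using AE_completion[OF h(2)] .
  have "integrable lebesgue h"
    using g h(1) unfolding set_integrable_def
    by (rule integrable_cong_AE_imp[OF _ measurable_completion ae])
  then have hi: "integrable lborel h" using integrable_completion[OF h(1)] by simp
  have hA: "(LINT s:A|lborel. h s) = (LINT s|lebesgue. indicator (A \<inter> {0..1}) s *\<^sub>R g s)" if A: "A \<in> sets borel" for A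
  proof -
    have "(LINT s:A|lborel. h s) = (LINT s|lebesgue. indicator A s *\<^sub>R h s)"
      unfolding set_lebesgue_integral_def using h(1) A by (intro integral_completion[symmetric]) auto
    also have "\<dots> = (LINT s|lebesgue. indicator A s *\<^sub>R (indicator {0..1} s *\<^sub>R g s))"
    proof (rule integral_cong_AE)
      show "AE s in lebesgue. indicator A s *\<^sub>R h s = indicator A s *\<^sub>R (indicator {0..1} s *\<^sub>R g s)"
        using ae by eventually_elim simp
      show "(\<lambda>s. indicator A s *\<^sub>R h s) \<in> borel_measurable lebesgue"
        using A h(1) by (intro measurable_completion) auto
      show "(\<lambda>s. indicator A s *\<^sub>R (indicator {0..1} s *\<^sub>R g s)) \<in> borel_measurable lebesgue"
        using A g unfolding set_integrable_def
        by (intro borel_measurable_scaleR borel_measurable_integrable[OF g[unfolded set_integrable_def]] measurable_completion) auto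
    qed
    finally show ?thesis by (simp add: indicator_inter_arith mult.assoc)
  qed
  have half: "(LINT s:{..t}|lborel. h s) = 0" for t
  proof -
    have "{..t} \<inter> {0..1} = (if t < 0 then {} else {0..min t 1})" by auto
    then show ?thesis
      using hA[of "{..t}"] z[of "min t 1"] by (simp add: set_lebesgue_integral_def split: if_splits)
  qed
  have univ: "(LINT s:UNIV|lborel. h s) = 0"
    using hA[of UNIV] z[of 1] by (simp add: set_lebesgue_integral_def)
  have si: "set_integrable lborel A h" if "A \<in> sets borel" for A
    using hi that integrable_mult_indicator[of A lborel h] by (simp add: set_integrable_def)
  have zero: "(LINT s:A|lborel. h s) = 0" if "A \<in> sets borel" for A
  proof -
    have "Int_stable (range (\<lambda>a::real. {..a}))" by (auto simp: Int_stable_def)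
    moreover have "range (\<lambda>a::real. {..a}) \<subseteq> Pow UNIV" by simp
    moreover have "A \<in> sigma_sets UNIV (range (\<lambda>a::real. {..a}))"
      using that by (subst (asm) borel_eq_atMost) auto
    ultimately show ?thesis
    proof (induct rule: sigma_sets_induct_disjoint)
      case (basic A) then show ?case using half by auto
    next
      case empty then show ?case by (simp add: set_lebesgue_integral_def)
    next
      case (compl A)
      then have A: "A \<in> sets borel" by (subst borel_eq_atMost) auto
      have "(LINT s:A \<union> (UNIV - A)|lborel. h s) = (LINT s:A|lborel. h s) + (LINT s:UNIV - A|lborel. h s)"
        using A by (intro set_integral_Un si) auto
      then show ?case using compl univ by simp
    next
      case (union A)
      have A: "A i \<in> sets borel" for i using union(2) by (subst borel_eq_atMost) auto
      have "(LINT s:(\<Union>i. A i)|lborel. h s) = (\<Sum>i. (LINT s:(A i)|lborel. h s))"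
        using A union(1) by (intro lebesgue_integral_countable_add si) (auto simp: disjoint_family_on_def)
      then show ?case using union(3) by simp
    qed
  qed
  have "AE s in lborel. h s = 0"
    by (rule density_unique_real[OF hi]) (use zero in \<open>auto simp: set_lebesgue_integral_def\<close>)
  then have "AE s in lebesgue. h s = 0" by (rule AE_completion)
  with ae have "AE s in lebesgue. s \<in> {0..1} \<longrightarrow> g s = 0" by eventually_elim (auto simp: indicator_def)
  then show ?thesis by (simp add: AE_restrict_space_iff)
qed

text \<open>Moments determine the integrals of continuous functions by Weierstrass, and these
  determine the distribution function.\<close>

lemma finite_measure_eqI_powers:
  assumes s: "sets M = sets (restrict_space borel {0..1::real})" "sets N = sets (restrict_space borel {0..1})"
    and f: "finite_measure M" "finite_measure N" and eq: "\<And>i::nat. (LINT x|M. x ^ i) = (LINT x|N. x ^ i)"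
  shows "M = N"
proof -
  have sp: "space M = {0..1}" "space N = {0..1}"
    using s[THEN sets_eq_imp_space_eq] by (auto simp: space_restrict_space)
  interpret M: finite_measure M by fact
  interpret N: finite_measure N by fact
  have pow: "integrable M (\<lambda>x. x ^ i)" "integrable N (\<lambda>x. x ^ i)" for i
    by (intro continuous_on_integrable s f continuous_intros)+
  have cont: "(LINT x|M. u x) = (LINT x|N. u x)" if u: "continuous_on {0..1} u" for u :: "real \<Rightarrow> real"
  proof (rule ccontr)
    assume ne: "(LINT x|M. u x) \<noteq> (LINT x|N. u x)"
    \<comment> \<open>The summand 1 keeps c positive even if both measures vanish, and makes the
      final inequality strict.\<close>
    define c where "c = measure M {0..1} + measure N {0..1} + 1"
    have c: "c > 0" unfolding c_def by (intro add_nonneg_pos add_nonneg_nonneg) auto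
    define e where "e = \<bar>(LINT x|M. u x) - (LINT x|N. u x)\<bar> / c"
    have e: "e > 0" using ne c by (simp add: e_def)
    obtain g where g: "real_polynomial_function g" "\<And>x. x \<in> {0..1} \<Longrightarrow> \<bar>u x - g x\<bar> < e"
      using Stone_Weierstrass_real_polynomial_function[OF _ u e] by auto
    obtain k n where gk: "g = (\<lambda>x. \<Sum>i\<le>n. k i * x ^ i)" using g(1) unfolding real_polynomial_function_iff_sum by blast
    have gc: "continuous_on {0..1} g" unfolding gk by (intro continuous_intros)
    have geq: "(LINT x|M. g x) = (LINT x|N. g x)" unfolding gk using pow eq by simp
    have near: "\<bar>(LINT x|Q. u x) - (LINT x|Q. g x)\<bar> \<le> e * measure Q {0..1}" if Q: "sets Q = sets (restrict_space borel {0..1})" "finite_measure Q" for Q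
    proof -
      have sq: "space Q = {0..1}" using sets_eq_imp_space_eq[OF Q(1)] by (simp add: space_restrict_space)
      have iu: "integrable Q u" "integrable Q g" using continuous_on_integrable Q u gc by auto
      interpret Q: finite_measure Q by fact
      have "(LINT x|Q. u x) - (LINT x|Q. g x) = (LINT x|Q. u x - g x)" using iu by simp
      also have "\<bar>\<dots>\<bar> \<le> (LINT x|Q. \<bar>u x - g x\<bar>)" using integral_norm_bound[of Q "\<lambda>x. u x - g x"] by simp
      also have "\<dots> \<le> (LINT x|Q. e)" using iu g(2) sq by (intro integral_mono) (auto intro: less_imp_le)
      finally show ?thesis using sq by (simp add: mult.commute)
    qed
    have "\<bar>(LINT x|M. u x) - (LINT x|N. u x)\<bar> \<le> e * measure M {0..1} + e * measure N {0..1}"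
      using near[OF s(1) f(1)] near[OF s(2) f(2)] geq by linarith
    also have "\<dots> < e * c" using e by (simp add: c_def algebra_simps)
    finally show False using c by (simp add: e_def)
  qed
  have half: "measure M ({..a} \<inter> {0..1}) = measure N ({..a} \<inter> {0..1})" for a
  proof -
    \<comment> \<open>A continuous ramp that is 1 up to a and falls to 0 with slope k; it decreases
      to the indicator of the half-line.\<close>
    define u where "u k x = max 0 (1 - real k * max 0 (x - a))" for k :: nat and x
    have uc: "continuous_on {0..1} (u k)" for k unfolding u_def by (intro continuous_intros)
    have ub: "\<bar>u k x\<bar> \<le> 1" for k x by (auto simp: u_def max_def)
    have lim: "(\<lambda>k. u k x) \<longlonglongrightarrow> indicator {..a} x" for x
    proof (cases "x \<le> a")
      case True then show ?thesis by (simp add: u_def max_def)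
    next
      case False
      obtain K :: nat where K: "1 / (x - a) < K" using reals_Archimedean2 by blast
      have "u k x = 0" if "k \<ge> K" for k
      proof -
        have "1 / (x - a) \<le> k" using K that by (meson less_imp_le of_nat_le_iff order_trans)
        then have "1 \<le> real k * (x - a)" using False by (simp add: field_simps)
        then show ?thesis using False by (simp add: u_def max_def)
      qed
      then have "eventually (\<lambda>k. u k x = 0) sequentially" by (auto simp: eventually_sequentially)
      then show ?thesis using False by (simp add: tendsto_eventually)
    qed
    have Q: "(\<lambda>k. LINT x|Q. u k x) \<longlonglongrightarrow> measure Q ({..a} \<inter> {0..1})"
      if Q: "sets Q = sets (restrict_space borel {0..1})" "finite_measure Q" for Q
    proof -
      have sq: "space Q = {0..1}" using sets_eq_imp_space_eq[OF Q(1)] by (simp add: space_restrict_space)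
      interpret Q: finite_measure Q by fact
      have "(\<lambda>k. LINT x|Q. u k x) \<longlonglongrightarrow> (LINT x|Q. indicator {..a} x)"
      proof (rule integral_dominated_convergence[where w="\<lambda>_. 1"])
        show "(\<lambda>x. indicator {..a} x :: real) \<in> borel_measurable Q"
          using measurable_restrict_space1[of "indicator {..a} :: real \<Rightarrow> real" borel borel "{0..1}"]
          by (simp add: measurable_cong_sets[OF Q(1) refl])
      qed (use lim ub continuous_on_borel_lb01[OF uc Q(1)] in auto)
      then show ?thesis using sq by simp
    qed
    show ?thesis using LIMSEQ_unique[OF Q[OF s(1) f(1)]] Q[OF s(2) f(2)] cont[OF uc] by simp
  qed
  have id: "(\<lambda>x. x) \<in> measurable M borel" "(\<lambda>x. x) \<in> measurable N borel"
    unfolding measurable_cong_sets[OF s(1) refl] measurable_cong_sets[OF s(2) refl]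
    by (rule measurable_restrict_space1, simp)+
  have fb: "finite_borel_measure (distr M borel (\<lambda>x. x))" "finite_borel_measure (distr N borel (\<lambda>x. x))"
    using M.finite_measure_distr[OF id(1)] N.finite_measure_distr[OF id(2)]
    by (auto simp: finite_borel_measure_def finite_borel_measure_axioms_def)
  have cd: "cdf (distr M borel (\<lambda>x. x)) = cdf (distr N borel (\<lambda>x. x))"
    using half sp by (auto simp: cdf_def fun_eq_iff measure_distr[OF id(1)] measure_distr[OF id(2)] vimage_def)
  have D: "distr M borel (\<lambda>x. x) = distr N borel (\<lambda>x. x)" by (rule cdf_unique'[OF fb cd])
  show "M = N"
  proof (rule measure_eqI_lb01)
    fix B :: "real set" assume B: "B \<in> sets borel"
    have "measure (distr M borel (\<lambda>x. x)) B = measure (distr N borel (\<lambda>x. x)) B" using D by simp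
    then show "(LINT x|M. indicator B x :: real) = (LINT x|N. indicator B x)"
      using B sp by (simp add: measure_distr[OF id(1)] measure_distr[OF id(2)])
  qed (use s f sets_lb01 in auto)
qed

section \<open>Convergence of the averages\<close>

text \<open>Deviation sets of a supremum over t are only covered by Borel sets, without checking
  their measurability: a set outside the sigma-algebra has measure 0 by default, so the bound holds
  in any case.\<close>

lemma measure_leb01_le:
  assumes U: "U \<in> sets lb01" and A: "A \<subseteq> U"
  shows "measure leb01 A \<le> measure lb01 U"
proof -
  have U': "U \<in> sets borel" "U \<subseteq> {0..1}" using U by (auto simp: sets_restrict_space)
  have eq: "measure leb01 U = measure lb01 U"
    using U' by (simp add: measure_restrict_space)
  have UL: "U \<in> fmeasurable leb01"
  proof (rule fmeasurableI)
    show "U \<in> sets leb01" using U' by (auto simp: sets_restrict_space)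
    have "emeasure leb01 U = emeasure lb01 U" using U' by (simp add: emeasure_restrict_space)
    then show "emeasure leb01 U < \<infinity>" by (simp add: lb01.emeasure_eq_measure)
  qed
  show ?thesis
  proof (cases "A \<in> sets leb01")
    case True then show ?thesis using measure_mono_fmeasurable[OF A True UL] eq by simp
  next
    case False then show ?thesis by (simp add: measure_notin_sets)
  qed
qed

lemma AE_leb01_iff: "(AE x in leb01. P x) \<longleftrightarrow> (AE x in lb01. P x)"
  by (simp add: AE_restrict_space_iff AE_completion_iff)

section \<open>From decreasing observables to continuous ones, uniformly in time\<close>

context array_setup begin

text \<open>Point masses along the orbit make \<open>zeta_n\<close> the time integral of a family of
  probability measures.\<close>

definition dirac :: "nat \<Rightarrow> real \<Rightarrow> real \<Rightarrow> real measure" where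
  "dirac n x s = return lb01 (orb (par n) (nat \<lfloor>real n * s\<rfloor>) x)"

lemma orb_par_in: "x \<in> {0..1} \<Longrightarrow> orb (par n) k x \<in> {0..1}"
  using orb_in[of "par n" x k] par_in by auto

lemma dirac_integral:
  fixes f :: "real \<Rightarrow> real"
  assumes "continuous_on {0..1} f" "x \<in> {0..1}"
  shows "(LINT y|dirac n x s. f y) = f (orb (par n) (nat \<lfloor>real n * s\<rfloor>) x)"
  unfolding dirac_def using orb_par_in[OF assms(2)] continuous_on_borel_lb01[OF assms(1) sets_lb01]
  by (intro integral_return) auto

lemma dirac_family: 
  assumes x: "x \<in> {0..1}" shows "prob_family (dirac n x)"
  unfolding prob_family_def measurable_family_def
proof (intro conjI ballI allI impI)
  show p: "prob_space (dirac n x s)" for s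
    unfolding dirac_def using orb_par_in[OF x] by (intro prob_space_return) auto
  show "finite_measure (dirac n x s)" for s using p by (rule prob_space.finite_measure)
  show "sets (dirac n x s) = sets (restrict_space borel {0..1})" for s by (simp add: dirac_def sets_lb01)
  fix f :: "real \<Rightarrow> real" assume f: "continuous_on {0..1} f"
  have "(\<lambda>s. nat \<lfloor>real n * s\<rfloor>) \<in> borel \<rightarrow>\<^sub>M count_space UNIV" by measurable
  from measurable_compose[OF this, of "\<lambda>k. f (orb (par n) k x)" borel]
  have "(\<lambda>s. f (orb (par n) (nat \<lfloor>real n * s\<rfloor>) x)) \<in> borel_measurable lborel" by simp
  then show "(\<lambda>s. LINT y|dirac n x s. f y) \<in> borel_measurable leb01"
    unfolding dirac_integral[OF f x] by (intro measurable_restrict_space1 measurable_completion)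
qed

lemma dirac_family_integral:
  fixes f :: "real \<Rightarrow> real"
  assumes "continuous_on {0..1} f" "x \<in> {0..1}" "t \<in> {0..1}"
  shows "family_integral (dirac n x) f t = (\<Sum>k\<le>n. weight n t k * f (orb (par n) k x))"
  unfolding family_integral_def dirac_integral[OF assms(1,2)] using assms(3) by (intro step_integral(2)) auto

lemma zeta_n_dirac:
  assumes "good n" "continuous_on {0..1} f" "x \<in> {0..1}" "t \<in> {0..1}"
  shows "zeta_n \<alpha> f n x t = family_integral (dirac n x) f t"
  using assms by (simp add: zeta_n_eq dirac_family_integral)

abbreviation \<mu>\<gamma> :: "real \<Rightarrow> real measure" where "\<mu>\<gamma> s \<equiv> SRB (\<gamma> s)"

lemma SRB_family: "prob_family \<mu>\<gamma>"
  unfolding prob_family_def measurable_family_def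
proof (intro conjI ballI allI impI)
  have i: "is_SRB (\<gamma> s) (\<mu>\<gamma> s)" if "s \<in> {0..1}" for s using is_SRB_SRB[OF b \<gamma>_in[OF that]] .
  then show "prob_space (\<mu>\<gamma> s)" "sets (\<mu>\<gamma> s) = sets (restrict_space borel {0..1})" if "s \<in> {0..1}" for s
    using that by (auto simp: is_SRB_def)
  then show "finite_measure (\<mu>\<gamma> s)" if "s \<in> {0..1}" for s using that by (intro prob_space.finite_measure)
  have sp: "space (\<mu>\<gamma> s) = {0..1}" if "s \<in> {0..1}" for s
    using i[OF that] sets_eq_imp_space_eq[of "\<mu>\<gamma> s" "restrict_space borel {0..1}"] by (simp add: is_SRB_def space_restrict_space)
  fix f :: "real \<Rightarrow> real" assume f: "continuous_on {0..1} f"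
  obtain C0 where C0: "\<And>x. x \<in> {0..1} \<Longrightarrow> \<bar>f x\<bar> \<le> C0"
    using compact_imp_bounded[OF compact_continuous_image[OF f]] by (force simp: bounded_iff)
  \<comment> \<open>Rescaling by C and extension by 0 bring f into the class of test functions
    bounded by 1; the maximum keeps C positive.\<close>
  define C where "C = max 1 C0"
  have C: "C > 0" "\<And>x. x \<in> {0..1} \<Longrightarrow> \<bar>f x\<bar> \<le> C" using C0 by (auto simp: C_def le_max_iff_disj)
  define \<psi> where "\<psi> x = indicator {0..1} x *\<^sub>R f x / C" for x
  have "f \<in> borel_measurable (restrict_space borel {0..1})" by (rule borel_measurable_continuous_on_restrict[OF f])
  then have "(\<lambda>x. indicator {0..1} x *\<^sub>R f x) \<in> borel_measurable borel"
    by (subst (asm) borel_measurable_restrict_space_iff) auto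
  then have 1: "\<psi> \<in> borel_measurable borel" unfolding \<psi>_def by measurable
  have 2: "\<bar>\<psi> x\<bar> \<le> 1" for x using C by (auto simp: \<psi>_def indicator_def)
  have "continuous_on {0..1} (\<lambda>x. f x / C)" using C(1) by (intro continuous_intros f) auto
  then have 3: "continuous_on {0..1} \<psi>"
    by (rule continuous_on_cong[THEN iffD1, rotated 2]) (auto simp: \<psi>_def)
  have m: "(\<lambda>s. C * (LINT x|\<mu>\<gamma> s. \<psi> x)) \<in> borel_measurable leb01"
    using SRB_integral_measurable[OF 1 2 3] by measurable
  have eq: "(LINT x|\<mu>\<gamma> s. f x) = C * (LINT x|\<mu>\<gamma> s. \<psi> x)" if "s \<in> {0..1}" for s
  proof -
    have "(LINT x|\<mu>\<gamma> s. f x) = (LINT x|\<mu>\<gamma> s. C * \<psi> x)"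
      using sp[OF that] C(1) by (intro Bochner_Integration.integral_cong) (auto simp: \<psi>_def)
    then show ?thesis by simp
  qed
  show "(\<lambda>s. LINT x|\<mu>\<gamma> s. f x) \<in> borel_measurable leb01"
    using m by (rule measurable_cong[THEN iffD1, rotated]) (simp add: eq)
qed

abbreviation dev_sup :: "(real \<Rightarrow> real) \<Rightarrow> nat \<Rightarrow> real \<Rightarrow> real" where
  "dev_sup f n x \<equiv> (SUP t\<in>{0..1}. \<bar>zeta_n \<alpha> f n x t - family_integral \<mu>\<gamma> f t\<bar>)"

lemma dev_sup_le:
  assumes "\<And>t. t \<in> {0..1} \<Longrightarrow> \<bar>zeta_n \<alpha> f n x t - family_integral \<mu>\<gamma> f t\<bar> \<le> e"
  shows "dev_sup f n x \<le> e" "0 \<le> dev_sup f n x"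
proof -
  show "dev_sup f n x \<le> e" using assms by (intro cSUP_least) auto
  have "bdd_above ((\<lambda>t. \<bar>zeta_n \<alpha> f n x t - family_integral \<mu>\<gamma> f t\<bar>) ` {0..1})" using assms by (intro bdd_aboveI2) auto
  then have "\<bar>zeta_n \<alpha> f n x 0 - family_integral \<mu>\<gamma> f 0\<bar> \<le> dev_sup f n x" by (intro cSUP_upper) auto
  then show "0 \<le> dev_sup f n x" by linarith
qed

lemma copow_control:
  fixes f :: "real \<Rightarrow> real"
  assumes f: "continuous_on {0..1} f" and e: "0 < e"
  obtains \<eta> d m where "0 < \<eta>" "m \<ge> (1::nat)"
    "\<And>n x t. good n \<Longrightarrow> x \<in> {0..1} \<Longrightarrow> t \<in> {0..1} \<Longrightarrow>
      (\<And>i (j::nat). i < d \<Longrightarrow> j \<le> m \<Longrightarrow> \<bar>S (copow i) n (j / m) x - family_integral \<mu>\<gamma> (copow i) (j / m)\<bar> < \<eta>) \<Longrightarrow>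
      \<bar>zeta_n \<alpha> f n x t - family_integral \<mu>\<gamma> f t\<bar> \<le> e"
proof (rule uniform_from_copow[OF f e])
  fix \<eta> :: real and d m :: nat
  assume \<eta>: "0 < \<eta>" and m: "m \<ge> 1" and u: "\<And>\<nu> \<nu>' t. prob_family \<nu> \<Longrightarrow> prob_family \<nu>' \<Longrightarrow>
      (\<And>i (j::nat). i < d \<Longrightarrow> j \<le> m \<Longrightarrow> \<bar>family_integral \<nu> (copow i) (j / m) - family_integral \<nu>' (copow i) (j / m)\<bar> < \<eta>) \<Longrightarrow>
      t \<in> {0..1} \<Longrightarrow> \<bar>family_integral \<nu> f t - family_integral \<nu>' f t\<bar> \<le> e"
  show thesis
  proof (rule that[OF \<eta> m, of d])
    fix n :: nat and x t :: real
    assume n: "good n" and x: "x \<in> {0..1}" and t: "t \<in> {0..1}"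
      and c: "\<And>i (j::nat). i < d \<Longrightarrow> j \<le> m \<Longrightarrow> \<bar>S (copow i) n (j / m) x - family_integral \<mu>\<gamma> (copow i) (j / m)\<bar> < \<eta>"
    have "real j / real m \<in> {0..1}" if "j \<le> m" for j using that m by auto
    then show "\<bar>zeta_n \<alpha> f n x t - family_integral \<mu>\<gamma> f t\<bar> \<le> e"
      unfolding zeta_n_dirac[OF n f x t] using c
      by (intro u dirac_family x SRB_family t) (simp add: dirac_family_integral[OF copow_continuous x])
  qed
qed

text \<open>A large supremum forces a deviation of one of finitely many observables at one of
  finitely many grid times; a union bound finishes.\<close>

theorem dev_sup_tendsto_prob:
  fixes f :: "real \<Rightarrow> real"
  assumes f: "continuous_on {0..1} f" and e: "0 < e"
  shows "(\<lambda>n. measure leb01 {x \<in> {0..1}. dev_sup f n x \<ge> e}) \<longlonglongrightarrow> 0"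
proof -
  obtain \<eta> d m where \<eta>: "0 < \<eta>" "m \<ge> (1::nat)" and c: "\<And>n x t. good n \<Longrightarrow> x \<in> {0..1} \<Longrightarrow> t \<in> {0..1} \<Longrightarrow>
      (\<And>i (j::nat). i < d \<Longrightarrow> j \<le> m \<Longrightarrow> \<bar>S (copow i) n (j / m) x - family_integral \<mu>\<gamma> (copow i) (j / m)\<bar> < \<eta>) \<Longrightarrow>
      \<bar>zeta_n \<alpha> f n x t - family_integral \<mu>\<gamma> f t\<bar> \<le> e / 2"
    by (rule copow_control[OF f, of "e / 2"]) (use e in auto)
  let ?B = "\<lambda>n i j. {x \<in> {0..1}. \<bar>S (copow i) n (real j / real m) x - family_integral \<mu>\<gamma> (copow i) (real j / real m)\<bar> \<ge> \<eta>}"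
  have Bm: "?B n i j \<in> sets lb01" for n i j
  proof -
    have "(\<lambda>x. S (copow i) n (real j / real m) x) \<in> borel_measurable lb01" by (intro borel_imp_lb01 S_measurable copow_test_fun)
    then have "{x \<in> space lb01. \<bar>S (copow i) n (real j / real m) x - family_integral \<mu>\<gamma> (copow i) (real j / real m)\<bar> \<ge> \<eta>} \<in> sets lb01"
      by measurable
    then show ?thesis by simp
  qed
  have "eventually (\<lambda>n. norm (measure leb01 {x \<in> {0..1}. dev_sup f n x \<ge> e}) \<le> (\<Sum>p\<in>{..<d} \<times> {..m}. measure lb01 (?B n (fst p) (snd p)))) sequentially"
    using eventually_good
  proof eventually_elim
    case (elim n)
    have sub: "{x \<in> {0..1}. dev_sup f n x \<ge> e} \<subseteq> (\<Union>p\<in>{..<d} \<times> {..m}. ?B n (fst p) (snd p))"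
    proof
      fix x assume "x \<in> {x \<in> {0..1}. dev_sup f n x \<ge> e}"
      then have x: "x \<in> {0..1}" "dev_sup f n x \<ge> e" by auto
      show "x \<in> (\<Union>p\<in>{..<d} \<times> {..m}. ?B n (fst p) (snd p))"
      proof (rule ccontr)
        assume nx: "x \<notin> (\<Union>p\<in>{..<d} \<times> {..m}. ?B n (fst p) (snd p))"
        have "\<bar>S (copow i) n (real j / real m) x - family_integral \<mu>\<gamma> (copow i) (real j / real m)\<bar> < \<eta>" if "i < d" "j \<le> m" for i j
        proof -
          have "(i, j) \<in> {..<d} \<times> {..m}" using that by simp
          then have "x \<notin> ?B n i j" using nx by force
          then show ?thesis using x(1) by simp
        qed
        then have "dev_sup f n x \<le> e / 2" by (intro dev_sup_le c[OF elim x(1)])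
        then show False using x(2) e by simp
      qed
    qed
    have "measure leb01 {x \<in> {0..1}. dev_sup f n x \<ge> e} \<le> measure lb01 (\<Union>p\<in>{..<d} \<times> {..m}. ?B n (fst p) (snd p))"
      by (rule measure_leb01_le[OF _ sub]) (intro sets.finite_UN Bm, simp)
    also have "\<dots> \<le> (\<Sum>p\<in>{..<d} \<times> {..m}. measure lb01 (?B n (fst p) (snd p)))"
      by (intro measure_UNION_le Bm) simp
    finally show ?case by simp
  qed
  moreover have "(\<lambda>n. \<Sum>p\<in>{..<d} \<times> {..m}. measure lb01 (?B n (fst p) (snd p))) \<longlonglongrightarrow> (\<Sum>p\<in>{..<d} \<times> {..m}. 0)"
    using \<eta> by (intro tendsto_sum S_tendsto_prob copow_test_fun copow_continuous) auto
  ultimately show ?thesis by (simp add: Lim_null_comparison)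
qed

text \<open>Countably many conditions that do not mention f. The exceptional null set is therefore
  the same for all continuous f, which a basin requires.\<close>

definition typical :: "real \<Rightarrow> bool" where
  "typical x \<longleftrightarrow> x \<in> {0..1} \<and> (\<forall>i. \<forall>t\<in>\<rat> \<inter> {0..1}. (\<lambda>n. S (copow i) n t x) \<longlonglongrightarrow> family_integral \<mu>\<gamma> (copow i) t)"

lemma typical_AE:
  assumes b2: "b < 1/2" shows "AE x in lb01. typical x"
proof -
  have "AE x in lb01. \<forall>i. \<forall>t\<in>\<rat> \<inter> {0..1}. (\<lambda>n. S (copow i) n t x) \<longlonglongrightarrow> family_integral \<mu>\<gamma> (copow i) t"
    unfolding AE_all_countable
    by (intro allI AE_ball_countable[THEN iffD2] ballI S_tendsto_AE[OF b2] copow_test_fun copow_continuous)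
      (auto intro: countable_rat countable_subset[of _ "\<rat>"])
  with AE_space show ?thesis by eventually_elim (simp add: typical_def)
qed

lemma typical_uniform:
  fixes f :: "real \<Rightarrow> real"
  assumes x: "typical x" and f: "continuous_on {0..1} f" and e: "0 < e"
  shows "eventually (\<lambda>n. \<forall>t\<in>{0..1}. \<bar>zeta_n \<alpha> f n x t - family_integral \<mu>\<gamma> f t\<bar> \<le> e) sequentially"
proof -
  obtain \<eta> d m where \<eta>: "0 < \<eta>" "m \<ge> (1::nat)" and c: "\<And>n x t. good n \<Longrightarrow> x \<in> {0..1} \<Longrightarrow> t \<in> {0..1} \<Longrightarrow>
      (\<And>i (j::nat). i < d \<Longrightarrow> j \<le> m \<Longrightarrow> \<bar>S (copow i) n (j / m) x - family_integral \<mu>\<gamma> (copow i) (j / m)\<bar> < \<eta>) \<Longrightarrow>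
      \<bar>zeta_n \<alpha> f n x t - family_integral \<mu>\<gamma> f t\<bar> \<le> e"
    by (rule copow_control[OF f e]) auto
  have x01: "x \<in> {0..1}" using x by (simp add: typical_def)
  have "eventually (\<lambda>n. \<forall>p\<in>{..<d} \<times> {..m}. \<bar>S (copow (fst p)) n (real (snd p) / real m) x - family_integral \<mu>\<gamma> (copow (fst p)) (real (snd p) / real m)\<bar> < \<eta>) sequentially"
  proof (rule eventually_ball_finite, simp, rule ballI)
    fix p assume p: "p \<in> {..<d} \<times> {..m}"
    then have "real (snd p) / real m \<in> \<rat> \<inter> {0..1}" using \<eta>(2) by auto
    then have "(\<lambda>n. S (copow (fst p)) n (real (snd p) / real m) x) \<longlonglongrightarrow> family_integral \<mu>\<gamma> (copow (fst p)) (real (snd p) / real m)"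
      using x by (simp add: typical_def)
    from tendstoD[OF this \<eta>(1)]
    show "eventually (\<lambda>n. \<bar>S (copow (fst p)) n (real (snd p) / real m) x - family_integral \<mu>\<gamma> (copow (fst p)) (real (snd p) / real m)\<bar> < \<eta>) sequentially"
      by (simp add: dist_norm)
  qed
  then show ?thesis using eventually_good
  proof eventually_elim
    case (elim n)
    have "\<bar>S (copow i) n (real j / real m) x - family_integral \<mu>\<gamma> (copow i) (real j / real m)\<bar> < \<eta>" if "i < d" "j \<le> m" for i j
      using elim(1)[rule_format, of "(i, j)"] that by simp
    then show ?case by (intro ballI c[OF elim(2) x01])
  qed
qed

lemma typical_dev_sup:
  fixes f :: "real \<Rightarrow> real"
  assumes x: "typical x" and f: "continuous_on {0..1} f"
  shows "(\<lambda>n. dev_sup f n x) \<longlonglongrightarrow> 0"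
  unfolding tendsto_iff
proof (intro allI impI)
  fix e :: real assume e: "0 < e"
  from typical_uniform[OF x f, of "e / 2"] e
  have "eventually (\<lambda>n. \<forall>t\<in>{0..1}. \<bar>zeta_n \<alpha> f n x t - family_integral \<mu>\<gamma> f t\<bar> \<le> e / 2) sequentially" by simp
  then show "eventually (\<lambda>n. dist (dev_sup f n x) 0 < e) sequentially"
  proof eventually_elim
    case (elim n)
    have "dev_sup f n x \<le> e / 2" "0 \<le> dev_sup f n x" by (intro dev_sup_le; use elim in blast)+
    then show ?case using e unfolding dist_norm real_norm_def by linarith
  qed
qed

lemma typical_pointwise:
  fixes f :: "real \<Rightarrow> real"
  assumes x: "typical x" and f: "continuous_on {0..1} f" and t: "t \<in> {0..1}"
  shows "(\<lambda>n. zeta_n \<alpha> f n x t) \<longlonglongrightarrow> family_integral \<mu>\<gamma> f t"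
  unfolding tendsto_iff
proof (intro allI impI)
  fix e :: real assume e: "0 < e"
  from typical_uniform[OF x f, of "e / 2"] e
  have "eventually (\<lambda>n. \<forall>t\<in>{0..1}. \<bar>zeta_n \<alpha> f n x t - family_integral \<mu>\<gamma> f t\<bar> \<le> e / 2) sequentially" by simp
  then show "eventually (\<lambda>n. dist (zeta_n \<alpha> f n x t) (family_integral \<mu>\<gamma> f t) < e) sequentially"
  proof eventually_elim
    case (elim n)
    then have "\<bar>zeta_n \<alpha> f n x t - family_integral \<mu>\<gamma> f t\<bar> \<le> e / 2" using t by blast
    then show ?case using e unfolding dist_norm real_norm_def by linarith
  qed
qed

lemma full_basin:
  assumes b2: "b < 1/2"
  shows "\<exists>A. is_basin \<alpha> \<mu>\<gamma> A \<and> measure leb01 A = 1 \<and> (\<forall>x\<in>A. typical x)"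
proof -
  obtain N where N: "{x \<in> space lb01. \<not> typical x} \<subseteq> N" "emeasure lb01 N = 0" "N \<in> sets lb01"
    using AE_E[OF typical_AE[OF b2]] by blast
  define A where "A = {0..1} - N"
  have A: "A \<in> sets lb01" using N(3) sets.top[of lb01] by (simp add: A_def)
  have typA: "typical x" if "x \<in> A" for x using that N(1) by (auto simp: A_def)
  have m: "measure lb01 A = 1"
    using lb01.prob_compl[OF N(3)] N(2) by (simp add: A_def measure_def)
  have A': "A \<in> sets borel" "A \<subseteq> {0..1}" using A by (auto simp: sets_restrict_space)
  have mA: "measure leb01 A = 1"
    using m A' by (simp add: measure_restrict_space)
  have "is_basin \<alpha> \<mu>\<gamma> A"
    unfolding is_basin_def using mA A' typA typical_pointwise by (auto simp: sets_restrict_space)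
  then show ?thesis using mA typA by blast
qed

text \<open>A basin has positive measure, so it meets the basin of full measure. At a common point
  both families are limits of the same averages, so all their time integrals agree; each moment then
  agrees for almost all times, and countably many moments determine the measures.\<close>

lemma physical_unique:
  assumes b2: "b < 1/2" and \<mu>: "physical_family \<alpha> \<mu>"
  shows "AE t in leb01. \<mu> t = \<mu>\<gamma> t"
proof -
  obtain A where A: "is_basin \<alpha> \<mu>\<gamma> A" "measure leb01 A = 1" "\<And>x. x \<in> A \<Longrightarrow> typical x" using full_basin[OF b2] by blast
  obtain B where B: "is_basin \<alpha> \<mu> B" and mf: "measurable_family \<mu>" using \<mu> by (auto simp: physical_family_def)
  have "A \<inter> B \<noteq> {}"
  proof
    assume AB: "A \<inter> B = {}"
    have s: "A \<in> sets leb01" "B \<in> sets leb01" "measure leb01 B > 0" using A(1) B by (auto simp: is_basin_def)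
    have e1: "emeasure leb01 (space leb01) = 1" by (simp add: emeasure_restrict_space)
    interpret P: prob_space leb01 by (rule prob_spaceI) (rule e1)
    have "measure leb01 (A \<union> B) = measure leb01 A + measure leb01 B"
      by (rule P.finite_measure_Union[OF s(1,2) AB])
    then show False using P.prob_le_1[of "A \<union> B"] A(2) s(3) by linarith
  qed
  then obtain x where x: "typical x" "x \<in> B" using A(3) by auto
  have eq: "family_integral \<mu> f t = family_integral \<mu>\<gamma> f t" if f: "continuous_on {0..1} f" and t: "t \<in> {0..1}" for f :: "real \<Rightarrow> real" and t
  proof (rule LIMSEQ_unique)
    show "(\<lambda>n. zeta_n \<alpha> f n x t) \<longlonglongrightarrow> family_integral \<mu> f t" using B x(2) f t by (simp add: is_basin_def)
    show "(\<lambda>n. zeta_n \<alpha> f n x t) \<longlonglongrightarrow> family_integral \<mu>\<gamma> f t" by (rule typical_pointwise[OF x(1) f t])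
  qed
  have fin: "finite_measure (\<mu> t)" "sets (\<mu> t) = sets (restrict_space borel {0..1})" if "t \<in> {0..1}" for t
    using mf that by (auto simp: measurable_family_def)
  have meas: "(\<lambda>s. indicator {0..1} s *\<^sub>R (LINT x|\<mu> s. f x)) \<in> borel_measurable lebesgue"
    if "continuous_on {0..1} f" for f :: "real \<Rightarrow> real"
  proof -
    have "(\<lambda>s. LINT x|\<mu> s. f x) \<in> borel_measurable leb01" using mf that by (simp add: measurable_family_def)
    then show ?thesis by (subst (asm) borel_measurable_restrict_space_iff) auto
  qed
  \<comment> \<open>The total masses are integrable because the integral of a function that is not
    integrable is \<open>0\<close> by convention, whereas here it is \<open>1\<close>.\<close>
  have I1: "set_integrable lebesgue {0..1} (\<lambda>s. LINT x|\<mu> s. (1::real))"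
  proof (rule ccontr)
    assume "\<not> set_integrable lebesgue {0..1} (\<lambda>s. LINT x|\<mu> s. (1::real))"
    then have "family_integral \<mu> (\<lambda>_. 1) 1 = 0"
      unfolding family_integral_def set_lebesgue_integral_def set_integrable_def by (rule not_integrable_integral_eq)
    moreover have "family_integral \<mu> (\<lambda>_. 1) 1 = 1"
      using eq[of "\<lambda>_. 1" 1] family_integral_const[OF SRB_family, of 1 1] by simp
    ultimately show False by simp
  qed
  have I: "set_integrable lebesgue {0..1} (\<lambda>s. LINT x|\<mu> s. x ^ i)" for i :: nat
    unfolding set_integrable_def
  proof (rule Bochner_Integration.integrable_bound[OF I1[unfolded set_integrable_def]])
    show "(\<lambda>s. indicator {0..1} s *\<^sub>R (LINT x|\<mu> s. x ^ i)) \<in> borel_measurable lebesgue"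
      by (intro meas continuous_intros)
    have "\<bar>LINT x|\<mu> s. x ^ i\<bar> \<le> (LINT x|\<mu> s. 1)" if s: "s \<in> {0..1}" for s
    proof -
      have sp: "space (\<mu> s) = {0..1}" using sets_eq_imp_space_eq[OF fin(2)[OF s]] by (simp add: space_restrict_space)
      have i: "integrable (\<mu> s) (\<lambda>x. x ^ i)" "integrable (\<mu> s) (\<lambda>x. 1::real)"
        by (intro continuous_on_integrable fin s continuous_intros)+
      have "\<bar>LINT x|\<mu> s. x ^ i\<bar> \<le> (LINT x|\<mu> s. \<bar>x ^ i\<bar>)" using integral_norm_bound[of "\<mu> s" "\<lambda>x. x ^ i"] by simp
      also have "\<dots> \<le> (LINT x|\<mu> s. 1)" using i sp by (intro integral_mono integrable_abs) (auto simp: power_le_one)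
      finally show ?thesis .
    qed
    then show "AE s in lebesgue. norm (indicator {0..1} s *\<^sub>R (LINT x|\<mu> s. x ^ i)) \<le> norm (indicator {0..1} s *\<^sub>R (LINT x|\<mu> s. (1::real)))"
      by (intro AE_I2) (force simp: indicator_def)
  qed
  have ae: "AE s in leb01. (LINT x|\<mu> s. x ^ i) - (LINT x|\<mu>\<gamma> s. x ^ i) = 0" for i :: nat
  proof (rule interval_integrals_zero_imp_AE_zero)
    have c: "continuous_on {0..1} (\<lambda>x::real. x ^ i)" by (intro continuous_intros)
    have J: "set_integrable lebesgue {0..t} (\<lambda>s. LINT x|\<mu> s. x ^ i)" "set_integrable lebesgue {0..t} (\<lambda>s. LINT x|\<mu>\<gamma> s. x ^ i)" if "t \<in> {0..1}" for t
      using set_integrable_subset[OF I[of i], of "{0..t}"] family_set_integrable[OF SRB_family c, of t] that by auto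
    show "set_integrable lebesgue {0..1} (\<lambda>s. (LINT x|\<mu> s. x ^ i) - (LINT x|\<mu>\<gamma> s. x ^ i))"
      using J[of 1] by (intro set_integral_diff) auto
    show "(LINT s:{0..t}|lebesgue. (LINT x|\<mu> s. x ^ i) - (LINT x|\<mu>\<gamma> s. x ^ i)) = 0" if t: "t \<in> {0..1}" for t
      using set_integral_diff(2)[OF J[OF t]] eq[OF c t] by (simp add: family_integral_def)
  qed
  have "AE s in leb01. \<forall>i::nat. (LINT x|\<mu> s. x ^ i) - (LINT x|\<mu>\<gamma> s. x ^ i) = 0"
    unfolding AE_all_countable using ae by blast
  with AE_space show ?thesis
  proof eventually_elim
    case (elim s)
    then have s: "s \<in> {0..1}" by simp
    show ?case
      by (rule finite_measure_eqI_powers) (use fin[OF s] elim family_sets[OF SRB_family s] family_finite[OF SRB_family s] in auto)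
  qed
qed

end

section \<open>From the hypotheses on the curve and the array to the setup\<close>

lemma interval_frontier_finite:
  fixes I :: "real set" assumes "is_interval I" "bounded I" shows "finite (I - interior I)"
proof (rule finite_subset)
  show "I - interior I \<subseteq> {Inf I, Sup I}"
  proof
    fix s assume s: "s \<in> I - interior I"
    have bd: "bdd_below I" "bdd_above I" using assms(2) by (auto intro: bounded_imp_bdd_below bounded_imp_bdd_above)
    show "s \<in> {Inf I, Sup I}"
    proof (rule ccontr)
      assume "s \<notin> {Inf I, Sup I}"
      moreover have "Inf I \<le> s" "s \<le> Sup I" using s bd by (auto intro: cInf_lower cSup_upper)
      ultimately have "Inf I < s" "s < Sup I" by auto
      then obtain x y where xy: "x \<in> I" "x < s" "y \<in> I" "s < y"
        using s bd by (metis DiffD1 cInf_less_iff empty_iff less_cSup_iff)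
      have "{x<..<y} \<subseteq> I"
        using xy assms(1) unfolding is_interval_1 by (meson greaterThanLessThan_iff less_imp_le subsetI)
      then have "{x<..<y} \<subseteq> interior I" by (rule interior_maximal) simp
      then show False using s xy by auto
    qed
  qed
qed simp

text \<open>F consists of those points of the pieces that are not interior to them, at most two per
  piece; in the interior of a piece the Hoelder bound gives continuity.\<close>

lemma piecewise_holder_continuous:
  assumes g: "piecewise_holder \<theta> g" and \<theta>: "0 < \<theta>"
  obtains F where "finite F" "\<And>s. s \<in> {0..1} - F \<Longrightarrow> continuous (at s within {0..1}) g"
proof -
  obtain P where P: "finite P" "partition_on {0..1} P" and I: "\<And>I. I \<in> P \<Longrightarrow> is_interval I \<and> holder_on \<theta> I g"
    using g by (auto simp: piecewise_holder_def)
  have UP: "\<Union>P = {0..1}" using P(2) by (simp add: partition_on_def)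
  define F where "F = (\<Union>I\<in>P. I - interior I)"
  have "finite F" unfolding F_def
  proof (intro finite_UN_I P(1) interval_frontier_finite)
    fix J assume J: "J \<in> P"
    show "is_interval J" using I[OF J] by simp
    show "bounded J" using UP J by (intro bounded_subset[of "{0..1::real}" J]) auto
  qed
  moreover have "continuous (at s within {0..1}) g" if s: "s \<in> {0..1} - F" for s
  proof -
    have "s \<in> \<Union>P" using s UP by simp
    then obtain J where J: "J \<in> P" "s \<in> J" by blast
    then have si: "s \<in> interior J" using s by (auto simp: F_def)
    obtain C where C: "\<And>u v. u \<in> J \<Longrightarrow> v \<in> J \<Longrightarrow> \<bar>g u - g v\<bar> \<le> C * \<bar>u - v\<bar> powr \<theta>"
      using I[OF J(1)] by (auto simp: holder_on_def)
    have "(g \<longlongrightarrow> g s) (at s)"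
    proof (rule LIM_zero_cancel, rule Lim_null_comparison)
      have "eventually (\<lambda>u. u \<in> interior J) (at s)" using si by (intro eventually_at_in_open') auto
      then show "eventually (\<lambda>u. norm (g u - g s) \<le> C * \<bar>u - s\<bar> powr \<theta>) (at s)"
        by eventually_elim (use C J(2) interior_subset[of J] in auto)
      have "((\<lambda>u. C * \<bar>u - s\<bar> powr \<theta>) \<longlongrightarrow> C * 0 powr \<theta>) (at s)"
        using \<theta> by (intro tendsto_intros tendsto_powr' tendsto_eq_intros) auto
      then show "((\<lambda>u. C * \<bar>u - s\<bar> powr \<theta>) \<longlongrightarrow> 0) (at s)" by simp
    qed
    then show ?thesis unfolding continuous_within by (rule tendsto_within_subset) simp
  qed
  ultimately show ?thesis using that by blast
qed

lemma powr_convergent_imp_tendsto_0: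
  fixes D :: "nat \<Rightarrow> real"
  assumes "convergent (\<lambda>n. real n powr \<theta> * D n)" "0 < \<theta>" shows "D \<longlonglongrightarrow> 0"
proof -
  obtain l where l: "(\<lambda>n. real n powr \<theta> * D n) \<longlonglongrightarrow> l" using assms(1) by (auto simp: convergent_def)
  have "(\<lambda>n. real n powr - \<theta>) \<longlonglongrightarrow> 0" using assms(2) by (intro tendsto_neg_powr filterlim_real_sequentially) auto
  from tendsto_mult[OF l this] have "(\<lambda>n. real n powr \<theta> * D n * real n powr - \<theta>) \<longlonglongrightarrow> 0" by simp
  then show ?thesis
  proof (rule Lim_transform_eventually)
    show "eventually (\<lambda>n. real n powr \<theta> * D n * real n powr - \<theta> = D n) sequentially"
      using eventually_ge_at_top[of 1] by eventually_elim (simp add: powr_minus)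
  qed
qed

text \<open>Every entry lies within \<open>D n\<close> of a value of the curve, namely at time k/n.
  The slack c - \<beta> absorbs this error as soon as D n < c - \<beta>.\<close>

lemma array_setup_exists:
  fixes \<alpha> :: "nat \<Rightarrow> nat \<Rightarrow> real" and \<gamma> :: "real \<Rightarrow> real" and \<theta> \<beta> c :: real
  assumes \<alpha>: "\<And>n k. n \<ge> 1 \<Longrightarrow> k \<le> n \<Longrightarrow> \<alpha> n k \<in> {0..1}"
    and \<gamma>: "\<gamma> ` {0..1} \<subseteq> {0..1}" and \<theta>: "\<theta> \<in> {0<..1}" and ph: "piecewise_holder \<theta> \<gamma>"
    and \<beta>: "0 < \<beta>" and cl: "closure (\<gamma> ` {0..1}) \<subseteq> {0..\<beta>}"
    and conv: "convergent (\<lambda>n. real n powr \<theta> * (SUP t\<in>{0..1}. \<bar>\<alpha> n (nat \<lfloor>real n * t\<rfloor>) - \<gamma> t\<bar>))"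
    and c: "\<beta> < c" "c < 1"
  shows "\<exists>D F. array_setup \<alpha> \<gamma> c D F"
proof -
  define D where "D n = (SUP t\<in>{0..1}. \<bar>\<alpha> n (nat \<lfloor>real n * t\<rfloor>) - \<gamma> t\<bar>)" for n
  have D: "D \<longlonglongrightarrow> 0" using powr_convergent_imp_tendsto_0[OF conv] \<theta> by (simp add: D_def[abs_def])
  have g: "\<gamma> t \<in> {0..\<beta>}" if "t \<in> {0..1}" for t using cl closure_subset[of "\<gamma> ` {0..1}"] that by blast
  have near: "\<bar>\<alpha> n (nat \<lfloor>real n * t\<rfloor>) - \<gamma> t\<bar> \<le> D n" if n: "n \<ge> 1" and t: "t \<in> {0..1}" for n t
    unfolding D_def
  \<comment> \<open>The supremum is an upper bound only if the set is bounded above; both numbers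
    lie in [0,1], so 1 is a bound.\<close>
  proof (rule cSUP_upper[OF t], rule bdd_aboveI2)
    fix u :: real assume u: "u \<in> {0..1}"
    have "\<alpha> n (nat \<lfloor>real n * u\<rfloor>) \<in> {0..1}" using u by (intro \<alpha> n floor_index_le) auto
    moreover have "\<gamma> u \<in> {0..1}" using \<gamma> u by blast
    ultimately show "\<bar>\<alpha> n (nat \<lfloor>real n * u\<rfloor>) - \<gamma> u\<bar> \<le> 1" by (auto simp: abs_le_iff)
  qed
  obtain F where F: "finite F" "\<And>s. s \<in> {0..1} - F \<Longrightarrow> continuous (at s within {0..1}) \<gamma>"
    using piecewise_holder_continuous[OF ph] \<theta> by auto
  have "eventually (\<lambda>n. D n < c - \<beta>) sequentially" using D c by (intro order_tendstoD) auto
  then have ev: "eventually (\<lambda>n. \<forall>k\<le>n. \<alpha> n k \<in> {0..c}) sequentially" using eventually_ge_at_top[of 1]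
  proof eventually_elim
    case (elim n)
    show ?case
    proof (intro allI impI)
      fix k assume k: "k \<le> n"
      have t: "real k / n \<in> {0..1}" using k elim by auto
      have "real n * (real k / n) = real k" using elim by simp
      then have "nat \<lfloor>real n * (real k / n)\<rfloor> = k" by simp
      then have "\<bar>\<alpha> n k - \<gamma> (real k / n)\<bar> \<le> D n" using near[OF elim(2) t] by simp
      then show "\<alpha> n k \<in> {0..c}" using g[OF t] elim(1) \<alpha>[OF elim(2) k] by auto
    qed
  qed
  have "array_setup \<alpha> \<gamma> c D F"
  proof
    show "0 < c" "c < 1" using c \<beta> by auto
    show "\<gamma> t \<in> {0..c}" if "t \<in> {0..1}" for t using g[OF that] c by auto
  qed (use near D ev F in auto)
  then show ?thesis by blast
qed

theorem theorem1p4: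
  fixes \<alpha> :: "nat \<Rightarrow> nat \<Rightarrow> real" and \<gamma> :: "real \<Rightarrow> real" and \<theta> \<beta> :: real
  assumes "\<And>n k. n \<ge> 1 \<Longrightarrow> k \<le> n \<Longrightarrow> \<alpha> n k \<in> {0..1}"
    and "\<gamma> ` {0..1} \<subseteq> {0..1}"
    and "\<theta> \<in> {0<..1}"
    and "piecewise_holder \<theta> \<gamma>"
    and "\<beta> \<in> {0<..<1}"
    and "closure (\<gamma> ` {0..1}) \<subseteq> {0..\<beta>}"
    and "convergent (\<lambda>n. real n powr \<theta> * (SUP t\<in>{0..1}. \<bar>\<alpha> n (nat \<lfloor>real n * t\<rfloor>) - \<gamma> t\<bar>))"
  shows
    "(\<beta> \<ge> 1/2 \<longrightarrow>
       (\<forall>f. continuous_on {0..1} f \<longrightarrow>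
         (\<forall>\<epsilon>>0. (\<lambda>n. measure leb01 {x\<in>{0..1}.
             (SUP t\<in>{0..1}. \<bar>zeta_n \<alpha> f n x t - family_integral (\<lambda>s. SRB (\<gamma> s)) f t\<bar>) \<ge> \<epsilon>})
           \<longlonglongrightarrow> 0))) \<and>
     (\<beta> < 1/2 \<longrightarrow>
       (\<forall>f. continuous_on {0..1} f \<longrightarrow>
         (AE x in leb01. (\<lambda>n. SUP t\<in>{0..1}.
             \<bar>zeta_n \<alpha> f n x t - family_integral (\<lambda>s. SRB (\<gamma> s)) f t\<bar>) \<longlonglongrightarrow> 0)) \<and>
       physical_family \<alpha> (\<lambda>t. SRB (\<gamma> t)) \<and>
       (\<forall>\<mu>. physical_family \<alpha> \<mu> \<longrightarrow> (AE t in leb01. \<mu> t = SRB (\<gamma> t))) \<and>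
       (\<exists>A. is_basin \<alpha> (\<lambda>t. SRB (\<gamma> t)) A \<and> measure leb01 A = 1))"
proof (intro conjI impI)
  \<comment> \<open>Any bound strictly between \<beta> and 1 leaves room for the error of the array;
    the midpoint is taken.\<close>
  have "\<beta> < (\<beta> + 1) / 2" "(\<beta> + 1) / 2 < 1" "0 < \<beta>" using assms(5) by auto
  then obtain D F where "array_setup \<alpha> \<gamma> ((\<beta> + 1) / 2) D F"
    using array_setup_exists[OF assms(1-4) _ assms(6,7)] by blast
  then interpret array_setup \<alpha> \<gamma> "(\<beta> + 1) / 2" D F .
  show "\<forall>f. continuous_on {0..1} f \<longrightarrow>
         (\<forall>\<epsilon>>0. (\<lambda>n. measure leb01 {x\<in>{0..1}.
             (SUP t\<in>{0..1}. \<bar>zeta_n \<alpha> f n x t - family_integral (\<lambda>s. SRB (\<gamma> s)) f t\<bar>) \<ge> \<epsilon>})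
           \<longlonglongrightarrow> 0)"
    using dev_sup_tendsto_prob by blast
next
  assume \<beta>: "\<beta> < 1/2"
  \<comment> \<open>The bound has to exceed \<beta> and still stay below 1/2 for the summable
    rate.\<close>
  define c where "c = (\<beta> + 1/2) / 2"
  have c: "\<beta> < c" "c < 1/2" "c < 1" "0 < \<beta>" using assms(5) \<beta> by (auto simp: c_def)
  then obtain D F where "array_setup \<alpha> \<gamma> c D F"
    using array_setup_exists[OF assms(1-4) _ assms(6,7)] by blast
  then interpret array_setup \<alpha> \<gamma> c D F .
  have "AE x in leb01. typical x" unfolding AE_leb01_iff by (rule typical_AE[OF c(2)])
  then show "\<forall>f. continuous_on {0..1} f \<longrightarrow>
         (AE x in leb01. (\<lambda>n. SUP t\<in>{0..1}.
             \<bar>zeta_n \<alpha> f n x t - family_integral (\<lambda>s. SRB (\<gamma> s)) f t\<bar>) \<longlonglongrightarrow> 0)"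
    using typical_dev_sup by (auto elim: eventually_mono)
  obtain A where A: "is_basin \<alpha> \<mu>\<gamma> A" "measure leb01 A = 1" using full_basin[OF c(2)] by blast
  then show "\<exists>A. is_basin \<alpha> (\<lambda>t. SRB (\<gamma> t)) A \<and> measure leb01 A = 1" by blast
  show "physical_family \<alpha> (\<lambda>t. SRB (\<gamma> t))"
    using A SRB_family by (auto simp: physical_family_def prob_family_def)
  show "\<forall>\<mu>. physical_family \<alpha> \<mu> \<longrightarrow> (AE t in leb01. \<mu> t = SRB (\<gamma> t))"
    using physical_unique[OF c(2)] by blast
qed

end
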